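(* Let $n>1$ be an integer. Then $t_{n-1}^G(a)=1/2$ for $0\le a<1$; $t_{n-1}^G(1)=3/4$; $t_{n-1}^G(a)=1$ for $a\ge\sqrt{n}$; and, for $1<a<\sqrt{n}$, $$1-t_{n-1}^G(a)=\max_{1\le k\le n}P\left\{\frac{Z_1+Z_2+\cdots+Z_k}{\sqrt{Z_1^2+Z_2^2+\cdots+Z_k^2}}\ge a\right\}=\max_{a^2<k\le n}P\left(t_{k-1}>\sqrt{\frac{a^2(k-1)}{k-a^2}}\right),$$ where $k$ ranges over integers, $Z_1,\ldots,Z_n$ are independent standard normal random variables, and $t_{k-1}$ is a $t$-distributed random variable with $k-1$ degrees of freedom.
   Context: Let $Z_1,\ldots,Z_n$ be independent standard normal random variables. For $a\ge 0$ the quantity $t_{n-1}^G(a)$ is defined by $$1-t_{n-1}^G(a):=\frac12\sup P\left\{\frac{\left(\sum_{i=1}^n\sigma_iZ_i\right)^2}{\sum_{i=1}^n\sigma_i^2Z_i^2}>a^2\right\},$$ where the supremum is over all non-random numbers $\sigma_1,\ldots,\sigma_n\ge 0$ with $\sigma_i>0$ for at least one $i$. *)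

theory Defs
  imports "HOL-Probability.Probability"
begin

text \<open>
  \<open>tG M Z n a\<close> is the quantity written \<open>t\<close> with superscript \<open>G\<close> and subscript \<open>n - 1\<close>, at \<open>a\<close>:
  the argument \<open>n\<close> is the number of variables \<open>Z 1, \<dots>, Z n\<close>, not the subscript.
  A ratio with zero denominator has the value 0; for \<open>a \<ge> 0\<close> it is then outside the event.
\<close>

definition tG :: "'a measure \<Rightarrow> (nat \<Rightarrow> 'a \<Rightarrow> real) \<Rightarrow> nat \<Rightarrow> real \<Rightarrow> real" where
  "tG M Z n a = 1 - 1 / 2 *
     (SUP \<sigma> \<in> {\<sigma> :: nat \<Rightarrow> real. (\<forall>i\<in>{1..n}. \<sigma> i \<ge> 0) \<and> (\<exists>i\<in>{1..n}. \<sigma> i > 0)}.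
        \<P>(\<omega> in M. (\<Sum>i=1..n. \<sigma> i * Z i \<omega>)\<^sup>2 / (\<Sum>i=1..n. (\<sigma> i)\<^sup>2 * (Z i \<omega>)\<^sup>2) > a\<^sup>2))"

definition student_t_density :: "nat \<Rightarrow> real \<Rightarrow> real" where
  "student_t_density \<nu> x =
     Gamma ((real \<nu> + 1) / 2) / (sqrt (real \<nu> * pi) * Gamma (real \<nu> / 2))
       * (1 + x\<^sup>2 / real \<nu>) powr (- ((real \<nu> + 1) / 2))"

end

theory Submission
  imports Defs
begin

text \<open>
  Write \<open>A = a\<^sup>2\<close>, \<open>L = \<Sum> \<sigma> i * Z i\<close> and \<open>V = \<Sum> (\<sigma> i)\<^sup>2 * (Z i)\<^sup>2\<close>. The event under the supremum is \<open>L\<^sup>2 > A * V\<close>,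
  a cone in \<open>Z\<close>, and it does not change when \<open>\<sigma>\<close> is multiplied by a positive constant. If at most \<open>A\<close>
  of the \<open>\<sigma> i\<close> are positive, the Cauchy-Schwarz inequality makes it empty. Otherwise \<open>\<sigma>\<close> can be scaled
  so that \<open>(\<sigma> i)\<^sup>2 = x i / (1 - x i)\<close> with \<open>x i \<in> [0, 1)\<close> and \<open>\<Sum> x i = A\<close> (\<open>ex_normalising_scale\<close>).

  The normalisation makes the vector \<open>\<xi> i = sqrt (x i * (1 - x i))\<close> an eigenvector, with eigenvalue \<open>A\<close>,
  of the quadratic form \<open>L\<^sup>2 - A * V\<close>; this is its only positive eigenvalue, the form being of rank one
  up to a negative part. Integrating the Gaussian density first along the lines in direction \<open>\<xi>\<close> and
  writing the Gaussian tail that appears there as a mixture of exponentials gives an explicit formula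
  (\<open>nn_integral_gaussian_cone\<close>): the probability is the average of \<open>cone_kernel x (y\<^sup>2)\<close> over a standard
  Cauchy variable \<open>y\<close>.

  It remains to maximise this average over the points \<open>x\<close> of the cube with \<open>\<Sum> x i = A\<close>. Vary two
  coordinates with a fixed sum \<open>\<tau>\<close> and let \<open>p\<close> be their product. For each \<open>y\<close>, the reciprocal of the
  squared kernel is an affine function of \<open>1 / (1 - \<tau> + p)\<close>. Since \<open>t \<mapsto> 1 / sqrt t\<close> is convex, the
  kernel, and with it the average, is convex in that variable and is largest at an end of its range:
  either the two coordinates are equal or one of them vanishes (\<open>cone_kernel_convex_pair\<close>). For \<open>\<tau> \<ge> 1\<close>
  even the kernel itself increases with \<open>p\<close> (\<open>cone_kernel_equalise_pair\<close>). A compactness argument turns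
  this into: the best \<open>\<sigma>\<close> has \<open>k\<close> equal positive entries for some \<open>k > A\<close>, and all others zero
  (\<open>cone_mass_le_equal_mass\<close>). This is the first formula for \<open>1 < a < sqrt n\<close>.

  For the second formula, the tail of Student's distribution is the same Cauchy average up to a constant
  factor, and the factor is found by comparing both sides at \<open>0\<close> (\<open>student_t_tail\<close>). For \<open>a < 1\<close> a
  single positive \<open>\<sigma> i\<close> already gives probability \<open>1\<close>. For \<open>a = 1\<close> one lets \<open>a\<close> decrease to \<open>1\<close>, where
  Bernoulli's inequality shows that \<open>k = 2\<close> is the best choice, with value \<open>1 / 2\<close>.
\<close>

section \<open>Lebesgue measure on coordinate space\<close>

abbreviation coord_lebesgue :: "'i set \<Rightarrow> ('i \<Rightarrow> real) measure" where
  "coord_lebesgue I \<equiv> Pi\<^sub>M I (\<lambda>_. lborel)"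

text \<open>
  The translations (\<open>c = 1\<close>) serve the integration along lines, the reflection at the origin (\<open>c = -1\<close>)
  serves the symmetry of the normal distribution.
\<close>

lemma distr_coord_lebesgue_affine:
  fixes b :: "'i \<Rightarrow> real" and c :: real
  assumes I: "finite I" and c: "\<bar>c\<bar> = 1"
  shows "distr (coord_lebesgue I) (coord_lebesgue I) (\<lambda>z. \<lambda>i\<in>I. b i + c * z i) = coord_lebesgue I"
proof -
  interpret product_sigma_finite "\<lambda>_::'i. lborel :: real measure" by standard
  have [measurable]: "(\<lambda>z. \<lambda>i\<in>I. b i + c * z i) \<in> coord_lebesgue I \<rightarrow>\<^sub>M coord_lebesgue I"
    by (rule measurable_restrict) simp
  show ?thesis
  proof (rule PiM_eqI[OF I])
    fix A :: "'i \<Rightarrow> real set" assume A: "\<And>i. i \<in> I \<Longrightarrow> A i \<in> sets lborel"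
    have A': "(\<lambda>x. b i + c * x) -` A i \<in> sets lborel" if "i \<in> I" for i
      using measurable_sets[of "\<lambda>x. b i + c * x" borel borel "A i"] A[OF that] by simp
    have E: "emeasure lborel ((\<lambda>x. b i + c * x) -` A i) = emeasure lborel (A i)" if "i \<in> I" for i
    proof -
      have "c \<noteq> 0" using c by auto
      then have "emeasure lborel (A i) = emeasure (density (distr lborel borel (\<lambda>x. b i + c * x)) (\<lambda>_. ennreal \<bar>c\<bar>)) (A i)"
        using lborel_real_affine[of c "b i"] by simp
      also have "\<dots> = emeasure (distr lborel borel (\<lambda>x. b i + c * x)) (A i)"
        using A[OF that] c by (simp add: density_1)
      also have "\<dots> = emeasure lborel ((\<lambda>x. b i + c * x) -` A i)"
        using A[OF that] by (subst emeasure_distr) auto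
      finally show ?thesis by simp
    qed
    have eq: "(\<lambda>z. \<lambda>i\<in>I. b i + c * z i) -` Pi\<^sub>E I A \<inter> space (coord_lebesgue I) =
        Pi\<^sub>E I (\<lambda>i. (\<lambda>x. b i + c * x) -` A i)"
      by (auto simp: space_PiM PiE_def Pi_def extensional_def)
    have "emeasure (distr (coord_lebesgue I) (coord_lebesgue I) (\<lambda>z. \<lambda>i\<in>I. b i + c * z i)) (Pi\<^sub>E I A) =
        emeasure (coord_lebesgue I) (Pi\<^sub>E I (\<lambda>i. (\<lambda>x. b i + c * x) -` A i))"
      using A by (subst emeasure_distr) (auto simp: eq intro!: sets_PiM_I_finite I)
    also have "\<dots> = (\<Prod>i\<in>I. emeasure lborel ((\<lambda>x. b i + c * x) -` A i))"
      by (rule emeasure_PiM[OF I A'])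
    also have "\<dots> = (\<Prod>i\<in>I. emeasure lborel (A i))"
      by (intro prod.cong refl E)
    finally show "emeasure (distr (coord_lebesgue I) (coord_lebesgue I) (\<lambda>z. \<lambda>i\<in>I. b i + c * z i)) (Pi\<^sub>E I A) =
        (\<Prod>i\<in>I. emeasure lborel (A i))" .
  qed simp
qed

lemma nn_integral_coord_lebesgue_affine:
  fixes b :: "'i \<Rightarrow> real" and c :: real
  assumes I: "finite I" and c: "\<bar>c\<bar> = 1"
    and f[measurable]: "f \<in> borel_measurable (coord_lebesgue I)"
  shows "(\<integral>\<^sup>+z. f (\<lambda>i\<in>I. b i + c * z i) \<partial>coord_lebesgue I) = (\<integral>\<^sup>+z. f z \<partial>coord_lebesgue I)"
proof -
  have [measurable]: "(\<lambda>z. \<lambda>i\<in>I. b i + c * z i) \<in> coord_lebesgue I \<rightarrow>\<^sub>M coord_lebesgue I"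
    by (rule measurable_restrict) simp
  have "(\<integral>\<^sup>+z. f z \<partial>coord_lebesgue I) =
      (\<integral>\<^sup>+z. f z \<partial>distr (coord_lebesgue I) (coord_lebesgue I) (\<lambda>z. \<lambda>i\<in>I. b i + c * z i))"
    by (simp add: distr_coord_lebesgue_affine[OF I c])
  also have "\<dots> = (\<integral>\<^sup>+z. f (\<lambda>i\<in>I. b i + c * z i) \<partial>coord_lebesgue I)"
    by (rule nn_integral_distr) auto
  finally show ?thesis ..
qed

lemma nn_integral_gaussian_square:
  fixes c b :: real
  assumes c: "c > 0"
  shows "(\<integral>\<^sup>+t. ennreal (exp (- c * (t + b)\<^sup>2 / 2)) \<partial>lborel) = ennreal (sqrt (2 * pi / c))"
proof -
  have "(\<integral>\<^sup>+t. ennreal (exp (- c * (t + b)\<^sup>2 / 2)) \<partial>lborel) =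
      (\<integral>\<^sup>+t. ennreal (sqrt (2 * pi / c)) * ennreal (normal_density (-b) (1 / sqrt c) t) \<partial>lborel)"
    using c by (intro nn_integral_cong)
      (simp add: normal_density_def ennreal_mult'[symmetric] field_simps real_sqrt_divide real_sqrt_mult)
  also have "\<dots> = ennreal (sqrt (2 * pi / c))"
    using c by (simp add: nn_integral_cmult nn_integral_eq_integral)
  finally show ?thesis .
qed

definition line_point :: "'i set \<Rightarrow> ('i \<Rightarrow> real) \<Rightarrow> ('i \<Rightarrow> real) \<Rightarrow> real \<Rightarrow> 'i \<Rightarrow> real" where
  "line_point I \<xi> z t = (\<lambda>i\<in>I. z i + t * \<xi> i)"

lemma line_point_apply[simp]: "i \<in> I \<Longrightarrow> line_point I \<xi> z t i = z i + t * \<xi> i"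
  by (simp add: line_point_def)

lemma measurable_line_point[measurable (raw)]:
  assumes [measurable]: "f \<in> N \<rightarrow>\<^sub>M coord_lebesgue I" "g \<in> borel_measurable N"
  shows "(\<lambda>x. line_point I \<xi> (f x) (g x)) \<in> N \<rightarrow>\<^sub>M coord_lebesgue I"
  unfolding line_point_def
proof (rule measurable_restrict)
  fix i assume "i \<in> I"
  then have [measurable]: "(\<lambda>x. f x i) \<in> borel_measurable N"
    using measurable_compose[OF assms(1) measurable_component_singleton] by simp
  show "(\<lambda>x. f x i + g x * \<xi> i) \<in> N \<rightarrow>\<^sub>M lborel" by simp
qed

lemma measurable_line_point_fixed: "(\<lambda>t. line_point I \<xi> z t) \<in> lborel \<rightarrow>\<^sub>M coord_lebesgue I"
  unfolding line_point_def by (rule measurable_restrict) simp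

text \<open>
  Lebesgue measure is invariant under translation by \<open>t * \<xi>\<close>, so \<open>h\<close> may be replaced by its integral
  along the line through \<open>z\<close>, provided that the points of each line are given total weight one. The
  Gaussian weight in the coordinate \<open>i0\<close> is an arbitrary choice of such a weight; it replaces a
  parametrisation of the set of lines.
\<close>

lemma nn_integral_eq_average_over_lines:
  fixes \<xi> :: "'i \<Rightarrow> real"
  assumes I: "finite I" and i0: "i0 \<in> I" "\<xi> i0 \<noteq> 0"
    and h[measurable]: "h \<in> borel_measurable (coord_lebesgue I)"
  shows "(\<integral>\<^sup>+z. h z \<partial>coord_lebesgue I) =
    (\<integral>\<^sup>+z. ennreal (\<bar>\<xi> i0\<bar> / sqrt (2 * pi) * exp (- (z i0)\<^sup>2 / 2)) *
       (\<integral>\<^sup>+t. h (line_point I \<xi> z t) \<partial>lborel) \<partial>coord_lebesgue I)"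
proof -
  interpret product_sigma_finite "\<lambda>_::'i. lborel :: real measure" by standard
  interpret I: sigma_finite_measure "coord_lebesgue I" by (rule sigma_finite[OF I])
  interpret P: pair_sigma_finite "coord_lebesgue I" "lborel :: real measure" ..
  define k where "k = (\<lambda>x. ennreal (\<bar>\<xi> i0\<bar> / sqrt (2 * pi) * exp (- x\<^sup>2 / 2)))"
  have k[measurable]: "k \<in> borel_measurable borel" unfolding k_def by measurable
  have k1: "(\<integral>\<^sup>+t. k (z - t * \<xi> i0) \<partial>lborel) = 1" for z
  proof -
    have "(\<integral>\<^sup>+t. k (z - t * \<xi> i0) \<partial>lborel) =
        (\<integral>\<^sup>+t. ennreal (\<bar>\<xi> i0\<bar> / sqrt (2 * pi)) * ennreal (exp (- (\<xi> i0)\<^sup>2 * (t + (- z / \<xi> i0))\<^sup>2 / 2)) \<partial>lborel)"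
      using i0 by (intro nn_integral_cong)
        (simp add: k_def ennreal_mult'[symmetric] power2_eq_square field_simps)
    also have "\<dots> = ennreal (\<bar>\<xi> i0\<bar> / sqrt (2 * pi)) * ennreal (sqrt (2 * pi / (\<xi> i0)\<^sup>2))"
      using i0 by (subst nn_integral_cmult) (simp, subst nn_integral_gaussian_square, simp_all)
    also have "\<dots> = 1"
      using i0 by (simp add: ennreal_mult'[symmetric] real_sqrt_divide)
    finally show ?thesis .
  qed
  have inner: "(\<integral>\<^sup>+z. h z * k (z i0 - t * \<xi> i0) \<partial>coord_lebesgue I) =
      (\<integral>\<^sup>+z. h (line_point I \<xi> z t) * k (z i0) \<partial>coord_lebesgue I)" for t
  proof -
    have "(\<integral>\<^sup>+z. h z * k (z i0 - t * \<xi> i0) \<partial>coord_lebesgue I) =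
       (\<integral>\<^sup>+z. h (\<lambda>i\<in>I. t * \<xi> i + 1 * z i) * k ((\<lambda>i\<in>I. t * \<xi> i + 1 * z i) i0 - t * \<xi> i0) \<partial>coord_lebesgue I)"
      using i0 by (subst nn_integral_coord_lebesgue_affine[OF I, symmetric, of 1 _ "\<lambda>i. t * \<xi> i"]) auto
    also have "\<dots> = (\<integral>\<^sup>+z. h (line_point I \<xi> z t) * k (z i0) \<partial>coord_lebesgue I)"
      using i0 by (simp add: add.commute line_point_def)
    finally show ?thesis .
  qed
  have ki[measurable]: "(\<lambda>z. z i0) \<in> borel_measurable (coord_lebesgue I)"
    using measurable_component_singleton[OF i0(1), of "\<lambda>_. lborel :: real measure"] by simp
  have "(\<integral>\<^sup>+z. h z \<partial>coord_lebesgue I) =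
      (\<integral>\<^sup>+z. (\<integral>\<^sup>+t. h z * k (z i0 - t * \<xi> i0) \<partial>lborel) \<partial>coord_lebesgue I)"
    by (simp add: nn_integral_cmult k1)
  also have "\<dots> = (\<integral>\<^sup>+t. (\<integral>\<^sup>+z. h z * k (z i0 - t * \<xi> i0) \<partial>coord_lebesgue I) \<partial>lborel)"
    by (rule P.Fubini'[symmetric]) measurable
  also have "\<dots> = (\<integral>\<^sup>+t. (\<integral>\<^sup>+z. h (line_point I \<xi> z t) * k (z i0) \<partial>coord_lebesgue I) \<partial>lborel)"
    by (simp add: inner)
  also have "\<dots> = (\<integral>\<^sup>+z. (\<integral>\<^sup>+t. h (line_point I \<xi> z t) * k (z i0) \<partial>lborel) \<partial>coord_lebesgue I)"
    by (rule P.Fubini') measurable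
  also have "\<dots> = (\<integral>\<^sup>+z. k (z i0) * (\<integral>\<^sup>+t. h (line_point I \<xi> z t) \<partial>lborel) \<partial>coord_lebesgue I)"
    using measurable_compose[OF measurable_line_point_fixed h]
    by (intro nn_integral_cong) (subst nn_integral_multc, simp, simp only: mult.commute)
  finally show ?thesis by (simp add: k_def)
qed

text \<open>
  This is how the indicator of a cone is exchanged for an integrand that can be computed and, with
  \<open>g = 0\<close>, how the boundary of a cone is seen to be a null set.
\<close>

lemma nn_integral_eq_if_line_integrals_eq:
  fixes \<xi> :: "'i \<Rightarrow> real"
  assumes I: "finite I" and i0: "i0 \<in> I" "\<xi> i0 \<noteq> 0"
    and f: "f \<in> borel_measurable (coord_lebesgue I)" and g: "g \<in> borel_measurable (coord_lebesgue I)"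
    and eq: "\<And>z. (\<integral>\<^sup>+t. f (line_point I \<xi> z t) \<partial>lborel) = (\<integral>\<^sup>+t. g (line_point I \<xi> z t) \<partial>lborel)"
  shows "(\<integral>\<^sup>+z. f z \<partial>coord_lebesgue I) = (\<integral>\<^sup>+z. g z \<partial>coord_lebesgue I)"
  unfolding nn_integral_eq_average_over_lines[where \<xi> = \<xi>, OF I i0 f]
    nn_integral_eq_average_over_lines[where \<xi> = \<xi>, OF I i0 g] eq ..

section \<open>One-dimensional and quadratic Gaussian integrals\<close>

lemma nn_integral_even:
  fixes f :: "real \<Rightarrow> ennreal"
  assumes [measurable]: "f \<in> borel_measurable borel" and even: "\<And>x. f (- x) = f x"
  shows "(\<integral>\<^sup>+x. f x \<partial>lborel) = 2 * (\<integral>\<^sup>+x. f x * indicator {0..} x \<partial>lborel)"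
proof -
  have "(\<integral>\<^sup>+x. f x \<partial>lborel) = (\<integral>\<^sup>+x. f x * indicator {0..} x + f x * indicator {0..} (-x) \<partial>lborel)"
  proof (rule nn_integral_cong_AE)
    have "AE x in lborel. x \<noteq> (0::real)" by (rule AE_lborel_singleton)
    then show "AE x in lborel. f x = f x * indicator {0..} x + f x * indicator {0..} (-x)"
      by eventually_elim (auto simp: indicator_def)
  qed
  also have "\<dots> = (\<integral>\<^sup>+x. f x * indicator {0..} x \<partial>lborel) + (\<integral>\<^sup>+x. f x * indicator {0..} (-x) \<partial>lborel)"
    by (rule nn_integral_add) measurable
  also have "(\<integral>\<^sup>+x. f x * indicator {0..} (-x) \<partial>lborel) = (\<integral>\<^sup>+x. f x * indicator {0..} x \<partial>lborel)"
    by (subst nn_integral_real_affine[where c = "-1" and t = 0]) (auto simp: even)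
  finally show ?thesis by (simp add: mult_2)
qed

text \<open>
  Both sides are the integral of \<open>s * exp (- s\<^sup>2 * (1 + y\<^sup>2) / 2)\<close> over \<open>s \<ge> sqrt q\<close> and all \<open>y\<close>, up to the
  same constant, taken in the two possible orders. The point of the right-hand side is that \<open>q\<close> enters
  exponentially, so that a quadratic form \<open>q\<close> leads to Gaussian integrals.
\<close>

lemma gaussian_tail_eq_cauchy_mixture:
  fixes q :: real
  assumes q: "q \<ge> 0"
  shows "(\<integral>\<^sup>+s. ennreal (exp (- s\<^sup>2 / 2)) * indicator {s. s\<^sup>2 > q} s \<partial>lborel) =
     ennreal (sqrt (2 * pi) / pi) * (\<integral>\<^sup>+y. ennreal (exp (- q * (1 + y\<^sup>2) / 2) / (1 + y\<^sup>2)) \<partial>lborel)"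
proof -
  have pos: "1 + y\<^sup>2 > 0" for y :: real by (simp add: add_pos_nonneg)
  have A: "(\<integral>\<^sup>+s. ennreal (s * exp (- s\<^sup>2 * (1 + y\<^sup>2) / 2)) * indicator {sqrt q ..} s \<partial>lborel) =
      ennreal (exp (- q * (1 + y\<^sup>2) / 2) / (1 + y\<^sup>2))" for y :: real
  proof -
    let ?F = "\<lambda>s. - exp (- s\<^sup>2 * (1 + y\<^sup>2) / 2) / (1 + y\<^sup>2)"
    have p: "1 + y\<^sup>2 > 0" by (rule pos)
    have lim: "(?F \<longlongrightarrow> 0) at_top"
      using p by real_asymp
    have "(\<integral>\<^sup>+s. ennreal (s * exp (- s\<^sup>2 * (1 + y\<^sup>2) / 2)) * indicator {sqrt q ..} s \<partial>lborel) = ennreal (0 - ?F (sqrt q))"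
    proof (rule nn_integral_FTC_atLeast[OF _ _ _ lim])
      fix s assume s: "sqrt q \<le> s"
      have "s \<ge> 0" using s q by (meson order_trans real_sqrt_ge_zero)
      then show "0 \<le> s * exp (- s\<^sup>2 * (1 + y\<^sup>2) / 2)" by simp
      show "(?F has_real_derivative s * exp (- s\<^sup>2 * (1 + y\<^sup>2) / 2)) (at s)"
      proof -
        define c where "c = 1 + y\<^sup>2"
        have c: "c \<noteq> 0" using p c_def by simp
        have "((\<lambda>s. - exp (- s\<^sup>2 * c / 2) / c) has_real_derivative s * exp (- s\<^sup>2 * c / 2)) (at s)"
          using c by (auto intro!: derivative_eq_intros)
        then show ?thesis by (simp add: c_def)
      qed
    qed simp
    then show ?thesis using q by simp
  qed
  have half: "(\<integral>\<^sup>+y. ennreal (exp (- q * (1 + y\<^sup>2) / 2) / (1 + y\<^sup>2)) \<partial>lborel) =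
      ennreal (sqrt (2 * pi)) * (\<integral>\<^sup>+s. ennreal (exp (- s\<^sup>2 / 2)) * indicator {sqrt q <..} s \<partial>lborel)"
  proof -
    have "(\<integral>\<^sup>+y. ennreal (exp (- q * (1 + y\<^sup>2) / 2) / (1 + y\<^sup>2)) \<partial>lborel) =
       (\<integral>\<^sup>+y. (\<integral>\<^sup>+s. ennreal (s * exp (- s\<^sup>2 * (1 + y\<^sup>2) / 2)) * indicator {sqrt q ..} s \<partial>lborel) \<partial>lborel)"
      by (simp only: A)
    also have "\<dots> = (\<integral>\<^sup>+s. (\<integral>\<^sup>+y. ennreal (s * exp (- s\<^sup>2 * (1 + y\<^sup>2) / 2)) * indicator {sqrt q ..} s \<partial>lborel) \<partial>lborel)"
      by (rule lborel_pair.Fubini') measurable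
    also have "\<dots> = (\<integral>\<^sup>+s. ennreal (sqrt (2 * pi)) * (ennreal (exp (- s\<^sup>2 / 2)) * indicator {sqrt q <..} s) \<partial>lborel)"
    proof (rule nn_integral_cong_AE)
      have "AE s in lborel. s \<noteq> sqrt q" by (rule AE_lborel_singleton)
      then show "AE s in lborel. (\<integral>\<^sup>+y. ennreal (s * exp (- s\<^sup>2 * (1 + y\<^sup>2) / 2)) * indicator {sqrt q ..} s \<partial>lborel) =
         ennreal (sqrt (2 * pi)) * (ennreal (exp (- s\<^sup>2 / 2)) * indicator {sqrt q <..} s)"
      proof eventually_elim
        case (elim s)
        show ?case
        proof (cases "s > sqrt q")
          case True
          then have s: "s > 0" using q by (meson le_less_trans real_sqrt_ge_zero)
          have "(\<integral>\<^sup>+y. ennreal (s * exp (- s\<^sup>2 * (1 + y\<^sup>2) / 2)) * indicator {sqrt q ..} s \<partial>lborel) =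
             (\<integral>\<^sup>+y. ennreal (s * exp (- s\<^sup>2 / 2)) * ennreal (exp (- s\<^sup>2 * (y + 0)\<^sup>2 / 2)) \<partial>lborel)"
            using True s by (intro nn_integral_cong)
              (simp add: ennreal_mult'[symmetric] exp_add[symmetric] field_simps)
          also have "\<dots> = ennreal (s * exp (- s\<^sup>2 / 2)) * ennreal (sqrt (2 * pi / s\<^sup>2))"
            using s by (subst nn_integral_cmult) (simp, subst nn_integral_gaussian_square, simp_all)
          also have "\<dots> = ennreal (sqrt (2 * pi)) * ennreal (exp (- s\<^sup>2 / 2))"
            using s by (simp add: ennreal_mult'[symmetric] real_sqrt_divide)
          finally show ?thesis using True by simp
        next
          case False
          then show ?thesis using elim by simp
        qed
      qed
    qed
    also have "\<dots> = ennreal (sqrt (2 * pi)) * (\<integral>\<^sup>+s. ennreal (exp (- s\<^sup>2 / 2)) * indicator {sqrt q <..} s \<partial>lborel)"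
      by (rule nn_integral_cmult) measurable
    finally show ?thesis .
  qed
  have split: "s\<^sup>2 > q \<longleftrightarrow> s > sqrt q" if "s \<ge> 0" for s
    using that real_sqrt_less_iff[of q "s\<^sup>2"] by simp
  have pos_s: "s \<ge> 0" if "s > sqrt q" for s
    using that real_sqrt_ge_zero[OF q] by linarith
  have "(\<integral>\<^sup>+s. ennreal (exp (- s\<^sup>2 / 2)) * indicator {s. s\<^sup>2 > q} s \<partial>lborel) =
     2 * (\<integral>\<^sup>+s. ennreal (exp (- s\<^sup>2 / 2)) * indicator {s. s\<^sup>2 > q} s * indicator {0..} s \<partial>lborel)"
    by (rule nn_integral_even) (auto simp: indicator_def)
  also have "(\<integral>\<^sup>+s. ennreal (exp (- s\<^sup>2 / 2)) * indicator {s. s\<^sup>2 > q} s * indicator {0..} s \<partial>lborel) =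
     (\<integral>\<^sup>+s. ennreal (exp (- s\<^sup>2 / 2)) * indicator {sqrt q <..} s \<partial>lborel)"
    by (intro nn_integral_cong) (auto simp: indicator_def split pos_s)
  finally have two: "(\<integral>\<^sup>+s. ennreal (exp (- s\<^sup>2 / 2)) * indicator {s. s\<^sup>2 > q} s \<partial>lborel) =
     2 * (\<integral>\<^sup>+s. ennreal (exp (- s\<^sup>2 / 2)) * indicator {sqrt q <..} s \<partial>lborel)" .
  have "sqrt (2 * pi) / pi * sqrt (2 * pi) = 2" by (simp add: field_simps)
  then have "ennreal (sqrt (2 * pi) / pi) * ennreal (sqrt (2 * pi)) = 2"
    by (metis ennreal_mult' ennreal_numeral divide_nonneg_nonneg pi_ge_zero real_sqrt_ge_zero mult_nonneg_nonneg zero_le_numeral)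
  then show ?thesis
    unfolding two half by (simp add: mult.assoc[symmetric])
qed

text \<open>
  The preceding identity at \<open>q = 0\<close>, where the left-hand side is the full Gaussian integral.
\<close>

lemma nn_integral_inverse_1_plus_square:
  "(\<integral>\<^sup>+y. ennreal (1 / (1 + y\<^sup>2)) \<partial>lborel) = ennreal pi"
proof -
  have "AE s in lborel. s \<noteq> (0::real)" by (rule AE_lborel_singleton)
  then have "(\<integral>\<^sup>+s. ennreal (exp (- s\<^sup>2 / 2)) * indicator {s. s\<^sup>2 > 0} s \<partial>lborel) =
      (\<integral>\<^sup>+s. ennreal (exp (- 1 * (s + 0)\<^sup>2 / 2)) \<partial>lborel)"
    by (intro nn_integral_cong_AE) (auto simp: indicator_def)
  also have "\<dots> = ennreal (sqrt (2 * pi))"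
    by (subst nn_integral_gaussian_square) auto
  finally have *: "ennreal (sqrt (2 * pi) / pi) * (\<integral>\<^sup>+y. ennreal (1 / (1 + y\<^sup>2)) \<partial>lborel) = ennreal (sqrt (2 * pi))"
    using gaussian_tail_eq_cauchy_mixture[of 0] by simp
  have "(\<integral>\<^sup>+y. ennreal (1 / (1 + y\<^sup>2)) \<partial>lborel) =
     ennreal (pi / sqrt (2 * pi)) * (ennreal (sqrt (2 * pi) / pi) * (\<integral>\<^sup>+y. ennreal (1 / (1 + y\<^sup>2)) \<partial>lborel))"
    by (simp add: mult.assoc[symmetric] ennreal_mult'[symmetric])
  also have "\<dots> = ennreal pi"
    unfolding * by (simp add: ennreal_mult'[symmetric])
  finally show ?thesis .
qed

lemma nn_integral_gaussian_two_squares: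
  fixes d M c \<xi> :: real
  assumes d: "d > 0" and M: "M \<ge> 0"
  shows "(\<integral>\<^sup>+y. ennreal (exp (- (d * y\<^sup>2 + M * (c + \<xi> * y)\<^sup>2) / 2)) \<partial>lborel) =
    ennreal (sqrt (2 * pi / (d + M * \<xi>\<^sup>2)) * exp (- (M * d / (d + M * \<xi>\<^sup>2)) * c\<^sup>2 / 2))"
proof -
  define D where "D = d + M * \<xi>\<^sup>2"
  have D: "D > 0" using d M by (simp add: D_def add_pos_nonneg)
  have sq: "d * y\<^sup>2 + M * (c + \<xi> * y)\<^sup>2 = D * (y + M * c * \<xi> / D)\<^sup>2 + M * d / D * c\<^sup>2" for y
  proof -
    have "D * (d * y\<^sup>2 + M * (c + \<xi> * y)\<^sup>2) = (D * y + M * c * \<xi>)\<^sup>2 + M * d * c\<^sup>2"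
      unfolding D_def by algebra
    also have "\<dots> = D * (D * (y + M * c * \<xi> / D)\<^sup>2 + M * d / D * c\<^sup>2)"
      using D by (simp add: field_simps power2_eq_square)
    finally show ?thesis using D by simp
  qed
  have "(\<integral>\<^sup>+y. ennreal (exp (- (d * y\<^sup>2 + M * (c + \<xi> * y)\<^sup>2) / 2)) \<partial>lborel) =
     (\<integral>\<^sup>+y. ennreal (exp (- (M * d / D) * c\<^sup>2 / 2)) * ennreal (exp (- D * (y + M * c * \<xi> / D)\<^sup>2 / 2)) \<partial>lborel)"
    unfolding sq by (intro nn_integral_cong)
      (simp add: ennreal_mult'[symmetric] exp_add[symmetric] add_divide_distrib)
  also have "\<dots> = ennreal (exp (- (M * d / D) * c\<^sup>2 / 2)) * ennreal (sqrt (2 * pi / D))"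
    by (subst nn_integral_cmult) (simp, subst nn_integral_gaussian_square[OF D], simp)
  finally show ?thesis unfolding D_def using d M by (simp add: ennreal_mult'[symmetric] mult.commute)
qed

text \<open>
  A diagonal quadratic form plus \<open>m\<close> times the square of one affine form. Integrating out one coordinate
  leaves an integrand of the same shape with another \<open>m\<close>, so induction on the set of coordinates
  avoids determinants. The shift \<open>c\<close> is there for the induction.
\<close>

lemma nn_integral_gaussian_rank_one_perturbation:
  fixes d \<xi> :: "'i \<Rightarrow> real" and m c :: real
  assumes "finite I" and "\<And>i. i \<in> I \<Longrightarrow> d i > 0" and m: "m \<ge> 0"
  shows "(\<integral>\<^sup>+z. ennreal (exp (- ((\<Sum>i\<in>I. d i * (z i)\<^sup>2) + m * (c + (\<Sum>i\<in>I. \<xi> i * z i))\<^sup>2) / 2)) \<partial>coord_lebesgue I) =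
    ennreal ((\<Prod>i\<in>I. sqrt (2 * pi / d i)) / sqrt (1 + m * (\<Sum>i\<in>I. (\<xi> i)\<^sup>2 / d i)) *
       exp (- (m / (1 + m * (\<Sum>i\<in>I. (\<xi> i)\<^sup>2 / d i))) * c\<^sup>2 / 2))"
  using assms(1,2)
proof (induction I arbitrary: c rule: finite_induct)
  case empty
  interpret product_sigma_finite "\<lambda>_::'i. lborel :: real measure" by standard
  show ?case by (subst nn_integral_empty) simp_all
next
  case (insert i I)
  interpret product_sigma_finite "\<lambda>_::'i. lborel :: real measure" by standard
  define S where "S = (\<Sum>i\<in>I. (\<xi> i)\<^sup>2 / d i)"
  define M where "M = m / (1 + m * S)"
  define K where "K = (\<Prod>i\<in>I. sqrt (2 * pi / d i)) / sqrt (1 + m * S)"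
  have di: "d i > 0" using insert.prems by simp
  have S: "S \<ge> 0" unfolding S_def using insert.prems by (intro sum_nonneg divide_nonneg_pos) auto
  have S1: "1 + m * S > 0" using S m by (simp add: add_pos_nonneg)
  have M: "M \<ge> 0" using m S1 by (simp add: M_def)
  have K: "K \<ge> 0" unfolding K_def using S1 insert.prems by (intro divide_nonneg_nonneg prod_nonneg) (auto intro: less_imp_le)
  have "(\<integral>\<^sup>+z. ennreal (exp (- ((\<Sum>j\<in>insert i I. d j * (z j)\<^sup>2) + m * (c + (\<Sum>j\<in>insert i I. \<xi> j * z j))\<^sup>2) / 2))
        \<partial>coord_lebesgue (insert i I)) =
     (\<integral>\<^sup>+y. (\<integral>\<^sup>+z. ennreal (exp (- ((\<Sum>j\<in>insert i I. d j * ((z(i := y)) j)\<^sup>2) + m * (c + (\<Sum>j\<in>insert i I. \<xi> j * (z(i := y)) j))\<^sup>2) / 2))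
        \<partial>coord_lebesgue I) \<partial>lborel)"
    using insert.hyps by (intro product_nn_integral_insert_rev) auto
  also have "\<dots> = (\<integral>\<^sup>+y. ennreal K * ennreal (exp (- (d i * y\<^sup>2 + M * (c + \<xi> i * y)\<^sup>2) / 2)) \<partial>lborel)"
  proof (rule nn_integral_cong)
    fix y :: real
    have s1: "(\<Sum>j\<in>insert i I. d j * ((z(i := y)) j)\<^sup>2) = d i * y\<^sup>2 + (\<Sum>j\<in>I. d j * (z j)\<^sup>2)" for z
      using insert.hyps by (auto intro!: sum.cong)
    have s2: "(\<Sum>j\<in>insert i I. \<xi> j * (z(i := y)) j) = \<xi> i * y + (\<Sum>j\<in>I. \<xi> j * z j)" for z
      using insert.hyps by (auto intro!: sum.cong)
    have "(\<integral>\<^sup>+z. ennreal (exp (- ((\<Sum>j\<in>insert i I. d j * ((z(i := y)) j)\<^sup>2) + m * (c + (\<Sum>j\<in>insert i I. \<xi> j * (z(i := y)) j))\<^sup>2) / 2))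
        \<partial>coord_lebesgue I) =
      (\<integral>\<^sup>+z. ennreal (exp (- d i * y\<^sup>2 / 2)) *
         ennreal (exp (- ((\<Sum>i\<in>I. d i * (z i)\<^sup>2) + m * ((c + \<xi> i * y) + (\<Sum>i\<in>I. \<xi> i * z i))\<^sup>2) / 2)) \<partial>coord_lebesgue I)"
      unfolding s1 s2
      by (intro nn_integral_cong) (simp add: ennreal_mult'[symmetric] exp_add[symmetric] add_divide_distrib add.assoc)
    also have "\<dots> = ennreal (exp (- d i * y\<^sup>2 / 2)) * ennreal (K * exp (- M * (c + \<xi> i * y)\<^sup>2 / 2))"
    proof (subst nn_integral_cmult)
      have "\<And>j. j \<in> I \<Longrightarrow> d j > 0" using insert.prems by simp
      then show "ennreal (exp (- d i * y\<^sup>2 / 2)) * (\<integral>\<^sup>+z. ennreal (exp (- ((\<Sum>i\<in>I. d i * (z i)\<^sup>2) +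
           m * ((c + \<xi> i * y) + (\<Sum>i\<in>I. \<xi> i * z i))\<^sup>2) / 2)) \<partial>coord_lebesgue I) =
         ennreal (exp (- d i * y\<^sup>2 / 2)) * ennreal (K * exp (- M * (c + \<xi> i * y)\<^sup>2 / 2))"
        by (subst insert.IH) (simp_all add: K_def M_def S_def)
    qed measurable
    also have "\<dots> = ennreal K * ennreal (exp (- (d i * y\<^sup>2 + M * (c + \<xi> i * y)\<^sup>2) / 2))"
      using K by (simp add: ennreal_mult'[symmetric] exp_add[symmetric] add_divide_distrib)
    finally show "(\<integral>\<^sup>+z. ennreal (exp (- ((\<Sum>j\<in>insert i I. d j * ((z(i := y)) j)\<^sup>2) + m * (c + (\<Sum>j\<in>insert i I. \<xi> j * (z(i := y)) j))\<^sup>2) / 2))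
        \<partial>coord_lebesgue I) = ennreal K * ennreal (exp (- (d i * y\<^sup>2 + M * (c + \<xi> i * y)\<^sup>2) / 2))" .
  qed
  also have "\<dots> = ennreal K * ennreal (sqrt (2 * pi / (d i + M * (\<xi> i)\<^sup>2)) * exp (- (M * d i / (d i + M * (\<xi> i)\<^sup>2)) * c\<^sup>2 / 2))"
    by (subst nn_integral_cmult) (simp, subst nn_integral_gaussian_two_squares[OF di M], simp)
  also have "\<dots> = ennreal (K * sqrt (2 * pi / (d i + M * (\<xi> i)\<^sup>2)) * exp (- (M * d i / (d i + M * (\<xi> i)\<^sup>2)) * c\<^sup>2 / 2))"
    using K by (simp add: ennreal_mult'[symmetric] mult.assoc)
  also have "K * sqrt (2 * pi / (d i + M * (\<xi> i)\<^sup>2)) =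
      (\<Prod>j\<in>insert i I. sqrt (2 * pi / d j)) / sqrt (1 + m * (\<Sum>j\<in>insert i I. (\<xi> j)\<^sup>2 / d j))"
  proof -
    have "(1 + m * S) * (d i + M * (\<xi> i)\<^sup>2) = d i * (1 + m * ((\<xi> i)\<^sup>2 / d i + S))"
      using S1 di by (simp add: M_def field_simps)
    then have "sqrt (1 + m * S) * sqrt (d i + M * (\<xi> i)\<^sup>2) = sqrt (d i) * sqrt (1 + m * ((\<xi> i)\<^sup>2 / d i + S))"
      by (simp add: real_sqrt_mult[symmetric])
    then show ?thesis
      using insert.hyps by (simp add: K_def S_def[symmetric] real_sqrt_divide)
  qed
  also have "M * d i / (d i + M * (\<xi> i)\<^sup>2) = m / (1 + m * (\<Sum>j\<in>insert i I. (\<xi> j)\<^sup>2 / d j))"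
  proof -
    have p: "d i + M * (\<xi> i)\<^sup>2 > 0" using di M by (simp add: add_pos_nonneg)
    have p2: "1 + m * ((\<xi> i)\<^sup>2 / d i + S) > 0" using di m S by (simp add: add_pos_nonneg)
    have "(1 + m * S) * (d i + M * (\<xi> i)\<^sup>2) = d i * (1 + m * ((\<xi> i)\<^sup>2 / d i + S))"
      using S1 di by (simp add: M_def field_simps)
    moreover have "M * d i / (d i + M * (\<xi> i)\<^sup>2) = (1 + m * S) * (M * d i) / ((1 + m * S) * (d i + M * (\<xi> i)\<^sup>2))"
      using S1 by simp
    moreover have "(1 + m * S) * (M * d i) = d i * m"
      using S1 by (simp add: M_def)
    ultimately have "M * d i / (d i + M * (\<xi> i)\<^sup>2) = (d i * m) / (d i * (1 + m * ((\<xi> i)\<^sup>2 / d i + S)))"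
      by simp
    then show ?thesis
      using insert.hyps di by (simp add: S_def[symmetric])
  qed
  finally show ?case .
qed

section \<open>The probability of a Gaussian cone\<close>

text \<open>
  Let \<open>A = \<Sum> x i\<close>, \<open>(\<sigma> i)\<^sup>2 = x i / (1 - x i)\<close>, and let \<open>Q\<close> be the symmetric matrix of the form
  \<open>(\<Sum> \<sigma> i * z i)\<^sup>2 - A * (\<Sum> (\<sigma> i)\<^sup>2 * (z i)\<^sup>2)\<close>, whose largest eigenvalue is \<open>A\<close>. For \<open>u > 0\<close> the square
  of the kernel is \<open>u / - det (1 - ((1 + u) / A) * Q)\<close>.
\<close>

definition cone_kernel :: "'i set \<Rightarrow> ('i \<Rightarrow> real) \<Rightarrow> real \<Rightarrow> real" where
  "cone_kernel I x u = sqrt ((\<Sum>i\<in>I. x i) * (\<Prod>i\<in>I. 1 - x i) /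
     ((\<Prod>i\<in>I. 1 + u * x i) * (\<Sum>i\<in>I. x i * (1 - x i) / (1 + u * x i))))"

lemma sqrt_prod: "sqrt (\<Prod>i\<in>I. f i) = (\<Prod>i\<in>I. sqrt (f i))"
  by (induction I rule: infinite_finite_induct) (auto simp: real_sqrt_mult)

text \<open>
  Here \<open>L\<close>, \<open>V\<close> are as in the introduction, \<open>Y = \<Sum> \<xi> i * z i\<close> and \<open>\<kappa> = \<Sum> (\<xi> i)\<^sup>2\<close>. Since \<open>\<xi>\<close> is an
  eigenvector with eigenvalue \<open>A\<close>, one has \<open>L\<^sup>2 - A * V = A * (Y\<^sup>2 / \<kappa> - q)\<close> with \<open>q \<ge> 0\<close> constant along
  the lines in direction \<open>\<xi>\<close>. On such a line the indicator of the cone integrates to a Gaussian tail,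
  hence to a mixture of \<open>exp (- q * (1 + y\<^sup>2) / 2)\<close>. The same line integrals arise from a second
  integrand, in which \<open>q\<close> is replaced by \<open>q + L\<^sup>2 / A = V + Y\<^sup>2 / \<kappa>\<close>. This choice removes the square \<open>L\<^sup>2\<close>,
  the only negative term of \<open>q\<close>; what is left is a diagonal form plus the single square \<open>Y\<^sup>2\<close>, whose
  Gaussian integral is known.
\<close>

lemma nn_integral_gaussian_cone:
  fixes I :: "'i set" and x :: "'i \<Rightarrow> real"
  defines "A \<equiv> (\<Sum>i\<in>I. x i)"
  defines "\<sigma> \<equiv> (\<lambda>i. sqrt (x i / (1 - x i)))"
  assumes I: "finite I" and x0: "\<And>i. i \<in> I \<Longrightarrow> 0 \<le> x i" and x1: "\<And>i. i \<in> I \<Longrightarrow> x i < 1"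
    and i0: "i0 \<in> I" "x i0 > 0"
  shows "(\<integral>\<^sup>+z. ennreal (\<Prod>i\<in>I. std_normal_density (z i)) *
       indicator {z. (\<Sum>i\<in>I. \<sigma> i * z i)\<^sup>2 > A * (\<Sum>i\<in>I. (\<sigma> i)\<^sup>2 * (z i)\<^sup>2)} z \<partial>coord_lebesgue I) =
     ennreal (1 / pi) * (\<integral>\<^sup>+y. ennreal (cone_kernel I x (y\<^sup>2) / (1 + y\<^sup>2)) \<partial>lborel)"
proof -
  interpret product_sigma_finite "\<lambda>_::'i. lborel :: real measure" by standard
  interpret I: sigma_finite_measure "coord_lebesgue I" by (rule sigma_finite[OF I])
  interpret P: pair_sigma_finite "coord_lebesgue I" "lborel :: real measure" ..
  define \<xi> where "\<xi> = (\<lambda>i. sqrt (x i * (1 - x i)))"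
  define \<kappa> where "\<kappa> = (\<Sum>i\<in>I. x i * (1 - x i))"
  define c0 where "c0 = (1 / sqrt (2 * pi)) ^ card I"
  define L where "L = (\<lambda>z. \<Sum>i\<in>I. \<sigma> i * z i)"
  define V where "V = (\<lambda>z. \<Sum>i\<in>I. (\<sigma> i)\<^sup>2 * (z i)\<^sup>2)"
  define Y where "Y = (\<lambda>z. \<Sum>i\<in>I. \<xi> i * z i)"
  define S where "S = (\<lambda>z::'i \<Rightarrow> real. \<Sum>i\<in>I. (z i)\<^sup>2)"
  have c0: "c0 > 0" unfolding c0_def by simp
  have A: "A > 0" unfolding A_def using i0 x0 I by (meson sum_pos2)
  have "x i0 * (1 - x i0) > 0" using i0 x1 by simp
  moreover have "x i * (1 - x i) \<ge> 0" if "i \<in> I" for i using x0[OF that] x1[OF that] by simp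
  ultimately have \<kappa>: "\<kappa> > 0" unfolding \<kappa>_def using i0(1) I by (meson sum_pos2)
  have [measurable]: "L \<in> borel_measurable (coord_lebesgue I)" "V \<in> borel_measurable (coord_lebesgue I)"
    "Y \<in> borel_measurable (coord_lebesgue I)" "S \<in> borel_measurable (coord_lebesgue I)"
    unfolding L_def V_def Y_def S_def by measurable
  \<comment> \<open>How the linear and quadratic forms change along the lines in direction \<open>\<xi>\<close>. The essential relation is
    \<open>\<sigma> i * (1 - x i) = \<xi> i\<close>, which is what makes \<open>\<xi>\<close> an eigenvector.\<close>
  have \<sigma>\<xi>: "\<sigma> i * \<xi> i = x i" if "i \<in> I" for i
    using x0[OF that] x1[OF that] by (simp add: \<sigma>_def \<xi>_def real_sqrt_mult[symmetric])
  have \<sigma>2\<xi>: "(\<sigma> i)\<^sup>2 * \<xi> i = \<sigma> i - \<xi> i" if "i \<in> I" for i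
  proof -
    have "\<xi> i = \<sigma> i * (1 - x i)"
    proof -
      have s: "sqrt (1 - x i) * sqrt (1 - x i) = 1 - x i" "sqrt (1 - x i) > 0" using x1[OF that] by auto
      have "\<sigma> i * (1 - x i) = sqrt (x i) / sqrt (1 - x i) * (sqrt (1 - x i) * sqrt (1 - x i))"
        unfolding s(1) by (simp add: \<sigma>_def real_sqrt_divide)
      also have "\<dots> = sqrt (x i) * sqrt (1 - x i)" using s(2) unfolding mult.assoc[symmetric] by (simp del: real_sqrt_gt_0_iff)
      also have "\<dots> = \<xi> i" by (simp add: \<xi>_def real_sqrt_mult)
      finally show ?thesis ..
    qed
    then show ?thesis using \<sigma>\<xi>[OF that] by (simp add: power2_eq_square algebra_simps)
  qed
  have \<xi>2: "\<xi> i * \<xi> i = x i * (1 - x i)" if "i \<in> I" for i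
    using x0[OF that] x1[OF that] by (simp add: \<xi>_def)
  have L_line: "L (line_point I \<xi> z t) = L z + t * A" for z t
    using \<sigma>\<xi> by (simp add: L_def A_def sum_distrib_left sum.distrib[symmetric] algebra_simps)
  have Y_line: "Y (line_point I \<xi> z t) = Y z + t * \<kappa>" for z t
    using \<xi>2 by (simp add: Y_def \<kappa>_def sum_distrib_left sum.distrib[symmetric] distrib_left mult.left_commute)
  have S_line: "S (line_point I \<xi> z t) = S z + 2 * t * Y z + t\<^sup>2 * \<kappa>" for z t
  proof -
    have "S (line_point I \<xi> z t) = (\<Sum>i\<in>I. (z i)\<^sup>2 + 2 * t * (\<xi> i * z i) + t\<^sup>2 * (\<xi> i * \<xi> i))"
      unfolding S_def by (intro sum.cong) (auto simp: power2_eq_square algebra_simps)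
    then show ?thesis using \<xi>2 by (simp add: S_def Y_def \<kappa>_def sum.distrib sum_distrib_left)
  qed
  have V_line: "V (line_point I \<xi> z t) = V z + 2 * t * (L z - Y z) + t\<^sup>2 * (A - \<kappa>)" for z t
  proof -
    have "(\<sigma> i)\<^sup>2 * (z i + t * \<xi> i)\<^sup>2 = (\<sigma> i)\<^sup>2 * (z i)\<^sup>2 + 2 * t * (\<sigma> i * z i - \<xi> i * z i) + t\<^sup>2 * (x i - x i * (1 - x i))"
      if i: "i \<in> I" for i
    proof -
      have "(\<sigma> i)\<^sup>2 * (z i + t * \<xi> i)\<^sup>2 = (\<sigma> i)\<^sup>2 * (z i)\<^sup>2 + 2 * t * z i * ((\<sigma> i)\<^sup>2 * \<xi> i) + t\<^sup>2 * ((\<sigma> i)\<^sup>2 * \<xi> i) * \<xi> i"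
        by (simp add: power2_eq_square algebra_simps)
      also have "\<dots> = (\<sigma> i)\<^sup>2 * (z i)\<^sup>2 + 2 * t * z i * (\<sigma> i - \<xi> i) + t\<^sup>2 * (\<sigma> i * \<xi> i - \<xi> i * \<xi> i)"
        unfolding \<sigma>2\<xi>[OF i] by (simp add: algebra_simps)
      finally show ?thesis unfolding \<sigma>\<xi>[OF i] \<xi>2[OF i] by (simp add: algebra_simps)
    qed
    then have "V (line_point I \<xi> z t) = (\<Sum>i\<in>I. (\<sigma> i)\<^sup>2 * (z i)\<^sup>2 + 2 * t * (\<sigma> i * z i - \<xi> i * z i) + t\<^sup>2 * (x i - x i * (1 - x i)))"
      unfolding V_def by (intro sum.cong) auto
    then show ?thesis
      by (simp add: V_def L_def Y_def A_def \<kappa>_def sum.distrib sum_distrib_left[symmetric] sum_subtractf)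
  qed
  define q where "q = (\<lambda>z. V z - (L z)\<^sup>2 / A + (Y z)\<^sup>2 / \<kappa>)"
  define N where "N = (\<lambda>z. S z - (Y z)\<^sup>2 / \<kappa>)"
  \<comment> \<open>\<open>q\<close> is constant along the line, and nonnegative at the point of the line where \<open>L\<close> vanishes.\<close>
  have q0: "q z \<ge> 0" for z
  proof -
    let ?t = "- L z / A"
    have "0 \<le> V (line_point I \<xi> z ?t) + (Y (line_point I \<xi> z ?t))\<^sup>2 / \<kappa>"
      using \<kappa> unfolding V_def by (intro add_nonneg_nonneg sum_nonneg) auto
    also have "\<dots> = q z"
      unfolding V_line Y_line q_def using A \<kappa> by (simp add: power2_eq_square field_simps)
    finally show ?thesis .
  qed
  \<comment> \<open>\<open>h1\<close> is the Gaussian density restricted to the cone, \<open>h2\<close> the integrand that replaces it.\<close>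
  define h1 where "h1 = (\<lambda>z. ennreal (c0 * exp (- S z / 2)) * indicator {z. (L z)\<^sup>2 > A * V z} z)"
  define g where "g = (\<lambda>y z. c0 / pi * sqrt (A / \<kappa>) / sqrt (1 + y\<^sup>2) *
     exp (- (S z + (1 + y\<^sup>2) * V z + y\<^sup>2 / \<kappa> * (Y z)\<^sup>2) / 2))"
  define h2 where "h2 = (\<lambda>z. \<integral>\<^sup>+y. ennreal (g y z) \<partial>lborel)"
  have g0: "g y z \<ge> 0" for y z unfolding g_def using c0 A \<kappa> by simp
  have gm[measurable]: "(\<lambda>(z, y). ennreal (g y z)) \<in> borel_measurable (coord_lebesgue I \<Otimes>\<^sub>M lborel)"
    unfolding g_def by measurable
  have h1_line: "(\<integral>\<^sup>+t. h1 (line_point I \<xi> z t) \<partial>lborel) =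
      ennreal (c0 * exp (- N z / 2) / sqrt \<kappa> * (sqrt (2 * pi) / pi)) *
        (\<integral>\<^sup>+y. ennreal (exp (- q z * (1 + y\<^sup>2) / 2) / (1 + y\<^sup>2)) \<partial>lborel)" for z
  proof -
    define f where "f = (\<lambda>s::real. ennreal (exp (- s\<^sup>2 / 2)) * indicator {s. s\<^sup>2 > q z} s)"
    have [measurable]: "f \<in> borel_measurable borel" unfolding f_def by measurable
    have "h1 (line_point I \<xi> z t) = ennreal (c0 * exp (- N z / 2)) * f (Y z / sqrt \<kappa> + sqrt \<kappa> * t)" for t
    proof -
      have s: "(Y z / sqrt \<kappa> + sqrt \<kappa> * t)\<^sup>2 = (Y z)\<^sup>2 / \<kappa> + 2 * t * Y z + t\<^sup>2 * \<kappa>"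
        using \<kappa> by (simp add: power2_sum power_divide power_mult_distrib)
      have e: "S (line_point I \<xi> z t) = N z + (Y z / sqrt \<kappa> + sqrt \<kappa> * t)\<^sup>2"
        unfolding s S_line N_def by simp
      have "(L (line_point I \<xi> z t))\<^sup>2 - A * V (line_point I \<xi> z t) = A * ((Y z / sqrt \<kappa> + sqrt \<kappa> * t)\<^sup>2 - q z)"
        unfolding s L_line V_line q_def using A by (simp add: power2_eq_square algebra_simps)
      then have "(L (line_point I \<xi> z t))\<^sup>2 > A * V (line_point I \<xi> z t) \<longleftrightarrow> (Y z / sqrt \<kappa> + sqrt \<kappa> * t)\<^sup>2 > q z"
        using A by (smt (verit) zero_less_mult_iff)
      then show ?thesis
        unfolding h1_def f_def e using c0
        by (simp add: indicator_def ennreal_mult'[symmetric] add_divide_distrib exp_add[symmetric] mult.assoc)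
    qed
    then have "(\<integral>\<^sup>+t. h1 (line_point I \<xi> z t) \<partial>lborel) =
        ennreal (c0 * exp (- N z / 2)) * (\<integral>\<^sup>+t. f (Y z / sqrt \<kappa> + sqrt \<kappa> * t) \<partial>lborel)"
      by (simp add: nn_integral_cmult)
    also have "(\<integral>\<^sup>+t. f (Y z / sqrt \<kappa> + sqrt \<kappa> * t) \<partial>lborel) = ennreal (1 / sqrt \<kappa>) * (\<integral>\<^sup>+s. f s \<partial>lborel)"
      using \<kappa> by (subst (2) nn_integral_real_affine[where c = "sqrt \<kappa>" and t = "Y z / sqrt \<kappa>"])
        (simp_all add: mult.assoc[symmetric] ennreal_mult'[symmetric])
    also have "(\<integral>\<^sup>+s. f s \<partial>lborel) = ennreal (sqrt (2 * pi) / pi) *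
        (\<integral>\<^sup>+y. ennreal (exp (- q z * (1 + y\<^sup>2) / 2) / (1 + y\<^sup>2)) \<partial>lborel)"
      unfolding f_def by (rule gaussian_tail_eq_cauchy_mixture[OF q0])
    finally show ?thesis using c0 \<kappa> by (simp add: mult.assoc[symmetric] ennreal_mult'[symmetric])
  qed
  have h2_line: "(\<integral>\<^sup>+t. h2 (line_point I \<xi> z t) \<partial>lborel) =
      ennreal (c0 * exp (- N z / 2) / sqrt \<kappa> * (sqrt (2 * pi) / pi)) *
        (\<integral>\<^sup>+y. ennreal (exp (- q z * (1 + y\<^sup>2) / 2) / (1 + y\<^sup>2)) \<partial>lborel)" for z
  proof -
    have Gm: "(\<lambda>(t, y). ennreal (g y (line_point I \<xi> z t))) \<in> borel_measurable (lborel \<Otimes>\<^sub>M lborel)"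
      unfolding g_def L_line V_line S_line Y_line by measurable
    have inner: "(\<integral>\<^sup>+t. ennreal (g y (line_point I \<xi> z t)) \<partial>lborel) =
       ennreal (c0 * exp (- N z / 2) / sqrt \<kappa> * (sqrt (2 * pi) / pi)) * ennreal (exp (- q z * (1 + y\<^sup>2) / 2) / (1 + y\<^sup>2))" for y
    proof -
      define r where "r = 1 + y\<^sup>2"
      have r: "r > 0" unfolding r_def by (simp add: add_pos_nonneg)
      have u: "y\<^sup>2 = r - 1" unfolding r_def by simp
      have ex: "S (line_point I \<xi> z t) + r * V (line_point I \<xi> z t) + (r - 1) / \<kappa> * (Y (line_point I \<xi> z t))\<^sup>2 =
         N z + r * q z + r * A * (t + L z / A)\<^sup>2" for t
        unfolding S_line V_line Y_line N_def q_def using A \<kappa> by (simp add: power2_eq_square field_simps)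
      have "(\<integral>\<^sup>+t. ennreal (g y (line_point I \<xi> z t)) \<partial>lborel) =
         (\<integral>\<^sup>+t. ennreal (c0 / pi * sqrt (A / \<kappa>) / sqrt r * exp (- (N z + r * q z) / 2)) *
             ennreal (exp (- (r * A) * (t + L z / A)\<^sup>2 / 2)) \<partial>lborel)"
        unfolding g_def r_def[symmetric] unfolding u ex using c0 A \<kappa> r
        by (intro nn_integral_cong) (simp add: ennreal_mult'[symmetric] exp_add[symmetric] add_divide_distrib mult.assoc)
      also have "\<dots> = ennreal (c0 / pi * sqrt (A / \<kappa>) / sqrt r * exp (- (N z + r * q z) / 2)) * ennreal (sqrt (2 * pi / (r * A)))"
        using r A by (subst nn_integral_cmult) (simp, subst nn_integral_gaussian_square, simp_all)
      also have "\<dots> = ennreal (c0 / pi * sqrt (A / \<kappa>) / sqrt r * exp (- (N z + r * q z) / 2) * sqrt (2 * pi / (r * A)))"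
        using c0 r A \<kappa> by (subst ennreal_mult') simp_all
      also have "c0 / pi * sqrt (A / \<kappa>) / sqrt r * exp (- (N z + r * q z) / 2) * sqrt (2 * pi / (r * A)) =
          c0 * exp (- N z / 2) / sqrt \<kappa> * (sqrt (2 * pi) / pi) * (exp (- q z * r / 2) / r)"
      proof -
        have e: "exp (- (N z + r * q z) / 2) = exp (- N z / 2) * exp (- q z * r / 2)"
          by (simp add: exp_add[symmetric] add_divide_distrib mult.commute)
        have "sqrt r * sqrt r = r" "sqrt A / sqrt A = 1" using r A by auto
        then show ?thesis unfolding e using r A \<kappa>
          by (simp add: real_sqrt_divide real_sqrt_mult field_simps)
      qed
      finally show ?thesis using c0 \<kappa> r by (simp add: ennreal_mult'[symmetric] r_def)
    qed
    have "(\<integral>\<^sup>+t. h2 (line_point I \<xi> z t) \<partial>lborel) = (\<integral>\<^sup>+y. (\<integral>\<^sup>+t. ennreal (g y (line_point I \<xi> z t)) \<partial>lborel) \<partial>lborel)"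
      unfolding h2_def by (rule lborel_pair.Fubini'[symmetric, OF Gm])
    also have "\<dots> = ennreal (c0 * exp (- N z / 2) / sqrt \<kappa> * (sqrt (2 * pi) / pi)) *
        (\<integral>\<^sup>+y. ennreal (exp (- q z * (1 + y\<^sup>2) / 2) / (1 + y\<^sup>2)) \<partial>lborel)"
      unfolding inner by (rule nn_integral_cmult) measurable
    finally show ?thesis .
  qed
  have "\<xi> i0 \<noteq> 0" unfolding \<xi>_def using i0 x1[OF i0(1)] by simp
  moreover have "h1 \<in> borel_measurable (coord_lebesgue I)" "h2 \<in> borel_measurable (coord_lebesgue I)"
    unfolding h1_def h2_def by measurable
  ultimately have eq: "(\<integral>\<^sup>+z. h1 z \<partial>coord_lebesgue I) = (\<integral>\<^sup>+z. h2 z \<partial>coord_lebesgue I)"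
    by (intro nn_integral_eq_if_line_integrals_eq[OF I i0(1)]) (auto simp: h1_line h2_line)
  have dens: "(\<Prod>i\<in>I. std_normal_density (z i)) = c0 * exp (- S z / 2)" for z
    unfolding std_normal_density_def prod.distrib c0_def S_def
    by (simp add: I exp_sum[symmetric] sum_negf sum_divide_distrib)
  have "(\<integral>\<^sup>+z. ennreal (\<Prod>i\<in>I. std_normal_density (z i)) *
       indicator {z. (\<Sum>i\<in>I. \<sigma> i * z i)\<^sup>2 > A * (\<Sum>i\<in>I. (\<sigma> i)\<^sup>2 * (z i)\<^sup>2)} z \<partial>coord_lebesgue I) =
       (\<integral>\<^sup>+z. h1 z \<partial>coord_lebesgue I)"
    unfolding h1_def dens L_def V_def ..
  also note eq
  also have "(\<integral>\<^sup>+z. h2 z \<partial>coord_lebesgue I) = (\<integral>\<^sup>+y. (\<integral>\<^sup>+z. ennreal (g y z) \<partial>coord_lebesgue I) \<partial>lborel)"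
    unfolding h2_def by (rule P.Fubini'[symmetric, OF gm])
  also have "\<dots> = (\<integral>\<^sup>+y. ennreal (1 / pi) * ennreal (cone_kernel I x (y\<^sup>2) / (1 + y\<^sup>2)) \<partial>lborel)"
  proof (rule nn_integral_cong)
    fix y :: real
    define u where "u = y\<^sup>2"
    define d where "d = (\<lambda>i. (1 + u * x i) / (1 - x i))"
    have u: "u \<ge> 0" unfolding u_def by simp
    have ux: "1 + u * x i > 0" if "i \<in> I" for i using u x0[OF that] by (simp add: add_pos_nonneg)
    have d: "d i > 0" if "i \<in> I" for i unfolding d_def using ux[OF that] x1[OF that] by simp
    have dV: "(\<Sum>i\<in>I. d i * (z i)\<^sup>2) = S z + (1 + u) * V z" for z
    proof -
      have "d i = 1 + (1 + u) * (\<sigma> i)\<^sup>2" if "i \<in> I" for i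
        using x0[OF that] x1[OF that] by (simp add: d_def \<sigma>_def field_simps)
      then have "(\<Sum>i\<in>I. d i * (z i)\<^sup>2) = (\<Sum>i\<in>I. (z i)\<^sup>2 + (1 + u) * ((\<sigma> i)\<^sup>2 * (z i)\<^sup>2))"
        by (intro sum.cong) (auto simp: algebra_simps)
      then show ?thesis by (simp add: sum.distrib sum_distrib_left S_def V_def)
    qed
    define K where "K = c0 / pi * sqrt (A / \<kappa>) / sqrt (1 + u)"
    have K: "K \<ge> 0" unfolding K_def using c0 A \<kappa> u by simp
    define B where "B = (\<Sum>i\<in>I. x i * (1 - x i) / (1 + u * x i))"
    have xd: "(\<xi> i)\<^sup>2 / d i = x i * (1 - x i) * (1 - x i) / (1 + u * x i)" if "i \<in> I" for i
      using \<xi>2[OF that] x1[OF that] by (simp add: d_def power2_eq_square)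
    have B: "1 + u / \<kappa> * (\<Sum>i\<in>I. (\<xi> i)\<^sup>2 / d i) = (1 + u) / \<kappa> * B"
    proof -
      have "\<kappa> + u * (\<Sum>i\<in>I. (\<xi> i)\<^sup>2 / d i) = (\<Sum>i\<in>I. x i * (1 - x i) + u * (x i * (1 - x i) * (1 - x i) / (1 + u * x i)))"
        using xd by (simp add: \<kappa>_def sum.distrib sum_distrib_left)
      also have "\<dots> = (\<Sum>i\<in>I. (1 + u) * (x i * (1 - x i) / (1 + u * x i)))"
      proof (rule sum.cong[OF refl])
        fix i assume "i \<in> I"
        have "x i * (1 - x i) = x i * (1 - x i) * (1 + u * x i) / (1 + u * x i)"
          using ux[OF \<open>i \<in> I\<close>] by simp
        then have "x i * (1 - x i) + u * (x i * (1 - x i) * (1 - x i) / (1 + u * x i)) =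
           (x i * (1 - x i) * (1 + u * x i) + u * (x i * (1 - x i) * (1 - x i))) / (1 + u * x i)"
          by (metis add_divide_distrib times_divide_eq_right)
        also have "\<dots> = (1 + u) * (x i * (1 - x i) / (1 + u * x i))"
          unfolding times_divide_eq_right by (rule arg_cong[where f = "\<lambda>a. a / _"]) algebra
        finally show "x i * (1 - x i) + u * (x i * (1 - x i) * (1 - x i) / (1 + u * x i)) = (1 + u) * (x i * (1 - x i) / (1 + u * x i))" .
      qed
      also have "\<dots> = (1 + u) * B" by (simp add: B_def sum_distrib_left)
      finally show ?thesis using \<kappa> by (simp add: field_simps)
    qed
    have "(\<integral>\<^sup>+z. ennreal (g y z) \<partial>coord_lebesgue I) =
       (\<integral>\<^sup>+z. ennreal K * ennreal (exp (- ((\<Sum>i\<in>I. d i * (z i)\<^sup>2) + u / \<kappa> * (0 + (\<Sum>i\<in>I. \<xi> i * z i))\<^sup>2) / 2)) \<partial>coord_lebesgue I)"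
      unfolding g_def u_def[symmetric] dV K_def[symmetric] Y_def using K by (simp add: ennreal_mult'[symmetric])
    also have "\<dots> = ennreal K * ennreal ((\<Prod>i\<in>I. sqrt (2 * pi / d i)) / sqrt ((1 + u) / \<kappa> * B))"
    proof (subst nn_integral_cmult)
      have "u / \<kappa> \<ge> 0" using u \<kappa> by simp
      then have "(\<integral>\<^sup>+z. ennreal (exp (- ((\<Sum>i\<in>I. d i * (z i)\<^sup>2) + u / \<kappa> * (0 + (\<Sum>i\<in>I. \<xi> i * z i))\<^sup>2) / 2)) \<partial>coord_lebesgue I) =
          ennreal ((\<Prod>i\<in>I. sqrt (2 * pi / d i)) / sqrt ((1 + u) / \<kappa> * B) * exp (- (u / \<kappa> / ((1 + u) / \<kappa> * B)) * 0\<^sup>2 / 2))"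
        unfolding B[symmetric] by (intro nn_integral_gaussian_rank_one_perturbation I d)
      then show "ennreal K * (\<integral>\<^sup>+z. ennreal (exp (- ((\<Sum>i\<in>I. d i * (z i)\<^sup>2) + u / \<kappa> * (0 + (\<Sum>i\<in>I. \<xi> i * z i))\<^sup>2) / 2)) \<partial>coord_lebesgue I) =
          ennreal K * ennreal ((\<Prod>i\<in>I. sqrt (2 * pi / d i)) / sqrt ((1 + u) / \<kappa> * B))"
        by (simp only: power2_eq_square mult_zero_right div_0 exp_zero mult_1_right)
    qed measurable
    also have "\<dots> = ennreal (K * ((\<Prod>i\<in>I. sqrt (2 * pi / d i)) / sqrt ((1 + u) / \<kappa> * B)))"
      by (rule ennreal_mult'[OF K, symmetric])
    also have "K * ((\<Prod>i\<in>I. sqrt (2 * pi / d i)) / sqrt ((1 + u) / \<kappa> * B)) = 1 / pi * (cone_kernel I x u / (1 + u))"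
    proof -
      have "c0 * (\<Prod>i\<in>I. sqrt (2 * pi / d i)) = (\<Prod>i\<in>I. 1 / sqrt (2 * pi) * sqrt (2 * pi / d i))"
        unfolding prod.distrib c0_def by simp
      also have "\<dots> = (\<Prod>i\<in>I. sqrt (1 - x i) / sqrt (1 + u * x i))"
      proof (rule prod.cong[OF refl])
        fix i
        have "sqrt (2 * pi / d i) = sqrt (2 * pi) * (sqrt (1 - x i) / sqrt (1 + u * x i))"
          by (simp only: d_def real_sqrt_divide[symmetric] real_sqrt_mult[symmetric] times_divide_eq_right divide_divide_eq_right)
        then show "1 / sqrt (2 * pi) * sqrt (2 * pi / d i) = sqrt (1 - x i) / sqrt (1 + u * x i)"
          by (simp del: real_sqrt_mult)
      qed
      also have "\<dots> = sqrt (\<Prod>i\<in>I. 1 - x i) / sqrt (\<Prod>i\<in>I. 1 + u * x i)"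
        by (simp add: prod_dividef sqrt_prod)
      finally have p: "c0 * (\<Prod>i\<in>I. sqrt (2 * pi / d i)) = sqrt (\<Prod>i\<in>I. 1 - x i) / sqrt (\<Prod>i\<in>I. 1 + u * x i)" .
      have "K * ((\<Prod>i\<in>I. sqrt (2 * pi / d i)) / sqrt ((1 + u) / \<kappa> * B)) =
         (c0 * (\<Prod>i\<in>I. sqrt (2 * pi / d i))) * sqrt A / (pi * (1 + u) * sqrt B)"
      proof -
        have s: "sqrt (1 + u) * sqrt (1 + u) = 1 + u" "sqrt \<kappa> \<noteq> 0" using u \<kappa> by auto
        define R where "R = (\<Prod>i\<in>I. sqrt (2 * pi / d i))"
        have "K * (R / sqrt ((1 + u) / \<kappa> * B)) = (c0 * R) * sqrt A / (pi * (sqrt (1 + u) * sqrt (1 + u)) * sqrt B)"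
          unfolding K_def real_sqrt_mult real_sqrt_divide using s(2) by (simp add: mult_ac del: real_sqrt_eq_0_iff real_sqrt_mult_self real_sqrt_abs2)
        then show ?thesis unfolding s(1) R_def .
      qed
      also have "\<dots> = 1 / pi * (cone_kernel I x u / (1 + u))"
        unfolding p cone_kernel_def A_def[symmetric] B_def[symmetric] using u
        by (simp add: real_sqrt_divide real_sqrt_mult mult_ac)
      finally show ?thesis .
    qed
    also have "ennreal (1 / pi * (cone_kernel I x u / (1 + u))) = ennreal (1 / pi) * ennreal (cone_kernel I x u / (1 + u))"
      by (rule ennreal_mult') simp
    finally show "(\<integral>\<^sup>+z. ennreal (g y z) \<partial>coord_lebesgue I) = ennreal (1 / pi) * ennreal (cone_kernel I x (y\<^sup>2) / (1 + y\<^sup>2))"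
      by (simp only: u_def)
  qed
  also have "\<dots> = ennreal (1 / pi) * (\<integral>\<^sup>+y. ennreal (cone_kernel I x (y\<^sup>2) / (1 + y\<^sup>2)) \<partial>lborel)"
    unfolding cone_kernel_def by (rule nn_integral_cmult) measurable
  finally show ?thesis .
qed

section \<open>Bounds and continuity of the Cauchy average\<close>

definition cone_mass :: "'i set \<Rightarrow> ('i \<Rightarrow> real) \<Rightarrow> real" where
  "cone_mass I x = (\<integral>y. cone_kernel I x (y\<^sup>2) / (1 + y\<^sup>2) \<partial>lborel) / pi"

text \<open>
  The value of \<open>cone_kernel\<close> when \<open>k\<close> coordinates are equal to \<open>A / k\<close> and all others are zero.
\<close>

definition equal_kernel :: "real \<Rightarrow> nat \<Rightarrow> real \<Rightarrow> real" where
  "equal_kernel A k u = sqrt (((1 - A / k) / (1 + u * (A / k))) ^ (k - 1))"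

definition equal_mass :: "real \<Rightarrow> nat \<Rightarrow> real" where
  "equal_mass A k = (\<integral>y. equal_kernel A k (y\<^sup>2) / (1 + y\<^sup>2) \<partial>lborel) / pi"

lemma integrable_inverse_1_plus_square: "integrable lborel (\<lambda>y::real. c / (1 + y\<^sup>2))"
proof -
  have "integrable lborel (\<lambda>y::real. 1 / (1 + y\<^sup>2))"
    by (rule integrableI_nonneg) (auto simp: nn_integral_inverse_1_plus_square add_nonneg_nonneg)
  from integrable_mult_right[OF this, of c] show ?thesis by simp
qed

lemma measurable_cone_kernel[measurable]:
  "(\<lambda>y. cone_kernel I x (y\<^sup>2)) \<in> borel_measurable borel"
  unfolding cone_kernel_def by measurable

lemma cone_kernel_cong:
  assumes "\<And>i. i \<in> I \<Longrightarrow> x i = y i"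
  shows "cone_kernel I x u = cone_kernel I y u"
  unfolding cone_kernel_def using assms by (simp cong: sum.cong prod.cong)

lemma cone_mass_cong:
  assumes "\<And>i. i \<in> I \<Longrightarrow> x i = y i"
  shows "cone_mass I x = cone_mass I y"
proof -
  have "cone_kernel I x = cone_kernel I y" by (intro ext cone_kernel_cong assms)
  then show ?thesis by (simp add: cone_mass_def)
qed

lemma cone_kernel_drop_zeros:
  assumes "finite I" "S \<subseteq> I" "\<And>i. i \<in> I - S \<Longrightarrow> x i = 0"
  shows "cone_kernel I x u = cone_kernel S x u"
proof -
  have "(\<Sum>i\<in>S. x i) = (\<Sum>i\<in>I. x i)" "(\<Prod>i\<in>S. 1 - x i) = (\<Prod>i\<in>I. 1 - x i)"
    "(\<Prod>i\<in>S. 1 + u * x i) = (\<Prod>i\<in>I. 1 + u * x i)"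
    "(\<Sum>i\<in>S. x i * (1 - x i) / (1 + u * x i)) = (\<Sum>i\<in>I. x i * (1 - x i) / (1 + u * x i))"
    using assms by (auto intro!: sum.mono_neutral_left prod.mono_neutral_left)
  then show ?thesis unfolding cone_kernel_def by simp
qed

lemma cone_mass_drop_zeros:
  assumes "finite I" "S \<subseteq> I" "\<And>i. i \<in> I - S \<Longrightarrow> x i = 0"
  shows "cone_mass I x = cone_mass S x"
proof -
  have "cone_kernel I x = cone_kernel S x" by (intro ext cone_kernel_drop_zeros assms)
  then show ?thesis by (simp add: cone_mass_def)
qed

lemma cone_kernel_const:
  assumes S: "finite S" "card S = k" "k \<ge> 1" and A: "0 < A" "A < k" and u: "u \<ge> 0"
    and x: "\<And>i. i \<in> S \<Longrightarrow> x i = A / k"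
  shows "cone_kernel S x u = equal_kernel A k u"
proof -
  define w where "w = A / k"
  have w: "w > 0" "w < 1" "k * w = A" using S A by (auto simp: w_def)
  obtain m where k: "k = Suc m" using S by (cases k) auto
  have uw: "1 + u * w > 0" using u w by (simp add: add_pos_nonneg)
  have "cone_kernel S x u = cone_kernel S (\<lambda>_. w) u"
    using x by (intro cone_kernel_cong) (simp add: w_def)
  also have "\<dots> = sqrt (A * (1 - w) ^ k / ((1 + u * w) ^ k * (A * (1 - w) / (1 + u * w))))"
    using w(3) S by (simp add: cone_kernel_def mult.assoc[symmetric])
  also have "A * (1 - w) ^ k / ((1 + u * w) ^ k * (A * (1 - w) / (1 + u * w))) = ((1 - w) / (1 + u * w)) ^ (k - 1)"
  proof -
    have "A * a ^ Suc m / (b ^ Suc m * (A * a / b)) = (a / b) ^ m" if "a > 0" "b > 0" for a b :: real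
      using that A by (simp add: power_divide)
    from this[of "1 - w" "1 + u * w"] show ?thesis using w uw by (simp add: k)
  qed
  finally show ?thesis by (simp add: equal_kernel_def w_def)
qed

lemma cone_mass_const:
  assumes "finite S" "card S = k" "k \<ge> 1" "0 < A" "A < k" "\<And>i. i \<in> S \<Longrightarrow> x i = A / k"
  shows "cone_mass S x = equal_mass A k"
  unfolding cone_mass_def equal_mass_def using cone_kernel_const[OF assms(1-5) _ assms(6)] by simp

lemma cone_kernel_eq_0: "finite I \<Longrightarrow> i \<in> I \<Longrightarrow> x i = 1 \<Longrightarrow> cone_kernel I x u = 0"
  unfolding cone_kernel_def by (auto simp: prod_zero_iff)

lemma cone_kernel_nonneg:
  assumes "\<And>i. i \<in> I \<Longrightarrow> 0 \<le> x i" "\<And>i. i \<in> I \<Longrightarrow> x i \<le> 1" "u \<ge> 0"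
  shows "cone_kernel I x u \<ge> 0"
  unfolding cone_kernel_def using assms
  by (intro real_sqrt_ge_zero divide_nonneg_nonneg mult_nonneg_nonneg prod_nonneg sum_nonneg ballI) auto

text \<open>
  The kernel is not continuous on the whole cube: where all coordinates are \<open>0\<close> or \<open>1\<close> its
  formula reads \<open>0 / 0\<close>. On the slice \<open>\<Sum> x i = A\<close> with \<open>A > 1\<close> it nevertheless tends to zero when some \<open>x i\<close>
  approaches \<open>1\<close>, because another coordinate \<open>x j\<close> is then bounded away from zero and the factors
  \<open>x j * (1 - x j)\<close> of the denominator compensate the factor \<open>1 - x j\<close> of the numerator.
\<close>

lemma cone_kernel_le:
  assumes I: "finite I" and x0: "\<And>i. i \<in> I \<Longrightarrow> 0 \<le> x i" and x1: "\<And>i. i \<in> I \<Longrightarrow> x i \<le> 1"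
    and u: "u \<ge> 0" and A: "(\<Sum>i\<in>I. x i) = A" "A > 1" and i: "i \<in> I"
  shows "cone_kernel I x u \<le> sqrt (A * card I / (A - 1) * (1 - x i))"
proof -
  have c: "card I > 0" using I i by (auto simp: card_gt_0_iff)
  have "\<exists>j\<in>I - {i}. x j \<ge> (A - 1) / card I"
  proof (rule ccontr)
    assume "\<not> ?thesis"
    then have lt: "x j \<le> (A - 1) / card I" if "j \<in> I - {i}" for j using that by force
    have "A - x i = (\<Sum>j\<in>I - {i}. x j)" using A I i by (simp add: sum_diff1)
    also have "\<dots> \<le> of_nat (card (I - {i})) * ((A - 1) / card I)"
      by (rule sum_bounded_above) (rule lt)
    also have "\<dots> < card I * ((A - 1) / card I)"
      using c A I i by (intro mult_strict_right_mono) (auto simp: card_Diff_singleton)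
    also have "\<dots> = A - 1" using c by simp
    finally show False using x1[OF i] by simp
  qed
  then obtain j where j: "j \<in> I" "j \<noteq> i" "x j \<ge> (A - 1) / card I" by auto
  have xj: "x j > 0" using j(3) A c by (meson divide_pos_pos less_le_trans diff_gt_0_iff_gt of_nat_0_less_iff)
  have C: "A * card I / (A - 1) * (1 - x i) \<ge> 0" using A x1[OF i] by simp
  show ?thesis
  proof (cases "x j = 1")
    case True
    then show ?thesis using cone_kernel_eq_0[OF I j(1)] C by simp
  next
    case False
    then have xj1: "x j < 1" using x1[OF j(1)] by simp
    define R where "R = (\<Prod>l\<in>I - {j} - {i}. 1 - x l)"
    define W where "W = (\<Prod>l\<in>I - {j}. 1 + u * x l)"
    define B where "B = (\<Sum>l\<in>I. x l * (1 - x l) / (1 + u * x l))"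
    have R: "R \<le> 1" "R \<ge> 0" unfolding R_def using x0 x1 by (auto intro!: prod_le_1 prod_nonneg)
    have W: "W \<ge> 1" unfolding W_def using x0 u by (auto intro!: prod_ge_1)
    have uj: "1 + u * x j > 0" using u xj by (simp add: add_pos_nonneg)
    have Bj: "B \<ge> x j * (1 - x j) / (1 + u * x j)"
      unfolding B_def using x0 x1 u I j by (intro member_le_sum) auto
    have "(1 + u * x j) * W * B \<ge> (1 + u * x j) * W * (x j * (1 - x j) / (1 + u * x j))"
      using Bj uj W by (intro mult_left_mono) auto
    also have "(1 + u * x j) * W * (x j * (1 - x j) / (1 + u * x j)) = W * (x j * (1 - x j))"
      using uj by simp
    also have "W * (x j * (1 - x j)) \<ge> 1 * (x j * (1 - x j))"
      using W xj xj1 by (intro mult_right_mono) auto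
    finally have WB: "(1 + u * x j) * W * B \<ge> x j * (1 - x j)" by simp
    have pos: "x j * (1 - x j) > 0" using xj xj1 by simp
    have "A * ((1 - x j) * ((1 - x i) * R)) / ((1 + u * x j) * W * B) \<le> A * ((1 - x j) * ((1 - x i) * 1)) / (x j * (1 - x j))"
      using WB pos R A x1[OF i] xj1
      by (intro frac_le mult_nonneg_nonneg mult_left_mono) auto
    also have "\<dots> = A * (1 - x i) * (1 / x j)" using xj1 xj by (simp add: field_simps)
    also have "\<dots> \<le> A * (1 - x i) * (card I / (A - 1))"
    proof (rule mult_left_mono)
      have "x j * card I \<ge> A - 1" using j(3) c by (simp add: field_simps)
      then show "1 / x j \<le> card I / (A - 1)" using A xj by (simp add: field_simps)
    qed (use A x1[OF i] in simp)
    finally have le: "A * ((1 - x j) * ((1 - x i) * R)) / ((1 + u * x j) * W * B) \<le> A * card I / (A - 1) * (1 - x i)"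
      by (simp add: mult_ac)
    have "(\<Prod>l\<in>I. 1 - x l) = (1 - x j) * ((1 - x i) * R)"
      using I i j by (simp add: R_def prod.remove[of I j] prod.remove[of "I - {j}" i])
    moreover have "(\<Prod>l\<in>I. 1 + u * x l) = (1 + u * x j) * W"
      using I j by (simp add: W_def prod.remove[of I j])
    ultimately have "cone_kernel I x u = sqrt (A * ((1 - x j) * ((1 - x i) * R)) / ((1 + u * x j) * W * B))"
      by (simp add: cone_kernel_def A(1) B_def)
    then show ?thesis using le by simp
  qed
qed

lemma cone_kernel_le_uniform:
  assumes I: "finite I" and x0: "\<And>i. i \<in> I \<Longrightarrow> 0 \<le> x i" and x1: "\<And>i. i \<in> I \<Longrightarrow> x i \<le> 1"
    and u: "u \<ge> 0" and A: "(\<Sum>i\<in>I. x i) = A" "A > 1"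
  shows "cone_kernel I x u \<le> sqrt (A * card I / (A - 1))"
proof -
  have "I \<noteq> {}" using A by auto
  then obtain i where i: "i \<in> I" by auto
  have "cone_kernel I x u \<le> sqrt (A * card I / (A - 1) * (1 - x i))"
    by (intro cone_kernel_le assms i)
  also have "\<dots> \<le> sqrt (A * card I / (A - 1) * 1)"
    using A x0[OF i] by (intro real_sqrt_le_mono mult_left_mono) auto
  finally show ?thesis by simp
qed

lemma integrable_cone_kernel:
  assumes I: "finite I" and x0: "\<And>i. i \<in> I \<Longrightarrow> 0 \<le> x i" and x1: "\<And>i. i \<in> I \<Longrightarrow> x i \<le> 1"
    and A: "(\<Sum>i\<in>I. x i) = A" "A > 1"
  shows "integrable lborel (\<lambda>y. cone_kernel I x (y\<^sup>2) / (1 + y\<^sup>2))"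
proof (rule Bochner_Integration.integrable_bound)
  show "integrable lborel (\<lambda>y::real. sqrt (A * card I / (A - 1)) / (1 + y\<^sup>2))"
    by (rule integrable_inverse_1_plus_square)
  have "norm (cone_kernel I x (y\<^sup>2) / (1 + y\<^sup>2)) \<le> norm (sqrt (A * card I / (A - 1)) / (1 + y\<^sup>2))" for y :: real
    using cone_kernel_le_uniform[OF I x0 x1 _ A, of "y\<^sup>2"] cone_kernel_nonneg[of I x "y\<^sup>2"] x0 x1
    by (auto simp: abs_mult intro!: divide_right_mono)
  then show "AE y in lborel. norm (cone_kernel I x (y\<^sup>2) / (1 + y\<^sup>2)) \<le> norm (sqrt (A * card I / (A - 1)) / (1 + y\<^sup>2))"
    by simp
qed measurable

text \<open>
  The limit at a point with a coordinate equal to \<open>1\<close> comes from the bound just proved; elsewhere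
  the denominator is positive.
\<close>

lemma tendsto_cone_kernel:
  assumes I: "finite I" and x0: "\<And>i. i \<in> I \<Longrightarrow> 0 \<le> x i" and x1: "\<And>i. i \<in> I \<Longrightarrow> x i \<le> 1"
    and X0: "\<And>n i. i \<in> I \<Longrightarrow> 0 \<le> X n i" and X1: "\<And>n i. i \<in> I \<Longrightarrow> X n i \<le> 1"
    and A: "(\<Sum>i\<in>I. x i) = A" "A > 1" and XA: "\<And>n. (\<Sum>i\<in>I. X n i) = A"
    and u: "u \<ge> 0" and lim: "\<And>i. i \<in> I \<Longrightarrow> (\<lambda>n. X n i) \<longlonglongrightarrow> x i"
  shows "(\<lambda>n. cone_kernel I (X n) u) \<longlonglongrightarrow> cone_kernel I x u"
proof (cases "\<exists>i\<in>I. x i = 1")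
  case True
  then obtain i where i: "i \<in> I" "x i = 1" by auto
  have "(\<lambda>n. sqrt (A * card I / (A - 1) * (1 - X n i))) \<longlonglongrightarrow> sqrt (A * card I / (A - 1) * (1 - x i))"
    by (intro tendsto_intros lim i)
  then have lim0: "(\<lambda>n. sqrt (A * card I / (A - 1) * (1 - X n i))) \<longlonglongrightarrow> 0" using i by simp
  have lo: "0 \<le> cone_kernel I (X n) u" for n by (intro cone_kernel_nonneg X0 X1 u)
  have hi: "cone_kernel I (X n) u \<le> sqrt (A * card I / (A - 1) * (1 - X n i))" for n
    by (intro cone_kernel_le I X0 X1 u XA A i)
  have "(\<lambda>n. cone_kernel I (X n) u) \<longlonglongrightarrow> 0"
    by (rule tendsto_sandwich[OF always_eventually always_eventually tendsto_const lim0])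
      (use lo hi in blast)+
  then show ?thesis using cone_kernel_eq_0[of I i x u] I i by simp
next
  case False
  then have lt: "x i < 1" if "i \<in> I" for i using x1[OF that] that by force
  have ux: "1 + u * x i > 0" if "i \<in> I" for i using u x0[OF that] by (simp add: add_pos_nonneg)
  have "\<exists>i\<in>I. x i > 0"
  proof (rule ccontr)
    assume "\<not> ?thesis"
    then have "(\<Sum>i\<in>I. x i) \<le> 0" by (intro sum_nonpos) auto
    then show False using A by simp
  qed
  then obtain i0 where i0: "i0 \<in> I" "x i0 > 0" by auto
  have "x i0 * (1 - x i0) / (1 + u * x i0) > 0" using i0 lt ux by simp
  moreover have "x i * (1 - x i) / (1 + u * x i) \<ge> 0" if "i \<in> I" for i
    using x0[OF that] x1[OF that] ux[OF that] by simp
  ultimately have B: "(\<Sum>i\<in>I. x i * (1 - x i) / (1 + u * x i)) > 0"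
    using I i0(1) by (meson sum_pos2)
  have W: "(\<Prod>i\<in>I. 1 + u * x i) > 0" using ux by (intro prod_pos) auto
  have ne: "1 + u * x i \<noteq> 0" if "i \<in> I" for i using ux[OF that] by simp
  show ?thesis unfolding cone_kernel_def
    using B W by (intro tendsto_intros lim ne) auto
qed

lemma cone_mass_continuous:
  fixes I :: "nat set"
  assumes I: "finite I" and A: "A > 1"
  shows "continuous_on {x. (\<forall>i\<in>I. 0 \<le> x i \<and> x i \<le> 1) \<and> (\<Sum>i\<in>I. x i) = A} (cone_mass I)"
proof (rule continuous_on_sequentiallyI)
  fix X :: "nat \<Rightarrow> nat \<Rightarrow> real" and x
  assume X: "\<forall>n. X n \<in> {x. (\<forall>i\<in>I. 0 \<le> x i \<and> x i \<le> 1) \<and> (\<Sum>i\<in>I. x i) = A}"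
    and x: "x \<in> {x. (\<forall>i\<in>I. 0 \<le> x i \<and> x i \<le> 1) \<and> (\<Sum>i\<in>I. x i) = A}" and lim: "X \<longlonglongrightarrow> x"
  have lim_i: "(\<lambda>n. X n i) \<longlonglongrightarrow> x i" for i
    using continuous_on_tendsto_compose[OF continuous_on_product_coordinates lim] by simp
  have "(\<lambda>n. \<integral>y. cone_kernel I (X n) (y\<^sup>2) / (1 + y\<^sup>2) \<partial>lborel) \<longlonglongrightarrow> (\<integral>y. cone_kernel I x (y\<^sup>2) / (1 + y\<^sup>2) \<partial>lborel)"
  proof (rule integral_dominated_convergence)
    show "integrable lborel (\<lambda>y::real. sqrt (A * card I / (A - 1)) / (1 + y\<^sup>2))"
      by (rule integrable_inverse_1_plus_square)
    have "(\<lambda>n. cone_kernel I (X n) (y\<^sup>2)) \<longlonglongrightarrow> cone_kernel I x (y\<^sup>2)" for y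
      using X x by (intro tendsto_cone_kernel[where A = A] I A lim_i) auto
    then show "AE y in lborel. (\<lambda>n. cone_kernel I (X n) (y\<^sup>2) / (1 + y\<^sup>2)) \<longlonglongrightarrow> cone_kernel I x (y\<^sup>2) / (1 + y\<^sup>2)"
      by (intro AE_I2 tendsto_divide tendsto_const) (auto simp: add_nonneg_eq_0_iff)
    fix n
    have "norm (cone_kernel I (X n) (y\<^sup>2) / (1 + y\<^sup>2)) \<le> sqrt (A * card I / (A - 1)) / (1 + y\<^sup>2)" for y :: real
      using cone_kernel_le_uniform[of I "X n" "y\<^sup>2" A] cone_kernel_nonneg[of I "X n" "y\<^sup>2"] X I A
      by (auto simp: abs_mult intro!: divide_right_mono)
    then show "AE y in lborel. norm (cone_kernel I (X n) (y\<^sup>2) / (1 + y\<^sup>2)) \<le> sqrt (A * card I / (A - 1)) / (1 + y\<^sup>2)"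
      by simp
  qed measurable
  then show "(\<lambda>n. cone_mass I (X n)) \<longlonglongrightarrow> cone_mass I x"
    unfolding cone_mass_def by (intro tendsto_intros) auto
qed

section \<open>Varying two coordinates with a fixed sum\<close>

text \<open>
  Besides their sum \<open>\<tau>\<close>, the two distinguished coordinates enter only through their product \<open>p\<close>, and \<open>p\<close>
  enters through a quotient of two affine functions.
\<close>

lemma cone_kernel_pair:
  assumes J: "finite J" "i \<notin> J" "j \<notin> J" "i \<noteq> j" and x0: "\<And>l. l \<in> insert i (insert j J) \<Longrightarrow> 0 \<le> x l" and u: "u \<ge> 0"
  defines "B \<equiv> (\<Sum>l\<in>J. x l * (1 - x l) / (1 + u * x l))" and "\<tau> \<equiv> x i + x j" and "p \<equiv> x i * x j"
  shows "cone_kernel (insert i (insert j J)) x u =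
    sqrt ((\<tau> + (\<Sum>l\<in>J. x l)) * (\<Prod>l\<in>J. 1 - x l) / (\<Prod>l\<in>J. 1 + u * x l) *
      ((1 - \<tau> + p) / (((1 + u * \<tau>) * B + \<tau> - \<tau>\<^sup>2) + (u\<^sup>2 * B + 2 + u * (2 - \<tau>)) * p)))"
proof -
  have ui: "1 + u * x i > 0" "1 + u * x j > 0" using u x0 by (simp_all add: add_pos_nonneg)
  have 1: "(1 + u * x i) * (1 + u * x j) * (x i * (1 - x i) / (1 + u * x i) + (x j * (1 - x j) / (1 + u * x j) + B)) =
     ((1 + u * \<tau>) * B + \<tau> - \<tau>\<^sup>2) + (u\<^sup>2 * B + 2 + u * (2 - \<tau>)) * p"
  proof -
    have "(1 + u * x i) * (1 + u * x j) * (x i * (1 - x i) / (1 + u * x i) + (x j * (1 - x j) / (1 + u * x j) + B)) =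
       (1 + u * x j) * (x i * (1 - x i)) + (1 + u * x i) * (x j * (1 - x j)) + (1 + u * x i) * (1 + u * x j) * B"
    proof -
      have "a * b * (c / a + (d / b + e)) = b * c + a * d + a * b * e" if "a > 0" "b > 0" for a b c d e :: real
        using that by (simp add: field_simps)
      then show ?thesis using ui by blast
    qed
    also have "\<dots> = ((1 + u * \<tau>) * B + \<tau> - \<tau>\<^sup>2) + (u\<^sup>2 * B + 2 + u * (2 - \<tau>)) * p"
      unfolding \<tau>_def p_def by algebra
    finally show ?thesis .
  qed
  have 2: "(1 - x i) * (1 - x j) = 1 - \<tau> + p" unfolding \<tau>_def p_def by algebra
  have "cone_kernel (insert i (insert j J)) x u =
    sqrt ((x i + x j + (\<Sum>l\<in>J. x l)) * ((1 - x i) * (1 - x j) * (\<Prod>l\<in>J. 1 - x l)) /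
     ((\<Prod>l\<in>J. 1 + u * x l) * ((1 + u * x i) * (1 + u * x j) * (x i * (1 - x i) / (1 + u * x i) + (x j * (1 - x j) / (1 + u * x j) + B)))))"
    using J by (simp add: cone_kernel_def B_def mult_ac add_ac)
  then show ?thesis unfolding 1 2 \<tau>_def[symmetric] by (simp add: mult_ac)
qed

text \<open>
  A quotient of affine functions of \<open>p\<close> is monotone, its direction being the sign of a determinant;
  for \<open>\<tau> \<ge> 1\<close> all terms of that determinant are nonnegative.
\<close>

lemma mobius_ratio_mono:
  fixes B u \<tau> p p' :: real
  assumes "B \<ge> 0" "u \<ge> 0" "1 \<le> \<tau>" "\<tau> \<le> 2" "\<tau> - 1 \<le> p" "p \<le> p'"
  shows "(1 - \<tau> + p) / (((1 + u * \<tau>) * B + \<tau> - \<tau>\<^sup>2) + (u\<^sup>2 * B + 2 + u * (2 - \<tau>)) * p) \<le>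
    (1 - \<tau> + p') / (((1 + u * \<tau>) * B + \<tau> - \<tau>\<^sup>2) + (u\<^sup>2 * B + 2 + u * (2 - \<tau>)) * p')"
proof -
  define e0 where "e0 = (1 + u * \<tau>) * B + \<tau> - \<tau>\<^sup>2"
  define e1 where "e1 = u\<^sup>2 * B + 2 + u * (2 - \<tau>)"
  have e1: "e1 \<ge> 0" unfolding e1_def using assms by (intro add_nonneg_nonneg mult_nonneg_nonneg) auto
  have d: "e0 + (\<tau> - 1) * e1 \<ge> 0"
  proof -
    have "e0 + (\<tau> - 1) * e1 = (1 + u * \<tau>) * B + (\<tau> - 1) * (u\<^sup>2 * B + (2 - \<tau>) + u * (2 - \<tau>))"
      unfolding e0_def e1_def by algebra
    also have "\<dots> \<ge> 0" using assms by (intro add_nonneg_nonneg mult_nonneg_nonneg) auto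
    finally show ?thesis .
  qed
  have "e0 + e1 * p = (e0 + (\<tau> - 1) * e1) + e1 * (p - (\<tau> - 1))" by algebra
  also have "\<dots> \<ge> 0" using assms by (intro add_nonneg_nonneg[OF d] mult_nonneg_nonneg[OF e1]) simp
  finally have D: "e0 + e1 * p \<ge> 0" .
  have mono: "e1 * p \<le> e1 * p'" using e1 assms by (intro mult_left_mono) auto
  show ?thesis
  proof (cases "e0 + e1 * p = 0")
    case True
    then have "0 \<le> e0 + e1 * p'" "0 \<le> 1 - \<tau> + p'" using mono assms by linarith+
    then have "0 \<le> (1 - \<tau> + p') / (e0 + e1 * p')" by (rule divide_nonneg_nonneg[rotated])
    then show ?thesis using True by (simp add: e0_def e1_def)
  next
    case False
    then have pos: "e0 + e1 * p > 0" "e0 + e1 * p' > 0" using D mono by auto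
    have "(1 - \<tau> + p') * (e0 + e1 * p) - (1 - \<tau> + p) * (e0 + e1 * p') = (p' - p) * (e0 + (\<tau> - 1) * e1)" by algebra
    also have "\<dots> \<ge> 0" using d assms by (intro mult_nonneg_nonneg) auto
    finally have "(1 - \<tau> + p) / (e0 + e1 * p) \<le> (1 - \<tau> + p') / (e0 + e1 * p')"
      using pos by (simp add: divide_simps mult_ac)
    then show ?thesis by (simp add: e0_def e1_def)
  qed
qed

lemma inverse_sqrt_convex:
  fixes s r \<theta> :: real
  assumes "s > 0" "r > 0" "0 \<le> \<theta>" "\<theta> \<le> 1"
  shows "1 / sqrt (\<theta> * s + (1 - \<theta>) * r) \<le> \<theta> * (1 / sqrt s) + (1 - \<theta>) * (1 / sqrt r)"
proof -
  define a where "a = sqrt s"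
  define b where "b = sqrt r"
  have ab: "a > 0" "b > 0" "s = a\<^sup>2" "r = b\<^sup>2" unfolding a_def b_def using assms by auto
  define m where "m = \<theta> * a + (1 - \<theta>) * b"
  have m: "m > 0" unfolding m_def using ab assms
    by (smt (verit) mult_nonneg_nonneg mult_pos_pos)
  have "\<theta> * s + (1 - \<theta>) * r - m\<^sup>2 = \<theta> * (1 - \<theta>) * (a - b)\<^sup>2"
    unfolding m_def ab by algebra
  also have "\<dots> \<ge> 0" using assms by simp
  finally have "sqrt (\<theta> * s + (1 - \<theta>) * r) \<ge> m" using m by (intro real_le_rsqrt) simp
  moreover from this have "sqrt (\<theta> * s + (1 - \<theta>) * r) > 0" using m by linarith
  ultimately have "1 / sqrt (\<theta> * s + (1 - \<theta>) * r) \<le> 1 / m" using m by (intro divide_left_mono mult_pos_pos) auto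
  also have "\<dots> \<le> \<theta> * (1 / a) + (1 - \<theta>) * (1 / b)"
  proof -
    have "(\<theta> * b + (1 - \<theta>) * a) * m - a * b = \<theta> * (1 - \<theta>) * (a - b)\<^sup>2"
      unfolding m_def by algebra
    also have "\<dots> \<ge> 0" using assms by simp
    finally have "a * b \<le> (\<theta> * b + (1 - \<theta>) * a) * m" by simp
    then have "1 / m \<le> (\<theta> * b + (1 - \<theta>) * a) / (a * b)" using ab m by (simp add: divide_simps mult_ac)
    also have "\<dots> = \<theta> * (1 / a) + (1 - \<theta>) * (1 / b)" using ab by (simp add: field_simps)
    finally show ?thesis .
  qed
  finally show ?thesis by (simp add: a_def b_def)
qed

text \<open>
  The reciprocal \<open>s p\<close> of the ratio is affine in \<open>1 / (1 - \<tau> + p)\<close>, with coefficients depending on \<open>u\<close>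
  and \<open>B\<close>. The weight \<open>\<theta>\<close> expresses \<open>1 / (1 - \<tau> + p)\<close> as a convex combination of its values at \<open>p1\<close> and
  \<open>0\<close>, so it depends on neither \<open>u\<close> nor \<open>B\<close>. That is what allows the inequality to be integrated over
  \<open>u\<close>.
\<close>

lemma mobius_ratio_sqrt_convex:
  fixes B u \<tau> p p1 :: real
  assumes "B \<ge> 0" "u \<ge> 0" "0 < \<tau>" "\<tau> < 1" "0 < p" "p < p1"
  defines "\<theta> \<equiv> p * (1 - \<tau> + p1) / (p1 * (1 - \<tau> + p))"
  defines "h \<equiv> \<lambda>p. (1 - \<tau> + p) / (((1 + u * \<tau>) * B + \<tau> - \<tau>\<^sup>2) + (u\<^sup>2 * B + 2 + u * (2 - \<tau>)) * p)"
  shows "sqrt (h p) \<le> \<theta> * sqrt (h p1) + (1 - \<theta>) * sqrt (h 0)"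
proof -
  define e0 where "e0 = (1 + u * \<tau>) * B + \<tau> - \<tau>\<^sup>2"
  define e1 where "e1 = u\<^sup>2 * B + 2 + u * (2 - \<tau>)"
  have "\<tau> - \<tau>\<^sup>2 = \<tau> * (1 - \<tau>)" by algebra
  then have "\<tau> - \<tau>\<^sup>2 > 0" using assms by simp
  moreover have "(1 + u * \<tau>) * B \<ge> 0" using assms by simp
  ultimately have e0: "e0 > 0" unfolding e0_def by linarith
  have e1: "e1 > 0" unfolding e1_def using assms by (intro add_nonneg_pos add_pos_nonneg) auto
  have w: "1 - \<tau> + p > 0" "1 - \<tau> + p1 > 0" "1 - \<tau> > 0" "p1 > 0" using assms by auto
  have \<theta>: "0 \<le> \<theta>" unfolding \<theta>_def using assms w by simp
  have \<theta>1: "\<theta> \<le> 1"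
  proof -
    have "p * (1 - \<tau> + p1) \<le> p1 * (1 - \<tau> + p)"
    proof -
      have "p1 * (1 - \<tau> + p) - p * (1 - \<tau> + p1) = (p1 - p) * (1 - \<tau>)" by algebra
      also have "\<dots> \<ge> 0" using assms by simp
      finally show ?thesis by simp
    qed
    then show ?thesis unfolding \<theta>_def using w by (simp add: divide_simps)
  qed
  define s where "s = (\<lambda>p. (e0 + e1 * p) / (1 - \<tau> + p))"
  have hs: "sqrt (h q) = 1 / sqrt (s q)" for q
    unfolding h_def s_def e0_def e1_def by (simp add: real_sqrt_divide)
  have sp: "s p1 > 0" "s 0 > 0" unfolding s_def using e0 e1 w assms by (auto intro!: divide_pos_pos add_pos_nonneg)
  have "s p = \<theta> * s p1 + (1 - \<theta>) * s 0"
  proof -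
    have l: "\<theta> * (p1 * (1 - \<tau> + p)) = p * (1 - \<tau> + p1)" unfolding \<theta>_def using w by simp
    have 1: "\<theta> * s p1 = p * (e0 + e1 * p1) / (p1 * (1 - \<tau> + p))"
      unfolding \<theta>_def s_def using w by simp
    have 2: "1 - \<theta> = (p1 - p) * (1 - \<tau>) / (p1 * (1 - \<tau> + p))"
    proof -
      have "1 - \<theta> = (p1 * (1 - \<tau> + p) - p * (1 - \<tau> + p1)) / (p1 * (1 - \<tau> + p))"
        unfolding \<theta>_def using w by (simp add: diff_divide_distrib)
      also have "p1 * (1 - \<tau> + p) - p * (1 - \<tau> + p1) = (p1 - p) * (1 - \<tau>)" by algebra
      finally show ?thesis .
    qed
    have 3: "(1 - \<theta>) * s 0 = (p1 - p) * e0 / (p1 * (1 - \<tau> + p))"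
      unfolding 2 s_def using w by simp
    have "\<theta> * s p1 + (1 - \<theta>) * s 0 = (p * (e0 + e1 * p1) + (p1 - p) * e0) / (p1 * (1 - \<tau> + p))"
      unfolding 1 3 by (simp add: add_divide_distrib)
    also have "p * (e0 + e1 * p1) + (p1 - p) * e0 = p1 * (e0 + e1 * p)" by algebra
    also have "p1 * (e0 + e1 * p) / (p1 * (1 - \<tau> + p)) = s p" unfolding s_def using w by simp
    finally show ?thesis ..
  qed
  then show ?thesis unfolding hs using inverse_sqrt_convex[OF sp \<theta> \<theta>1] by simp
qed

lemma cone_kernel_equalise_pair:
  assumes S: "finite S" "i \<in> S" "j \<in> S" "i \<noteq> j"
    and x: "\<And>l. l \<in> S \<Longrightarrow> 0 \<le> x l" "\<And>l. l \<in> S \<Longrightarrow> x l \<le> 1" and u: "u \<ge> 0"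
    and big: "1 \<le> x i + x j"
  defines "\<tau> \<equiv> x i + x j"
  shows "cone_kernel S x u \<le> cone_kernel S (x(i := \<tau> / 2, j := \<tau> / 2)) u"
proof -
  define J where "J = S - {i, j}"
  define x' where "x' = x(i := \<tau> / 2, j := \<tau> / 2)"
  have J: "finite J" "i \<notin> J" "j \<notin> J" "S = insert i (insert j J)" using S by (auto simp: J_def)
  have xij: "0 \<le> x i" "0 \<le> x j" "x i \<le> 1" "x j \<le> 1" using x S by auto
  have x': "\<And>l. l \<in> S \<Longrightarrow> 0 \<le> x' l" using x xij by (auto simp: x'_def \<tau>_def)
  have same: "x' l = x l" if "l \<in> J" for l using that J by (auto simp: x'_def)
  define B where "B = (\<Sum>l\<in>J. x l * (1 - x l) / (1 + u * x l))"
  define C where "C = (\<tau> + (\<Sum>l\<in>J. x l)) * (\<Prod>l\<in>J. 1 - x l) / (\<Prod>l\<in>J. 1 + u * x l)"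
  define h where "h = (\<lambda>p. (1 - \<tau> + p) / (((1 + u * \<tau>) * B + \<tau> - \<tau>\<^sup>2) + (u\<^sup>2 * B + 2 + u * (2 - \<tau>)) * p))"
  have B: "B \<ge> 0" unfolding B_def using x u J by (intro sum_nonneg divide_nonneg_nonneg mult_nonneg_nonneg) auto
  have C: "C \<ge> 0" unfolding C_def \<tau>_def using x u J xij
    by (intro divide_nonneg_nonneg mult_nonneg_nonneg add_nonneg_nonneg sum_nonneg prod_nonneg) auto
  have k: "cone_kernel S x u = sqrt (C * h (x i * x j))"
    using cone_kernel_pair[OF J(1-3) S(4), of x u] x u J(4) by (simp add: C_def h_def B_def \<tau>_def)
  define p1 where "p1 = \<tau> / 2 * (\<tau> / 2)"
  have "x' i + x' j = \<tau>" "x' i * x' j = p1" using S by (auto simp: x'_def p1_def)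
  then have k': "cone_kernel S x' u = sqrt (C * h p1)"
    using cone_kernel_pair[OF J(1-3) S(4), of x' u] x' u J(4) same by (simp add: C_def h_def B_def)
  have "(1 - x i) * (1 - x j) \<ge> 0" using xij by simp
  then have pl: "\<tau> - 1 \<le> x i * x j" by (simp add: \<tau>_def algebra_simps)
  have "p1 - x i * x j = ((x i - x j) / 2)\<^sup>2"
    by (simp add: p1_def \<tau>_def power2_eq_square field_simps)
  also have "\<dots> \<ge> 0" by simp
  finally have pu: "x i * x j \<le> p1" by simp
  have "h (x i * x j) \<le> h p1"
    unfolding h_def using B u big xij pl pu by (intro mobius_ratio_mono) (auto simp: \<tau>_def)
  then show ?thesis unfolding x'_def[symmetric] k k' using C by (intro real_sqrt_le_mono mult_left_mono)
qed

text \<open>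
  The order of the quantifiers matters: one weight \<open>\<theta>\<close> serves all \<open>u\<close>. The two competing points have
  the pair of coordinates equal, or one of them zero; since the sum is less than \<open>1\<close>, both points stay
  in the cube.
\<close>

lemma cone_kernel_convex_pair:
  assumes S: "finite S" "i \<in> S" "j \<in> S" "i \<noteq> j"
    and x: "\<And>l. l \<in> S \<Longrightarrow> 0 \<le> x l" "\<And>l. l \<in> S \<Longrightarrow> x l \<le> 1"
    and small: "x i + x j < 1" and pos: "x i > 0" "x j > 0" and ne: "x i \<noteq> x j"
  defines "\<tau> \<equiv> x i + x j"
  obtains \<theta> where "0 \<le> \<theta>" "\<theta> \<le> 1"
    "\<And>u. u \<ge> 0 \<Longrightarrow> cone_kernel S x u \<le>
      \<theta> * cone_kernel S (x(i := \<tau> / 2, j := \<tau> / 2)) u + (1 - \<theta>) * cone_kernel S (x(i := \<tau>, j := 0)) u"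
proof -
  define J where "J = S - {i, j}"
  define x' where "x' = x(i := \<tau> / 2, j := \<tau> / 2)"
  define x'' where "x'' = x(i := \<tau>, j := 0)"
  have J: "finite J" "i \<notin> J" "j \<notin> J" "S = insert i (insert j J)" using S by (auto simp: J_def)
  have x': "\<And>l. l \<in> S \<Longrightarrow> 0 \<le> x' l" using x pos by (auto simp: x'_def \<tau>_def)
  have x'': "\<And>l. l \<in> S \<Longrightarrow> 0 \<le> x'' l" using x pos by (auto simp: x''_def \<tau>_def)
  have same: "x' l = x l" "x'' l = x l" if "l \<in> J" for l using that J by (auto simp: x'_def x''_def)
  define p where "p = x i * x j"
  define p1 where "p1 = \<tau> / 2 * (\<tau> / 2)"
  have p: "p > 0" using pos by (simp add: p_def)
  have "p1 - p = ((x i - x j) / 2)\<^sup>2"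
    by (simp add: p1_def p_def \<tau>_def power2_eq_square field_simps)
  also have "\<dots> > 0" using ne by simp
  finally have pp1: "p < p1" by simp
  have \<tau>: "0 < \<tau>" "\<tau> < 1" using small pos by (auto simp: \<tau>_def)
  define \<theta> where "\<theta> = p * (1 - \<tau> + p1) / (p1 * (1 - \<tau> + p))"
  have \<theta>0: "\<theta> \<ge> 0" unfolding \<theta>_def using p pp1 \<tau> by simp
  have "p1 * (1 - \<tau> + p) - p * (1 - \<tau> + p1) = (p1 - p) * (1 - \<tau>)" by algebra
  also have "\<dots> \<ge> 0" using pp1 \<tau> by simp
  finally have \<theta>1: "\<theta> \<le> 1" unfolding \<theta>_def using p pp1 \<tau> by (simp add: divide_simps)
  have "cone_kernel S x u \<le> \<theta> * cone_kernel S x' u + (1 - \<theta>) * cone_kernel S x'' u" if u: "u \<ge> 0" for u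
  proof -
    define B where "B = (\<Sum>l\<in>J. x l * (1 - x l) / (1 + u * x l))"
    define C where "C = (\<tau> + (\<Sum>l\<in>J. x l)) * (\<Prod>l\<in>J. 1 - x l) / (\<Prod>l\<in>J. 1 + u * x l)"
    define h where "h = (\<lambda>p. (1 - \<tau> + p) / (((1 + u * \<tau>) * B + \<tau> - \<tau>\<^sup>2) + (u\<^sup>2 * B + 2 + u * (2 - \<tau>)) * p))"
    have B: "B \<ge> 0" unfolding B_def using x u J by (intro sum_nonneg divide_nonneg_nonneg mult_nonneg_nonneg) auto
    have C: "C \<ge> 0" unfolding C_def using x u J \<tau>
      by (intro divide_nonneg_nonneg mult_nonneg_nonneg add_nonneg_nonneg sum_nonneg prod_nonneg) auto
    have k: "cone_kernel S x u = sqrt (C * h p)"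
      using cone_kernel_pair[OF J(1-3) S(4), of x u] x u J(4) by (simp add: C_def h_def B_def \<tau>_def p_def)
    have "x' i + x' j = \<tau>" "x' i * x' j = p1" using S by (auto simp: x'_def p1_def)
    then have k': "cone_kernel S x' u = sqrt (C * h p1)"
      using cone_kernel_pair[OF J(1-3) S(4), of x' u] x' u J(4) same by (simp add: C_def h_def B_def)
    have "x'' i = \<tau>" "x'' j = 0" using S by (auto simp: x''_def)
    then have k'': "cone_kernel S x'' u = sqrt (C * h 0)"
      using cone_kernel_pair[OF J(1-3) S(4), of x'' u] x'' u J(4) same by (simp add: C_def h_def B_def)
    have "sqrt (h p) \<le> \<theta> * sqrt (h p1) + (1 - \<theta>) * sqrt (h 0)"
      unfolding h_def \<theta>_def using B u \<tau> p pp1 by (rule mobius_ratio_sqrt_convex)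
    then have "sqrt C * sqrt (h p) \<le> sqrt C * (\<theta> * sqrt (h p1) + (1 - \<theta>) * sqrt (h 0))"
      using C by (intro mult_left_mono) auto
    then show ?thesis unfolding k k' k'' by (simp add: real_sqrt_mult algebra_simps)
  qed
  with \<theta>0 \<theta>1 that show thesis unfolding x'_def x''_def by blast
qed

section \<open>Maximising over the points of the cube with a given sum\<close>

lemma cone_mass_mono:
  assumes "finite I" and x: "\<And>i. i \<in> I \<Longrightarrow> 0 \<le> x i" "\<And>i. i \<in> I \<Longrightarrow> x i \<le> 1" "(\<Sum>i\<in>I. x i) = A"
    and y: "\<And>i. i \<in> I \<Longrightarrow> 0 \<le> y i" "\<And>i. i \<in> I \<Longrightarrow> y i \<le> 1" "(\<Sum>i\<in>I. y i) = A" and A: "A > 1"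
    and le: "\<And>u. u \<ge> 0 \<Longrightarrow> cone_kernel I x u \<le> cone_kernel I y u"
  shows "cone_mass I x \<le> cone_mass I y"
proof -
  have "(\<integral>t. cone_kernel I x (t\<^sup>2) / (1 + t\<^sup>2) \<partial>lborel) \<le> (\<integral>t. cone_kernel I y (t\<^sup>2) / (1 + t\<^sup>2) \<partial>lborel)"
    by (intro integral_mono integrable_cone_kernel[where A = A] assms divide_right_mono le) (auto simp: add_nonneg_nonneg)
  then show ?thesis unfolding cone_mass_def by (intro divide_right_mono) auto
qed

lemma cone_mass_convex_combination:
  assumes I: "finite I" and x: "\<And>i. i \<in> I \<Longrightarrow> 0 \<le> x i" "\<And>i. i \<in> I \<Longrightarrow> x i \<le> 1" "(\<Sum>i\<in>I. x i) = A"
    and y: "\<And>i. i \<in> I \<Longrightarrow> 0 \<le> y i" "\<And>i. i \<in> I \<Longrightarrow> y i \<le> 1" "(\<Sum>i\<in>I. y i) = A"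
    and w: "\<And>i. i \<in> I \<Longrightarrow> 0 \<le> w i" "\<And>i. i \<in> I \<Longrightarrow> w i \<le> 1" "(\<Sum>i\<in>I. w i) = A" and A: "A > 1"
    and le: "\<And>u. u \<ge> 0 \<Longrightarrow> cone_kernel I x u \<le> \<theta> * cone_kernel I y u + (1 - \<theta>) * cone_kernel I w u"
  shows "cone_mass I x \<le> \<theta> * cone_mass I y + (1 - \<theta>) * cone_mass I w"
proof -
  have iy: "integrable lborel (\<lambda>t. cone_kernel I y (t\<^sup>2) / (1 + t\<^sup>2))"
    by (rule integrable_cone_kernel[OF I y A])
  have iw: "integrable lborel (\<lambda>t. cone_kernel I w (t\<^sup>2) / (1 + t\<^sup>2))"
    by (rule integrable_cone_kernel[OF I w A])
  have "(\<integral>t. cone_kernel I x (t\<^sup>2) / (1 + t\<^sup>2) \<partial>lborel) \<le>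
      (\<integral>t. \<theta> * (cone_kernel I y (t\<^sup>2) / (1 + t\<^sup>2)) + (1 - \<theta>) * (cone_kernel I w (t\<^sup>2) / (1 + t\<^sup>2)) \<partial>lborel)"
  proof (rule integral_mono)
    show "integrable lborel (\<lambda>t. cone_kernel I x (t\<^sup>2) / (1 + t\<^sup>2))"
      by (rule integrable_cone_kernel[OF I x A])
    show "integrable lborel (\<lambda>t. \<theta> * (cone_kernel I y (t\<^sup>2) / (1 + t\<^sup>2)) + (1 - \<theta>) * (cone_kernel I w (t\<^sup>2) / (1 + t\<^sup>2)))"
      by (intro Bochner_Integration.integrable_add integrable_mult_right iy iw)
    fix t :: real
    have "cone_kernel I x (t\<^sup>2) / (1 + t\<^sup>2) \<le> (\<theta> * cone_kernel I y (t\<^sup>2) + (1 - \<theta>) * cone_kernel I w (t\<^sup>2)) / (1 + t\<^sup>2)"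
      by (intro divide_right_mono le) (auto simp: add_nonneg_nonneg)
    then show "cone_kernel I x (t\<^sup>2) / (1 + t\<^sup>2) \<le>
       \<theta> * (cone_kernel I y (t\<^sup>2) / (1 + t\<^sup>2)) + (1 - \<theta>) * (cone_kernel I w (t\<^sup>2) / (1 + t\<^sup>2))"
      by (simp add: add_divide_distrib)
  qed
  also have "\<dots> = \<theta> * (\<integral>t. cone_kernel I y (t\<^sup>2) / (1 + t\<^sup>2) \<partial>lborel) + (1 - \<theta>) * (\<integral>t. cone_kernel I w (t\<^sup>2) / (1 + t\<^sup>2) \<partial>lborel)"

    by (simp only: Bochner_Integration.integral_add[OF integrable_mult_right[OF iy] integrable_mult_right[OF iw]] integral_mult_right_zero)
  finally have "cone_mass I x \<le> (\<theta> * (\<integral>t. cone_kernel I y (t\<^sup>2) / (1 + t\<^sup>2) \<partial>lborel) + (1 - \<theta>) * (\<integral>t. cone_kernel I w (t\<^sup>2) / (1 + t\<^sup>2) \<partial>lborel)) / pi"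
    unfolding cone_mass_def by (intro divide_right_mono) auto
  then show ?thesis by (simp add: cone_mass_def add_divide_distrib)
qed

lemma compact_capped_simplex:
  fixes S :: "nat set"
  assumes "finite S"
  shows "compact {x. (\<forall>i. x i \<in> (if i \<in> S then {0..1} else {0::real})) \<and> (\<Sum>i\<in>S. x i) = A}"
proof -
  have "compactin (product_topology (\<lambda>i::nat. euclidean :: real topology) UNIV) (Pi\<^sub>E UNIV (\<lambda>i. if i \<in> S then {0..1} else {0}))"
    unfolding compactin_PiE by (auto simp: compactin_euclidean_iff)
  then have "compact (Pi\<^sub>E UNIV (\<lambda>i. if i \<in> S then {0..1} else {0::real}))"
    by (simp add: euclidean_product_topology compactin_euclidean_iff)
  moreover have "closed {x. (\<Sum>i\<in>S. x i) = A}"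
    by (intro closed_Collect_eq continuous_intros continuous_on_product_coordinates)
  ultimately have "compact (Pi\<^sub>E UNIV (\<lambda>i. if i \<in> S then {0..1} else {0::real}) \<inter> {x. (\<Sum>i\<in>S. x i) = A})"
    by (rule compact_Int_closed)
  also have "Pi\<^sub>E UNIV (\<lambda>i. if i \<in> S then {0..1} else {0::real}) \<inter> {x. (\<Sum>i\<in>S. x i) = A} =
     {x. (\<forall>i. x i \<in> (if i \<in> S then {0..1} else {0::real})) \<and> (\<Sum>i\<in>S. x i) = A}"
    by (rule set_eqI) (simp only: Int_iff mem_Collect_eq PiE_iff UNIV_I extensional_UNIV ball_UNIV simp_thms)
  finally show ?thesis .
qed

text \<open>
  Induction on the number of coordinates: a point with a zero coordinate is covered by the induction
  hypothesis. If the claim failed, choose \<open>\<epsilon> > 0\<close> so small that the value of \<open>cone_mass\<close> minus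
  \<open>\<epsilon> * \<Sum> (x i)\<^sup>2\<close> still exceeds \<open>m\<close> somewhere, and take a maximiser \<open>x\<close> of this penalised functional.
  All its coordinates are positive. Two different coordinates are impossible: making them equal lowers
  the penalty, hence strictly lowers \<open>cone_mass\<close>, which is absurd if their sum is at least \<open>1\<close>. If the
  sum is less than \<open>1\<close>, moving the whole sum to one of them leads to a value of at most \<open>m\<close>, whereas
  convexity forbids that both moves decrease \<open>cone_mass\<close>. So all coordinates are equal. The penalty is what excludes pairs of coordinates along which \<open>cone_mass\<close> is constant.
\<close>

proposition cone_mass_le_equal_mass:
  fixes S :: "nat set"
  assumes A: "A > 1" and m: "m \<ge> 0"
    and S: "finite S" and eq: "\<And>k. A < real k \<Longrightarrow> k \<le> card S \<Longrightarrow> equal_mass A k \<le> m"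
    and y: "\<And>i. i \<in> S \<Longrightarrow> 0 \<le> y i" "\<And>i. i \<in> S \<Longrightarrow> y i \<le> 1" "(\<Sum>i\<in>S. y i) = A"
  shows "cone_mass S y \<le> m"
  using S eq y
proof (induction S arbitrary: y rule: finite_psubset_induct)
  case (psubset S)
  note S = \<open>finite S\<close> and eq = psubset.prems(1) and y = psubset.prems(2-4)
  have less: "cone_mass S x \<le> m" if x: "\<And>i. i \<in> S \<Longrightarrow> 0 \<le> x i" "\<And>i. i \<in> S \<Longrightarrow> x i \<le> 1" "(\<Sum>i\<in>S. x i) = A"
    and j: "j \<in> S" "x j = 0" for x j
  proof -
    have "cone_mass S x = cone_mass (S - {j}) x" using S j by (intro cone_mass_drop_zeros) auto
    also have "\<dots> \<le> m"
    proof (rule psubset.IH)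
      fix k assume "A < real k" "k \<le> card (S - {j})"
      then show "equal_mass A k \<le> m" using eq[of k] S j by (meson card_Diff1_le order_trans)
    qed (use S x j in \<open>auto simp: sum_diff1\<close>)
    finally show ?thesis .
  qed
  define K where "K = {x. (\<forall>i. x i \<in> (if i \<in> S then {0..1} else {0::real})) \<and> (\<Sum>i\<in>S. x i) = A}"
  have K: "x \<in> K \<longleftrightarrow> (\<forall>i\<in>S. 0 \<le> x i \<and> x i \<le> 1) \<and> (\<forall>i. i \<notin> S \<longrightarrow> x i = 0) \<and> (\<Sum>i\<in>S. x i) = A" for x
    unfolding K_def by (auto split: if_splits)
  show ?case
  proof (rule ccontr)
    assume "\<not> cone_mass S y \<le> m"
    then have gt: "cone_mass S y > m" by simp
    define \<epsilon> where "\<epsilon> = (cone_mass S y - m) / (card S + 1)"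
    have \<epsilon>: "\<epsilon> > 0" unfolding \<epsilon>_def using gt by simp
    define g where "g = (\<lambda>x. cone_mass S x - \<epsilon> * (\<Sum>i\<in>S. (x i)\<^sup>2))"
    define y0 where "y0 = (\<lambda>i. if i \<in> S then y i else 0)"
    have y0: "y0 \<in> K" unfolding K using y by (auto simp: y0_def)
    have "continuous_on K (cone_mass S)"
      by (rule continuous_on_subset[OF cone_mass_continuous[OF S A]]) (auto simp: K)
    then have "continuous_on K g"
      unfolding g_def
      by (intro continuous_intros continuous_on_subset[OF continuous_on_product_coordinates]) auto
    moreover have "compact K" unfolding K_def by (rule compact_capped_simplex[OF S])
    ultimately obtain x where x: "x \<in> K" and max: "\<And>z. z \<in> K \<Longrightarrow> g z \<le> g x"
      using continuous_attains_sup[of K g] y0 by blast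
    have x0: "\<And>i. i \<in> S \<Longrightarrow> 0 \<le> x i" and x1: "\<And>i. i \<in> S \<Longrightarrow> x i \<le> 1" and xA: "(\<Sum>i\<in>S. x i) = A"
      and xout: "\<And>i. i \<notin> S \<Longrightarrow> x i = 0"
      using x unfolding K by auto
    have "g y0 > m"
    proof -
      have "(\<Sum>i\<in>S. (y0 i)\<^sup>2) \<le> (\<Sum>i\<in>S. 1)"
        using y by (intro sum_mono) (auto simp: y0_def power_le_one)
      then have "\<epsilon> * (\<Sum>i\<in>S. (y0 i)\<^sup>2) \<le> \<epsilon> * card S" using \<epsilon> by (intro mult_left_mono) auto
      also have "\<dots> < \<epsilon> * (card S + 1)" using \<epsilon> by simp
      also have "\<dots> = cone_mass S y - m" unfolding \<epsilon>_def by simp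
      finally have "cone_mass S y - \<epsilon> * (\<Sum>i\<in>S. (y0 i)\<^sup>2) > m" by simp
      moreover have "cone_mass S y0 = cone_mass S y" by (rule cone_mass_cong) (simp add: y0_def)
      ultimately show ?thesis by (simp add: g_def)
    qed
    also have "g y0 \<le> g x" by (rule max[OF y0])
    also have "g x \<le> cone_mass S x" unfolding g_def using \<epsilon> by (simp add: sum_nonneg)
    finally have xm: "cone_mass S x > m" .
    have pos: "x i > 0" if "i \<in> S" for i
      using less[of x i] x0 x1 xA xm that by (metis less_eq_real_def not_le)
    have "S \<noteq> {}" using A xA by auto
    show False
    proof (cases "\<exists>i\<in>S. \<exists>j\<in>S. x i \<noteq> x j")
      case False
      then obtain w where w: "\<And>i. i \<in> S \<Longrightarrow> x i = w" using \<open>S \<noteq> {}\<close> by blast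
      have cS: "card S \<ge> 1" using S \<open>S \<noteq> {}\<close> by (simp add: Suc_leI card_gt_0_iff)
      have wA: "real (card S) * w = A" using xA w by simp
      show False
      proof (cases "w = 1")
        \<comment> \<open>This happens only if \<open>A\<close> is the number of coordinates.\<close>
        case True
        obtain i where i: "i \<in> S" using \<open>S \<noteq> {}\<close> by auto
        have "cone_kernel S x u = 0" for u using cone_kernel_eq_0[of S i x u] S i w True by simp
        then have "cone_mass S x = 0" by (simp add: cone_mass_def)
        then show False using xm m by simp
      next
        case False
        then have "w < 1" using w x1 \<open>S \<noteq> {}\<close> by fastforce
        then have "A < card S" using wA cS by (metis mult.right_neutral mult_less_cancel_left_pos of_nat_0_less_iff less_le_trans zero_less_one)
        moreover have "x i = A / card S" if "i \<in> S" for i using w[OF that] wA cS by (simp add: field_simps)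
        ultimately have "cone_mass S x = equal_mass A (card S)"
          using S cS A by (intro cone_mass_const) auto
        then show False using eq[OF \<open>A < card S\<close>] xm by simp
      qed
    next
      case True
      then obtain i j where ij: "i \<in> S" "j \<in> S" "x i \<noteq> x j" by auto
      then have "i \<noteq> j" by auto
      define \<tau> where "\<tau> = x i + x j"
      define x' where "x' = x(i := \<tau> / 2, j := \<tau> / 2)"
      define J where "J = S - {i, j}"
      have J: "finite J" "i \<notin> J" "j \<notin> J" "S = insert i (insert j J)" using S ij by (auto simp: J_def)
      have sumS: "(\<Sum>l\<in>S. f l) = f i + (f j + (\<Sum>l\<in>J. f l))" for f :: "nat \<Rightarrow> real"
        using J \<open>i \<noteq> j\<close> by simp
      have sJ: "(\<Sum>l\<in>J. f (x' l)) = (\<Sum>l\<in>J. f (x l))" for f :: "real \<Rightarrow> real"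
        using J by (intro sum.cong) (auto simp: x'_def)
      have x'v: "x' i = \<tau> / 2" "x' j = \<tau> / 2" using \<open>i \<noteq> j\<close> by (auto simp: x'_def)
      have x'A: "(\<Sum>l\<in>S. x' l) = A"
        using xA sJ[of "\<lambda>t. t"] by (simp add: sumS x'v \<tau>_def)
      have \<tau>2: "0 < \<tau>" "\<tau> \<le> 2" using pos[OF ij(1)] pos[OF ij(2)] x1[OF ij(1)] x1[OF ij(2)] by (auto simp: \<tau>_def)
      have x'01: "0 \<le> x' l" "x' l \<le> 1" if "l \<in> S" for l
        using that x0 x1 \<tau>2 by (auto simp: x'_def)
      have "x' \<in> K" unfolding K using x'01 x'A xout ij by (auto simp: x'_def)
      then have gle: "g x' \<le> g x" by (rule max)
      have "(\<Sum>l\<in>S. (x l)\<^sup>2) - (\<Sum>l\<in>S. (x' l)\<^sup>2) = (x i - x j)\<^sup>2 / 2"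
        using sJ[of "\<lambda>t. t\<^sup>2"] by (simp add: sumS x'v \<tau>_def power2_eq_square field_simps)
      also have "\<dots> > 0" using ij by simp
      finally have "\<epsilon> * (\<Sum>l\<in>S. (x' l)\<^sup>2) < \<epsilon> * (\<Sum>l\<in>S. (x l)\<^sup>2)" using \<epsilon> by simp
      then have lt: "cone_mass S x' < cone_mass S x" using gle by (simp add: g_def)
      show False
      proof (cases "1 \<le> \<tau>")
        case True
        have "cone_mass S x \<le> cone_mass S x'"
        proof (rule cone_mass_mono[OF S x0 x1 xA x'01 x'A A])
          fix u :: real assume "u \<ge> 0"
          then show "cone_kernel S x u \<le> cone_kernel S x' u"
            using True unfolding x'_def \<tau>_def
            by (intro cone_kernel_equalise_pair S ij(1,2) \<open>i \<noteq> j\<close> x0 x1)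
        qed
        then show False using lt by simp
      next
        case False
        define x'' where "x'' = x(i := \<tau>, j := 0)"
        have sJ'': "(\<Sum>l\<in>J. x'' l) = (\<Sum>l\<in>J. x l)"
          using J by (intro sum.cong) (auto simp: x''_def)
        have x''v: "x'' i = \<tau>" "x'' j = 0" using \<open>i \<noteq> j\<close> by (auto simp: x''_def)
        have x''A: "(\<Sum>l\<in>S. x'' l) = A" using xA by (simp add: sumS x''v sJ'' \<tau>_def)
        have x''01: "0 \<le> x'' l" "x'' l \<le> 1" if "l \<in> S" for l
          using that x0 x1 \<tau>2 False by (auto simp: x''_def)
        have lt'': "cone_mass S x'' < cone_mass S x"
          using less[OF x''01 x''A ij(2) x''v(2)] xm by simp
        have "x i + x j < 1" using False by (simp add: \<tau>_def)
        from cone_kernel_convex_pair[OF S ij(1,2) \<open>i \<noteq> j\<close> x0 x1 this pos[OF ij(1)] pos[OF ij(2)] ij(3)]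
        obtain \<theta> where \<theta>: "0 \<le> \<theta>" "\<theta> \<le> 1"
          and le: "\<And>u. u \<ge> 0 \<Longrightarrow> cone_kernel S x u \<le> \<theta> * cone_kernel S x' u + (1 - \<theta>) * cone_kernel S x'' u"
          unfolding x'_def x''_def \<tau>_def by blast
        have "cone_mass S x \<le> \<theta> * cone_mass S x' + (1 - \<theta>) * cone_mass S x''"
          by (rule cone_mass_convex_combination[OF S x0 x1 xA x'01 x'A x''01 x''A A le])
        also have "\<dots> < cone_mass S x"
        proof (cases "\<theta> = 0")
          case True
          then show ?thesis using lt'' by simp
        next
          case False
          then have "\<theta> * cone_mass S x' < \<theta> * cone_mass S x" using \<theta> lt by simp
          moreover have "(1 - \<theta>) * cone_mass S x'' \<le> (1 - \<theta>) * cone_mass S x"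
            using \<theta> lt'' by (intro mult_left_mono) auto
          ultimately show ?thesis by (simp add: algebra_simps)
        qed
        finally show False by simp
      qed
    qed
  qed
qed

text \<open>
  Unlike the bounds for \<open>cone_kernel\<close>, these include the case \<open>A = 1\<close>.
\<close>

lemma equal_kernel_bounds:
  assumes "k \<ge> 1" "0 < A" "A \<le> k" "u \<ge> 0"
  shows "0 \<le> equal_kernel A k u" "equal_kernel A k u \<le> 1"
proof -
  have "0 \<le> (1 - A / k) / (1 + u * (A / k))" "(1 - A / k) / (1 + u * (A / k)) \<le> 1"
    using assms by (auto simp: divide_simps add_nonneg_nonneg) (smt (verit) mult_nonneg_nonneg)+
  then show "0 \<le> equal_kernel A k u" "equal_kernel A k u \<le> 1"
    by (auto simp: equal_kernel_def power_le_one)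
qed

lemma integrable_equal_kernel:
  assumes "k \<ge> 1" "0 < A" "A \<le> k"
  shows "integrable lborel (\<lambda>y. equal_kernel A k (y\<^sup>2) / (1 + y\<^sup>2))"
proof (rule Bochner_Integration.integrable_bound[OF integrable_inverse_1_plus_square[of 1]])
  have "norm (equal_kernel A k (y\<^sup>2) / (1 + y\<^sup>2)) \<le> norm (1 / (1 + y\<^sup>2))" for y :: real
    using equal_kernel_bounds[OF assms, of "y\<^sup>2"] by (auto simp: abs_mult intro!: divide_right_mono)
  then show "AE y in lborel. norm (equal_kernel A k (y\<^sup>2) / (1 + y\<^sup>2)) \<le> norm (1 / (1 + y\<^sup>2))" by simp
qed (unfold equal_kernel_def, measurable)

text \<open>
  The integrand has the primitive \<open>arctan (y / sqrt (2 + y\<^sup>2))\<close>, which tends to \<open>pi / 4\<close>.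
\<close>

lemma equal_mass_1_2: "equal_mass 1 2 = 1 / 2"
proof -
  define f where "f = (\<lambda>y::real. 1 / ((1 + y\<^sup>2) * sqrt (2 + y\<^sup>2)))"
  have fm[measurable]: "f \<in> borel_measurable borel" unfolding f_def by measurable
  have f0: "f y \<ge> 0" for y unfolding f_def by (simp add: add_nonneg_nonneg)
  have half: "(\<integral>\<^sup>+y. ennreal (f y) * indicator {0..} y \<partial>lborel) = ennreal (pi / 4 - arctan (0 / sqrt (2 + 0\<^sup>2)))"
  proof (rule nn_integral_FTC_atLeast[OF fm])
    have "((\<lambda>y::real. y / sqrt (2 + y\<^sup>2)) \<longlongrightarrow> 1) at_top" by real_asymp
    then have "((\<lambda>y::real. arctan (y / sqrt (2 + y\<^sup>2))) \<longlongrightarrow> arctan 1) at_top" by (rule tendsto_arctan)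
    then show "((\<lambda>y::real. arctan (y / sqrt (2 + y\<^sup>2))) \<longlongrightarrow> pi / 4) at_top" by (simp add: arctan_one)
    fix y :: real
    define r where "r = sqrt (2 + y\<^sup>2)"
    have r: "r > 0" "r * r = 2 + y\<^sup>2" unfolding r_def by (auto simp: add_pos_nonneg add_nonneg_nonneg)
    have "((\<lambda>y. arctan (y / sqrt (2 + y\<^sup>2))) has_real_derivative
        (1 / (1 + (y / r)\<^sup>2)) * ((r - y * (y / r)) / (r * r))) (at y)"
    proof -
      have p: "2 + y\<^sup>2 > 0" by (simp add: add_pos_nonneg)
      then have "((\<lambda>y. sqrt (2 + y\<^sup>2)) has_real_derivative (y / r)) (at y)"
        by (auto intro!: derivative_eq_intros simp: r_def divide_simps)
      from DERIV_divide[OF DERIV_ident this] p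
      have "((\<lambda>y. y / sqrt (2 + y\<^sup>2)) has_real_derivative (r - y * (y / r)) / (r * r)) (at y)"
        by (simp add: r_def)
      from DERIV_chain2[OF DERIV_arctan this] show ?thesis by (simp add: r_def inverse_eq_divide)
    qed
    also have "(1 / (1 + (y / r)\<^sup>2)) * ((r - y * (y / r)) / (r * r)) = f y"
    proof -
      have y2: "y\<^sup>2 = r * r - 2" using r by simp
      have r1: "r * r > 1" "r\<^sup>2 > 1" unfolding power2_eq_square r(2) by (simp_all add: add_pos_nonneg)
      have "1 + (q - 2) / q = 2 * (q - 1) / q" if "q > 0" for q :: real
        using that by (simp add: field_simps)
      from this[of "r * r"] have e1: "1 + (y / r)\<^sup>2 = 2 * (r * r - 1) / (r * r)"
        using r(1) by (simp add: power_divide y2 power2_eq_square[of r])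
      have "r - y * (y / r) = (r * r - y\<^sup>2) / r" using r(1) by (simp add: diff_divide_distrib power2_eq_square)
      then have e2: "r - y * (y / r) = 2 / r" by (simp add: y2)
      have e3: "f y = 1 / ((r * r - 1) * r)" unfolding f_def r_def[symmetric] y2 using r(1) by simp
      have "1 / (2 * (q - 1) / q) * (2 / r / q) = 1 / ((q - 1) * r)" if "q > 1" for q
        using that r(1) by (simp add: field_simps)
      from this[OF r1(1)] show ?thesis unfolding e1 e2 e3 .
    qed
    finally show "((\<lambda>y. arctan (y / sqrt (2 + y\<^sup>2))) has_real_derivative f y) (at y)" .
  qed (rule f0)
  have "(\<integral>\<^sup>+y. ennreal (f y) \<partial>lborel) = 2 * ennreal (pi / 4)"
    using half by (subst nn_integral_even) (simp_all add: f_def)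
  then have "(\<integral>\<^sup>+y. ennreal (f y) \<partial>lborel) = ennreal (pi / 2)"
    by (simp add: ennreal_mult'[symmetric] flip: ennreal_numeral)
  then have "(\<integral>y. f y \<partial>lborel) = pi / 2"
    by (intro integral_eq_nn_integral[THEN trans]) (auto simp: f0)
  moreover have "equal_kernel 1 2 (y\<^sup>2) / (1 + y\<^sup>2) = f y" for y
  proof -
    have "2 + y\<^sup>2 > 0" by (simp add: add_pos_nonneg)
    then have "(1 - 1 / real 2) / (1 + y\<^sup>2 * (1 / real 2)) = 1 / (2 + y\<^sup>2)" by (simp add: field_simps)
    then show ?thesis by (simp add: equal_kernel_def f_def real_sqrt_divide)
  qed
  ultimately show ?thesis by (simp add: equal_mass_def)
qed

text \<open>
  Already the kernels satisfy the inequality: by Bernoulli's inequality,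
  \<open>(1 + (1 + u) / (k - 1)) ^ (k - 1) \<ge> 2 + u\<close>, with equality for \<open>k = 2\<close>.
\<close>

lemma equal_mass_1_le:
  assumes k: "k \<ge> 2"
  shows "equal_mass 1 k \<le> 1 / 2"
proof -
  have le: "equal_kernel 1 k u \<le> equal_kernel 1 2 u" if u: "u \<ge> 0" for u
  proof -
    define m where "m = k - 1"
    have m: "m \<ge> 1" "real k = real m + 1" using k by (auto simp: m_def)
    have "(1 - 1 / real k) / (1 + u * (1 / real k)) = 1 / (1 + (1 + u) / m)"
      using m u by (simp add: divide_simps add_nonneg_eq_0_iff)
    then have e: "equal_kernel 1 k u = sqrt (1 / (1 + (1 + u) / m) ^ m)"
      by (simp add: equal_kernel_def m_def power_one_over)
    have e2: "equal_kernel 1 2 u = sqrt (1 / (2 + u))"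
      using u by (simp add: equal_kernel_def divide_simps)
    have "1 + real m * ((1 + u) / m) \<le> (1 + (1 + u) / m) ^ m"
      by (rule Bernoulli_inequality) (use u in \<open>simp add: order_trans[of "-1" 0]\<close>)
    then have "2 + u \<le> (1 + (1 + u) / m) ^ m" using m by simp
    then show ?thesis unfolding e e2 using u by (intro real_sqrt_le_mono divide_left_mono) auto
  qed
  have "(\<integral>y. equal_kernel 1 k (y\<^sup>2) / (1 + y\<^sup>2) \<partial>lborel) \<le> (\<integral>y. equal_kernel 1 2 (y\<^sup>2) / (1 + y\<^sup>2) \<partial>lborel)"
    using k by (intro integral_mono integrable_equal_kernel divide_right_mono le) (auto simp: add_nonneg_nonneg)
  then have "equal_mass 1 k \<le> equal_mass 1 2" unfolding equal_mass_def by (intro divide_right_mono) auto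
  then show ?thesis by (simp add: equal_mass_1_2)
qed

section \<open>The tail of Student's distribution\<close>

text \<open>
  The integrand on the left is itself a tail integral over \<open>t \<ge> c\<close>. After exchanging the integrals, the
  integral over \<open>y\<close> is reduced by the substitution \<open>y = s * sqrt (\<nu> + t\<^sup>2) / t\<close> to one that no longer
  depends on \<open>t\<close>; its value need not be known.
\<close>

lemma cauchy_mixture_eq_student_tail:
  fixes \<nu> c :: real
  assumes \<nu>: "\<nu> > 0" and c: "c \<ge> 0"
  shows "(\<integral>\<^sup>+y. ennreal ((1 + (1 + y\<^sup>2) * c\<^sup>2 / \<nu>) powr (- (\<nu> / 2)) / (1 + y\<^sup>2)) \<partial>lborel) =
    ennreal (sqrt \<nu>) * (\<integral>\<^sup>+s. ennreal ((1 + s\<^sup>2) powr (- (\<nu> / 2) - 1)) \<partial>lborel) *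
    (\<integral>\<^sup>+t. ennreal ((1 + t\<^sup>2 / \<nu>) powr (- ((\<nu> + 1) / 2))) * indicator {c..} t \<partial>lborel)"
proof -
  define \<kappa> where "\<kappa> = (\<integral>\<^sup>+s. ennreal ((1 + s\<^sup>2) powr (- (\<nu> / 2) - 1)) \<partial>lborel)"
  define G where "G = (\<lambda>t y. ennreal (t * (1 + (1 + y\<^sup>2) * t\<^sup>2 / \<nu>) powr (- (\<nu> / 2) - 1)) * indicator {c..} t)"
  have tail: "(\<integral>\<^sup>+t. G t y \<partial>lborel) = ennreal ((1 + (1 + y\<^sup>2) * c\<^sup>2 / \<nu>) powr (- (\<nu> / 2)) / (1 + y\<^sup>2))" for y :: real
  proof -
    define b where "b = (1 + y\<^sup>2) / \<nu>"
    have b: "b > 0" "1 + y\<^sup>2 = b * \<nu>" unfolding b_def using \<nu> by (simp_all add: add_pos_nonneg)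
    have b1: "(1 + (1 + y\<^sup>2) * t\<^sup>2 / \<nu>) = 1 + b * t\<^sup>2" for t by (simp add: b_def)
    have p: "1 + b * t\<^sup>2 > 0" for t using b by (simp add: add_pos_nonneg)
    have "filterlim (\<lambda>t. 1 + b * t\<^sup>2) at_top at_top" using b(1) by real_asymp
    then have "((\<lambda>t. (1 + b * t\<^sup>2) powr (- (\<nu> / 2))) \<longlongrightarrow> 0) at_top"
      using \<nu> by (intro tendsto_neg_powr) auto
    then have lim: "((\<lambda>t. - ((1 + b * t\<^sup>2) powr (- (\<nu> / 2))) / (b * \<nu>)) \<longlongrightarrow> - 0 / (b * \<nu>)) at_top"
      using b \<nu> by (intro tendsto_intros) auto
    have "(\<integral>\<^sup>+t. ennreal (t * (1 + b * t\<^sup>2) powr (- (\<nu> / 2) - 1)) * indicator {c..} t \<partial>lborel) =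
       ennreal (- 0 / (b * \<nu>) - (- ((1 + b * c\<^sup>2) powr (- (\<nu> / 2))) / (b * \<nu>)))"
    proof (rule nn_integral_FTC_atLeast[OF _ _ _ lim])
      fix t assume t: "c \<le> t"
      show "((\<lambda>t. - ((1 + b * t\<^sup>2) powr (- (\<nu> / 2))) / (b * \<nu>)) has_real_derivative
          t * (1 + b * t\<^sup>2) powr (- (\<nu> / 2) - 1)) (at t)"
      proof -
        have "((\<lambda>t. 1 + b * t\<^sup>2) has_real_derivative 2 * b * t) (at t)"
          by (auto intro!: derivative_eq_intros)
        from DERIV_fun_powr[OF this p, of "- (\<nu> / 2)"]
        have "((\<lambda>t. (1 + b * t\<^sup>2) powr (- (\<nu> / 2))) has_real_derivative
            - (\<nu> / 2) * (1 + b * t\<^sup>2) powr (- (\<nu> / 2) - 1) * (2 * b * t)) (at t)" by simp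
        from DERIV_cdivide[OF DERIV_minus[OF this], of "b * \<nu>"] show ?thesis
          using b \<nu> by (simp add: field_simps)
      qed
      show "0 \<le> t * (1 + b * t\<^sup>2) powr (- (\<nu> / 2) - 1)" using c t by simp
    qed measurable
    then show ?thesis unfolding G_def b1 unfolding b(2) by simp
  qed
  have inner: "(\<integral>\<^sup>+y. G t y \<partial>lborel) =
      ennreal (sqrt \<nu>) * \<kappa> * (ennreal ((1 + t\<^sup>2 / \<nu>) powr (- ((\<nu> + 1) / 2))) * indicator {c..} t)" if t: "t \<noteq> 0" for t
  proof (cases "t \<ge> c")
    case False
    then show ?thesis by (simp add: G_def)
  next
    case True
    then have t0: "t > 0" using c t by simp
    define D where "D = 1 + t\<^sup>2 / \<nu>"
    have D: "D > 0" unfolding D_def using \<nu> by (simp add: add_pos_nonneg)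
    define w where "w = sqrt (D * \<nu>) / t"
    have w: "w > 0" unfolding w_def using D \<nu> t0 by simp
    have "(\<integral>\<^sup>+y. G t y \<partial>lborel) = ennreal w * (\<integral>\<^sup>+s. G t (w * s) \<partial>lborel)"
      using w unfolding G_def by (subst nn_integral_real_affine[where c = w and t = 0]) auto
    also have "(\<lambda>s. G t (w * s)) = (\<lambda>s. ennreal (t * D powr (- (\<nu> / 2) - 1)) * ennreal ((1 + s\<^sup>2) powr (- (\<nu> / 2) - 1)))"
    proof
      fix s :: real
      have "1 + (1 + (w * s)\<^sup>2) * t\<^sup>2 / \<nu> = D * (1 + s\<^sup>2)"
      proof -
        have "(w * s)\<^sup>2 * t\<^sup>2 = D * \<nu> * s\<^sup>2"
          using t0 D \<nu> by (simp add: w_def power_mult_distrib power_divide)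
        then have "(1 + (w * s)\<^sup>2) * t\<^sup>2 / \<nu> = t\<^sup>2 / \<nu> + D * s\<^sup>2" using \<nu> by (simp add: distrib_right add_divide_distrib)
        then show ?thesis by (simp add: D_def algebra_simps add_divide_distrib)
      qed
      then show "G t (w * s) = ennreal (t * D powr (- (\<nu> / 2) - 1)) * ennreal ((1 + s\<^sup>2) powr (- (\<nu> / 2) - 1))"
        using True t0 D by (simp add: G_def powr_mult add_nonneg_nonneg ennreal_mult'[symmetric] mult.assoc)
    qed
    also have "ennreal w * (\<integral>\<^sup>+s. ennreal (t * D powr (- (\<nu> / 2) - 1)) * ennreal ((1 + s\<^sup>2) powr (- (\<nu> / 2) - 1)) \<partial>lborel) =
       ennreal (w * (t * D powr (- (\<nu> / 2) - 1))) * \<kappa>"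
      using w t0 by (simp add: nn_integral_cmult \<kappa>_def ennreal_mult' mult.assoc)
    also have "w * (t * D powr (- (\<nu> / 2) - 1)) = sqrt \<nu> * D powr (- ((\<nu> + 1) / 2))"
    proof -
      have "w * t = sqrt \<nu> * D powr (1 / 2)" using t0 D by (simp add: w_def real_sqrt_mult powr_half_sqrt)
      then have "w * (t * D powr (- (\<nu> / 2) - 1)) = sqrt \<nu> * (D powr (1 / 2) * D powr (- (\<nu> / 2) - 1))"
        by (simp add: mult.assoc[symmetric])
      also have "D powr (1 / 2) * D powr (- (\<nu> / 2) - 1) = D powr (- ((\<nu> + 1) / 2))"
      proof -
        have "1 / 2 + (- (\<nu> / 2) - 1) = - ((\<nu> + 1) / 2)" by (simp add: field_simps)
        then show ?thesis unfolding powr_add[symmetric] by (rule arg_cong)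
      qed
      finally show ?thesis .
    qed
    finally show ?thesis using True \<nu> by (simp add: D_def ennreal_mult' mult_ac)
  qed
  have "(\<integral>\<^sup>+y. ennreal ((1 + (1 + y\<^sup>2) * c\<^sup>2 / \<nu>) powr (- (\<nu> / 2)) / (1 + y\<^sup>2)) \<partial>lborel) =
     (\<integral>\<^sup>+y. (\<integral>\<^sup>+t. G t y \<partial>lborel) \<partial>lborel)"
    unfolding tail ..
  also have "\<dots> = (\<integral>\<^sup>+t. (\<integral>\<^sup>+y. G t y \<partial>lborel) \<partial>lborel)"
    unfolding G_def by (rule lborel_pair.Fubini') measurable
  also have "\<dots> = (\<integral>\<^sup>+t. ennreal (sqrt \<nu>) * \<kappa> * (ennreal ((1 + t\<^sup>2 / \<nu>) powr (- ((\<nu> + 1) / 2))) * indicator {c..} t) \<partial>lborel)"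
  proof (rule nn_integral_cong_AE)
    have "AE t in lborel. t \<noteq> (0::real)" by (rule AE_lborel_singleton)
    then show "AE t in lborel. (\<integral>\<^sup>+y. G t y \<partial>lborel) =
       ennreal (sqrt \<nu>) * \<kappa> * (ennreal ((1 + t\<^sup>2 / \<nu>) powr (- ((\<nu> + 1) / 2))) * indicator {c..} t)"
      by eventually_elim (rule inner)
  qed
  also have "\<dots> = ennreal (sqrt \<nu>) * \<kappa> * (\<integral>\<^sup>+t. ennreal ((1 + t\<^sup>2 / \<nu>) powr (- ((\<nu> + 1) / 2))) * indicator {c..} t \<partial>lborel)"
    by (rule nn_integral_cmult) measurable
  finally show ?thesis unfolding \<kappa>_def .
qed

text \<open>
  By the previous lemma the right-hand side is a constant times the tail integral of the density. At
  \<open>c = 0\<close> both sides are equal to \<open>1 / 2\<close>, by symmetry and total mass one, which determines the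
  constant without any computation with the Gamma function.
\<close>

lemma student_t_tail:
  fixes N :: "'b measure" and T :: "'b \<Rightarrow> real"
  assumes \<nu>: "\<nu> \<ge> 1" and N: "prob_space N"
    and T: "distributed N lborel T (\<lambda>x. ennreal (student_t_density \<nu> x))" and c: "c \<ge> 0"
  shows "\<P>(x in N. T x > c) =
    (\<integral>y. (1 + (1 + y\<^sup>2) * c\<^sup>2 / \<nu>) powr (- (real \<nu> / 2)) / (1 + y\<^sup>2) \<partial>lborel) / (2 * pi)"
proof -
  interpret N: prob_space N by fact
  define C where "C = Gamma ((real \<nu> + 1) / 2) / (sqrt (real \<nu> * pi) * Gamma (real \<nu> / 2))"
  have C: "C > 0" unfolding C_def using \<nu> by (intro divide_pos_pos mult_pos_pos Gamma_real_pos) auto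
  define w where "w = (\<lambda>t. (1 + t\<^sup>2 / real \<nu>) powr (- ((real \<nu> + 1) / 2)))"
  have [measurable]: "w \<in> borel_measurable borel" unfolding w_def by measurable
  have w0: "w t \<ge> 0" for t unfolding w_def by simp
  have dens: "ennreal (student_t_density \<nu> t) = ennreal C * ennreal (w t)" for t
  proof -
    have "student_t_density \<nu> t = C * w t" by (simp add: student_t_density_def C_def w_def)
    then show ?thesis using C by (simp add: ennreal_mult')
  qed
  define J where "J = (\<lambda>c. \<integral>\<^sup>+t. ennreal (w t) * indicator {c..} t \<partial>lborel)"
  define g where "g = (\<lambda>c. \<integral>\<^sup>+y. ennreal ((1 + (1 + y\<^sup>2) * c\<^sup>2 / \<nu>) powr (- (real \<nu> / 2)) / (1 + y\<^sup>2)) \<partial>lborel)"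
  define \<kappa> where "\<kappa> = ennreal (sqrt \<nu>) * (\<integral>\<^sup>+s. ennreal ((1 + s\<^sup>2) powr (- (real \<nu> / 2) - 1)) \<partial>lborel)"
  have g: "g c = \<kappa> * J c" if "c \<ge> 0" for c
    unfolding g_def \<kappa>_def J_def w_def using \<nu> that by (intro cauchy_mixture_eq_student_tail) auto
  have g0: "g 0 = ennreal pi" unfolding g_def by (simp add: nn_integral_inverse_1_plus_square)
  have "1 = emeasure N (space N)" by (simp add: N.emeasure_space_1)
  also have "\<dots> = emeasure N (T -` UNIV \<inter> space N)" by simp
  also have "\<dots> = (\<integral>\<^sup>+t. ennreal C * ennreal (w t) \<partial>lborel)"
    by (subst distributed_emeasure[OF T]) (simp_all add: dens)
  also have "\<dots> = ennreal C * (2 * J 0)"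
    unfolding J_def by (subst nn_integral_cmult) (simp, subst nn_integral_even, simp_all add: w_def)
  finally have one: "ennreal C * (2 * J 0) = 1" by simp
  have J0: "J 0 \<noteq> 0" "J 0 \<noteq> \<top>" using one C by (auto simp: ennreal_mult_top)
  have "\<kappa> * J 0 = ennreal pi * (ennreal C * (2 * J 0))" using g[of 0] g0 one by simp
  then have "J 0 * \<kappa> = J 0 * (ennreal (2 * pi) * ennreal C)"
    by (simp add: mult_ac ennreal_mult')
  then have \<kappa>: "\<kappa> = ennreal (2 * pi) * ennreal C" using J0 by (simp add: ennreal_mult_cancel_left)
  have "emeasure N {x \<in> space N. T x > c} = emeasure N (T -` {c<..} \<inter> space N)"
    by (rule arg_cong[where f = "emeasure N"]) auto
  also have "\<dots> = (\<integral>\<^sup>+t. ennreal C * (ennreal (w t) * indicator {c<..} t) \<partial>lborel)"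
    by (subst distributed_emeasure[OF T]) (simp_all add: dens mult.assoc)
  also have "\<dots> = (\<integral>\<^sup>+t. ennreal C * (ennreal (w t) * indicator {c..} t) \<partial>lborel)"
  proof (rule nn_integral_cong_AE)
    have "AE t in lborel. t \<noteq> c" by (rule AE_lborel_singleton)
    then show "AE t in lborel. ennreal C * (ennreal (w t) * indicator {c<..} t) = ennreal C * (ennreal (w t) * indicator {c..} t)"
      by eventually_elim (auto simp: indicator_def)
  qed
  also have "\<dots> = ennreal C * J c" unfolding J_def by (rule nn_integral_cmult) measurable
  finally have P: "ennreal (\<P>(x in N. T x > c)) = ennreal C * J c" by (simp add: N.emeasure_eq_measure)
  have "g c = ennreal (2 * pi) * ennreal (\<P>(x in N. T x > c))"
    unfolding g[OF c] \<kappa> P by (simp add: mult.assoc)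
  also have "\<dots> = ennreal (2 * pi * \<P>(x in N. T x > c))" by (simp add: ennreal_mult')
  finally have "(\<integral>y. (1 + (1 + y\<^sup>2) * c\<^sup>2 / \<nu>) powr (- (real \<nu> / 2)) / (1 + y\<^sup>2) \<partial>lborel) = 2 * pi * \<P>(x in N. T x > c)"
    unfolding g_def by (intro integral_eq_nn_integral[THEN trans]) (auto simp: add_nonneg_nonneg)
  then show ?thesis by simp
qed

lemma student_t_tail_eq_equal_mass:
  fixes N :: "'b measure" and T :: "'b \<Rightarrow> real"
  assumes A: "1 < A" "A < real k" and N: "prob_space N"
    and T: "distributed N lborel T (\<lambda>x. ennreal (student_t_density (k - 1) x))"
  shows "\<P>(x in N. T x > sqrt (A * (real k - 1) / (real k - A))) = equal_mass A k / 2"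
proof -
  define c where "c = sqrt (A * (real k - 1) / (real k - A))"
  define \<nu> where "\<nu> = k - 1"
  have \<nu>: "\<nu> \<ge> 1" "real k - 1 = real \<nu>" "real k = real \<nu> + 1" using A by (auto simp: \<nu>_def)
  have c: "c \<ge> 0" "c\<^sup>2 = A * real \<nu> / (real k - A)" unfolding c_def \<nu>(2) using A by auto
  have "(1 + (1 + u) * c\<^sup>2 / \<nu>) powr (- (real \<nu> / 2)) = equal_kernel A k u" if u: "u \<ge> 0" for u
  proof -
    define D where "D = 1 + (1 + u) * c\<^sup>2 / \<nu>"
    have D: "D > 0" unfolding D_def using u by (intro add_pos_nonneg divide_nonneg_nonneg mult_nonneg_nonneg) auto
    have kA: "real k - A > 0" "real k > 0" using A by auto
    have uk: "real k + u * A > 0" using kA u A by (intro add_pos_nonneg) auto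
    have "D = 1 + (1 + u) * A / (real k - A)" unfolding D_def c(2) using \<nu> by simp
    also have "\<dots> = (real k + u * A) / (real k - A)" using kA by (simp add: field_simps)
    finally have "1 / D = (real k - A) / (real k + u * A)" by simp
    also have "\<dots> = (1 - A / real k) / (1 + u * (A / real k))"
    proof -
      have "1 - A / real k = (real k - A) / real k" "1 + u * (A / real k) = (real k + u * A) / real k"
        using kA by (simp_all add: field_simps)
      then show ?thesis using kA by simp
    qed
    finally have "equal_kernel A k u = sqrt ((1 / D) ^ \<nu>)" unfolding equal_kernel_def \<nu>_def by simp
    also have "\<dots> = sqrt ((1 / D) powr real \<nu>)" using D by (simp add: powr_realpow)
    also have "\<dots> = ((1 / D) powr real \<nu>) powr (1 / 2)" by (simp add: powr_half_sqrt)
    also have "\<dots> = (1 / D) powr (real \<nu> / 2)" by (simp add: powr_powr)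
    also have "\<dots> = D powr (- (real \<nu> / 2))" using D by (simp add: powr_divide powr_minus_divide)
    finally show ?thesis unfolding D_def ..
  qed
  then have "(\<integral>y. (1 + (1 + y\<^sup>2) * c\<^sup>2 / \<nu>) powr (- (real \<nu> / 2)) / (1 + y\<^sup>2) \<partial>lborel) =
     (\<integral>y. equal_kernel A k (y\<^sup>2) / (1 + y\<^sup>2) \<partial>lborel)" by simp
  then show ?thesis
    using student_t_tail[OF \<nu>(1) N _ c(1)] T unfolding c_def[symmetric] \<nu>_def[symmetric] equal_mass_def by simp
qed

section \<open>Self-normalised sums of independent normal variables\<close>

lemma PiM_density_lborel:
  fixes \<phi> :: "real \<Rightarrow> real"
  assumes I: "finite I" and [measurable]: "\<phi> \<in> borel_measurable borel" and \<phi>0: "\<And>x. \<phi> x \<ge> 0"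
    and P: "prob_space (density lborel (\<lambda>x. ennreal (\<phi> x)))"
  shows "Pi\<^sub>M I (\<lambda>_. density lborel (\<lambda>x. ennreal (\<phi> x))) = density (coord_lebesgue I) (\<lambda>z. ennreal (\<Prod>i\<in>I. \<phi> (z i)))"
proof -
  interpret P: prob_space "density lborel (\<lambda>x. ennreal (\<phi> x))" by fact
  interpret D: product_sigma_finite "\<lambda>_. density lborel (\<lambda>x. ennreal (\<phi> x))" by standard
  interpret L: product_sigma_finite "\<lambda>_. lborel :: real measure" by standard
  have comp[measurable]: "(\<lambda>z. z i) \<in> borel_measurable (coord_lebesgue I)" if "i \<in> I" for i
    using measurable_component_singleton[OF that, of "\<lambda>_. lborel :: real measure"] by simp
  show ?thesis
  proof (rule D.PiM_eqI[OF I, symmetric])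
    show "sets (density (coord_lebesgue I) (\<lambda>z. ennreal (\<Prod>i\<in>I. \<phi> (z i)))) = sets (Pi\<^sub>M I (\<lambda>_. density lborel (\<lambda>x. ennreal (\<phi> x))))"
      unfolding sets_density by (rule sets_PiM_cong) auto
    fix A assume A: "\<And>i. i \<in> I \<Longrightarrow> A i \<in> sets (density lborel (\<lambda>x. ennreal (\<phi> x)))"
    then have A': "\<And>i. i \<in> I \<Longrightarrow> A i \<in> sets lborel" by simp
    have "emeasure (density (coord_lebesgue I) (\<lambda>z. ennreal (\<Prod>i\<in>I. \<phi> (z i)))) (Pi\<^sub>E I A) =
       (\<integral>\<^sup>+z. ennreal (\<Prod>i\<in>I. \<phi> (z i)) * indicator (Pi\<^sub>E I A) z \<partial>coord_lebesgue I)"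
      using A' I by (intro emeasure_density) (auto intro!: sets_PiM_I_finite)
    also have "\<dots> = (\<integral>\<^sup>+z. (\<Prod>i\<in>I. ennreal (\<phi> (z i)) * indicator (A i) (z i)) \<partial>coord_lebesgue I)"
    proof (rule nn_integral_cong)
      fix z assume "z \<in> space (coord_lebesgue I)"
      then have "indicator (Pi\<^sub>E I A) z = (\<Prod>i\<in>I. indicator (A i) (z i) :: ennreal)"
        using I by (auto simp: indicator_def space_PiM PiE_iff prod_zero_iff)
      then show "ennreal (\<Prod>i\<in>I. \<phi> (z i)) * indicator (Pi\<^sub>E I A) z = (\<Prod>i\<in>I. ennreal (\<phi> (z i)) * indicator (A i) (z i))"
        using \<phi>0 by (simp add: prod_ennreal prod.distrib)
    qed
    also have "\<dots> = (\<Prod>i\<in>I. \<integral>\<^sup>+x. ennreal (\<phi> x) * indicator (A i) x \<partial>lborel)"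
    proof (rule L.product_nn_integral_prod[OF I])
      fix i assume "i \<in> I"
      then show "(\<lambda>x. ennreal (\<phi> x) * indicator (A i) x) \<in> borel_measurable lborel"
        using A' by (intro borel_measurable_times_ennreal borel_measurable_indicator) auto
    qed
    also have "\<dots> = (\<Prod>i\<in>I. emeasure (density lborel (\<lambda>x. ennreal (\<phi> x))) (A i))"
      using A' by (intro prod.cong refl emeasure_density[symmetric]) auto
    finally show "emeasure (density (coord_lebesgue I) (\<lambda>z. ennreal (\<Prod>i\<in>I. \<phi> (z i)))) (Pi\<^sub>E I A) =
        (\<Prod>i\<in>I. emeasure (density lborel (\<lambda>x. ennreal (\<phi> x))) (A i))" .
  qed
qed

lemma real_quadratic_finite_roots:
  fixes a b c :: real
  assumes "a \<noteq> 0"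
  shows "finite {t. a * t\<^sup>2 + b * t + c = 0}"
proof -
  have "[:c, b, a:] \<noteq> 0" using assms by simp
  from poly_roots_finite[OF this] show ?thesis
    by (rule rev_finite_subset) (auto simp: power2_eq_square algebra_simps)
qed

text \<open>
  The sum is continuous in \<open>v\<close>, vanishes at \<open>v = 0\<close>, and tends to the number of positive weights as \<open>v\<close>
  tends to infinity.
\<close>

lemma ex_normalising_scale:
  fixes w :: "nat \<Rightarrow> real" and A :: real
  assumes I: "finite I" and w: "\<And>i. i \<in> I \<Longrightarrow> w i \<ge> 0" and A: "A > 0" "A < card {i\<in>I. w i > 0}"
  obtains v where "v > 0" "(\<Sum>i\<in>I. v * w i / (1 + v * w i)) = A"
proof -
  define F where "F = (\<lambda>v. \<Sum>i\<in>I. v * w i / (1 + v * w i))"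
  have "((\<lambda>v. v * w i / (1 + v * w i)) \<longlongrightarrow> (if w i > 0 then 1 else 0)) at_top" if "i \<in> I" for i
  proof (cases "w i > 0")
    case True
    then have "((\<lambda>v. v * w i / (1 + v * w i)) \<longlongrightarrow> 1) at_top" by real_asymp
    then show ?thesis using True by simp
  next
    case False
    then have "w i = 0" using w[OF that] by simp
    then show ?thesis by simp
  qed
  then have "(F \<longlongrightarrow> (\<Sum>i\<in>I. if w i > 0 then 1 else 0)) at_top"
    unfolding F_def by (rule tendsto_sum)
  moreover have "(\<Sum>i\<in>I. if w i > 0 then 1 else (0::real)) = card {i\<in>I. w i > 0}"
    using I by (simp add: sum.If_cases Int_def)
  ultimately have "\<forall>\<^sub>F v in at_top. F v > A" using A(2) by (simp add: order_tendstoD)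
  then obtain v1 where v1: "\<And>v. v \<ge> v1 \<Longrightarrow> F v > A" by (auto simp: eventually_at_top_linorder)
  define b where "b = max v1 1"
  have cont: "continuous_on {0..b} F"
    unfolding F_def using w
    by (intro continuous_intros) (auto simp: add_nonneg_eq_0_iff)
  have "F 0 = 0" by (simp add: F_def)
  then have "\<exists>v\<ge>0. v \<le> b \<and> F v = A"
    using IVT'[of F 0 A b] cont v1[of b] A(1) by (auto simp: b_def less_imp_le)
  then obtain v where v: "v \<ge> 0" "F v = A" by auto
  then have "v \<noteq> 0" using \<open>F 0 = 0\<close> A(1) by auto
  then show thesis using that[of v] v by (simp add: F_def)
qed

locale independent_normals = prob_space M for M :: "'a measure" +
  fixes Z :: "nat \<Rightarrow> 'a \<Rightarrow> real" and n :: nat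
  assumes n: "n > 1"
    and indep: "indep_vars (\<lambda>_. borel) Z {1..n}"
    and normal: "\<And>i. i \<in> {1..n} \<Longrightarrow> distributed M lborel (Z i) (\<lambda>x. ennreal (std_normal_density x))"
begin

lemma measurable_Z[measurable]: "i \<in> {1..n} \<Longrightarrow> Z i \<in> borel_measurable M"
  using normal[of i] unfolding distributed_def by simp

lemma emeasure_normal_event:
  assumes Q[measurable]: "Measurable.pred (coord_lebesgue {1..n}) Q"
  shows "emeasure M {\<omega> \<in> space M. Q (\<lambda>i\<in>{1..n}. Z i \<omega>)} =
    (\<integral>\<^sup>+z. ennreal (\<Prod>i\<in>{1..n}. std_normal_density (z i)) * indicator {z. Q z} z \<partial>coord_lebesgue {1..n})"
proof -
  let ?I = "{1..n}"
  let ?X = "\<lambda>\<omega>. \<lambda>i\<in>?I. Z i \<omega>"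
  have sets_eq: "sets (Pi\<^sub>M ?I (\<lambda>_. borel :: real measure)) = sets (coord_lebesgue ?I)"
    by (rule sets_PiM_cong) auto
  have X[measurable]: "?X \<in> M \<rightarrow>\<^sub>M Pi\<^sub>M ?I (\<lambda>_. borel)"
    by (rule measurable_restrict) (rule measurable_Z)
  have Zi: "distr M borel (Z i) = density lborel (\<lambda>x. ennreal (std_normal_density x))" if "i \<in> ?I" for i
  proof -
    have "distr M borel (Z i) = distr M lborel (Z i)" by (rule distr_cong) auto
    then show ?thesis using distributed_distr_eq_density[OF normal[OF that]] by simp
  qed
  have ne: "?I \<noteq> {}" using n by auto
  have "distr M (Pi\<^sub>M ?I (\<lambda>_. borel)) ?X = Pi\<^sub>M ?I (\<lambda>i. distr M borel (Z i))"
    using indep_vars_iff_distr_eq_PiM'[where I = ?I and M' = "\<lambda>_. borel" and X = Z] indep ne measurable_Z by blast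
  also have "\<dots> = Pi\<^sub>M ?I (\<lambda>_. density lborel (\<lambda>x. ennreal (std_normal_density x)))"
    using Zi by (rule PiM_cong[OF refl])
  also have "\<dots> = density (coord_lebesgue ?I) (\<lambda>z. ennreal (\<Prod>i\<in>?I. std_normal_density (z i)))"
    by (rule PiM_density_lborel) (auto intro: prob_space_normal_density)
  finally have law: "distr M (Pi\<^sub>M ?I (\<lambda>_. borel)) ?X = density (coord_lebesgue ?I) (\<lambda>z. ennreal (\<Prod>i\<in>?I. std_normal_density (z i)))" .
  define E where "E = {z \<in> space (coord_lebesgue ?I). Q z}"
  have E[measurable]: "E \<in> sets (coord_lebesgue ?I)" unfolding E_def by measurable
  have "{\<omega> \<in> space M. Q (?X \<omega>)} = ?X -` E \<inter> space M"
    by (auto simp: E_def space_PiM)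
  then have "emeasure M {\<omega> \<in> space M. Q (?X \<omega>)} = emeasure (distr M (Pi\<^sub>M ?I (\<lambda>_. borel)) ?X) E"
    using E by (subst emeasure_distr[OF X]) (simp_all only: sets_eq)
  also have "\<dots> = (\<integral>\<^sup>+z. ennreal (\<Prod>i\<in>?I. std_normal_density (z i)) * indicator E z \<partial>coord_lebesgue ?I)"
    unfolding law by (intro emeasure_density E) measurable
  also have "\<dots> = (\<integral>\<^sup>+z. ennreal (\<Prod>i\<in>?I. std_normal_density (z i)) * indicator {z. Q z} z \<partial>coord_lebesgue ?I)"
    by (intro nn_integral_cong) (auto simp: E_def indicator_def)
  finally show ?thesis .
qed

definition cone_prob :: "(nat \<Rightarrow> real) \<Rightarrow> real \<Rightarrow> real" where
  "cone_prob \<sigma> A = \<P>(\<omega> in M. (\<Sum>i=1..n. \<sigma> i * Z i \<omega>)\<^sup>2 > A * (\<Sum>i=1..n. (\<sigma> i)\<^sup>2 * (Z i \<omega>)\<^sup>2))"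

lemma ratio_event_eq_cone_prob:
  "\<P>(\<omega> in M. (\<Sum>i=1..n. \<sigma> i * Z i \<omega>)\<^sup>2 / (\<Sum>i=1..n. (\<sigma> i)\<^sup>2 * (Z i \<omega>)\<^sup>2) > a\<^sup>2) = cone_prob \<sigma> (a\<^sup>2)"
proof -
  have "(\<Sum>i=1..n. \<sigma> i * Z i \<omega>)\<^sup>2 / (\<Sum>i=1..n. (\<sigma> i)\<^sup>2 * (Z i \<omega>)\<^sup>2) > a\<^sup>2 \<longleftrightarrow>
     (\<Sum>i=1..n. \<sigma> i * Z i \<omega>)\<^sup>2 > a\<^sup>2 * (\<Sum>i=1..n. (\<sigma> i)\<^sup>2 * (Z i \<omega>)\<^sup>2)" for \<omega>
  proof -
    let ?V = "\<Sum>i=1..n. (\<sigma> i)\<^sup>2 * (Z i \<omega>)\<^sup>2"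
    have V: "?V \<ge> 0" by (intro sum_nonneg) simp
    show ?thesis
    proof (cases "?V = 0")
      case True
      then have "\<sigma> i * Z i \<omega> = 0" if "i \<in> {1..n}" for i
        using that by (subst (asm) sum_nonneg_eq_0_iff) auto
      then have "(\<Sum>i=1..n. \<sigma> i * Z i \<omega>) = 0" by (intro sum.neutral) blast
      then show ?thesis using True by simp
    next
      case False
      then show ?thesis using V by (simp add: less_divide_eq)
    qed
  qed
  then show ?thesis unfolding cone_prob_def by simp
qed

lemma cone_prob_antimono:
  assumes "A \<le> B"
  shows "cone_prob \<sigma> B \<le> cone_prob \<sigma> A"
  unfolding cone_prob_def
proof (rule finite_measure_mono)
  show "{\<omega> \<in> space M. (\<Sum>i=1..n. \<sigma> i * Z i \<omega>)\<^sup>2 > B * (\<Sum>i=1..n. (\<sigma> i)\<^sup>2 * (Z i \<omega>)\<^sup>2)} \<subseteq>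
     {\<omega> \<in> space M. (\<Sum>i=1..n. \<sigma> i * Z i \<omega>)\<^sup>2 > A * (\<Sum>i=1..n. (\<sigma> i)\<^sup>2 * (Z i \<omega>)\<^sup>2)}"
  proof clarify
    fix \<omega>
    assume *: "(\<Sum>i=1..n. \<sigma> i * Z i \<omega>)\<^sup>2 > B * (\<Sum>i=1..n. (\<sigma> i)\<^sup>2 * (Z i \<omega>)\<^sup>2)"
    have "A * (\<Sum>i=1..n. (\<sigma> i)\<^sup>2 * (Z i \<omega>)\<^sup>2) \<le> B * (\<Sum>i=1..n. (\<sigma> i)\<^sup>2 * (Z i \<omega>)\<^sup>2)"
      using assms by (intro mult_right_mono sum_nonneg) auto
    with * show "(\<Sum>i=1..n. \<sigma> i * Z i \<omega>)\<^sup>2 > A * (\<Sum>i=1..n. (\<sigma> i)\<^sup>2 * (Z i \<omega>)\<^sup>2)" by linarith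
  qed
qed measurable

text \<open>
  The event is invariant under scaling of \<open>\<sigma>\<close>, so the formula for the Gaussian cone applies to it.
\<close>

lemma cone_prob_scaled_eq_cone_mass:
  assumes x: "\<And>i. i \<in> {1..n} \<Longrightarrow> 0 \<le> x i" "\<And>i. i \<in> {1..n} \<Longrightarrow> x i < 1" and A: "(\<Sum>i=1..n. x i) = A" "A > 0"
    and s: "s > 0" and \<sigma>: "\<And>i. i \<in> {1..n} \<Longrightarrow> \<sigma> i = s * sqrt (x i / (1 - x i))"
  shows "cone_prob \<sigma> A = cone_mass {1..n} x"
proof -
  let ?I = "{1..n}"
  define \<rho> where "\<rho> = (\<lambda>i. sqrt (x i / (1 - x i)))"
  define Q where "Q = (\<lambda>z::nat \<Rightarrow> real. (\<Sum>i\<in>?I. \<rho> i * z i)\<^sup>2 > A * (\<Sum>i\<in>?I. (\<rho> i)\<^sup>2 * (z i)\<^sup>2))"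
  have "\<exists>i\<in>?I. x i > 0"
  proof (rule ccontr)
    assume "\<not> ?thesis"
    then have "(\<Sum>i=1..n. x i) \<le> 0" by (intro sum_nonpos) (meson not_less)
    then show False using A by simp
  qed
  then obtain i0 where i0: "i0 \<in> ?I" "x i0 > 0" by auto
  have ev: "(\<Sum>i=1..n. \<sigma> i * Z i \<omega>)\<^sup>2 > A * (\<Sum>i=1..n. (\<sigma> i)\<^sup>2 * (Z i \<omega>)\<^sup>2) \<longleftrightarrow> Q (\<lambda>i\<in>?I. Z i \<omega>)" for \<omega>
  proof -
    have 1: "(\<Sum>i=1..n. \<sigma> i * Z i \<omega>) = s * (\<Sum>i\<in>?I. \<rho> i * Z i \<omega>)"
      using \<sigma> by (simp add: sum_distrib_left \<rho>_def mult.assoc)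
    have 2: "(\<Sum>i=1..n. (\<sigma> i)\<^sup>2 * (Z i \<omega>)\<^sup>2) = s\<^sup>2 * (\<Sum>i\<in>?I. (\<rho> i)\<^sup>2 * (Z i \<omega>)\<^sup>2)"
      unfolding sum_distrib_left using \<sigma> by (intro sum.cong) (auto simp: \<rho>_def power_mult_distrib)
    have "(s * L)\<^sup>2 > A * (s\<^sup>2 * V) \<longleftrightarrow> L\<^sup>2 > A * V" for L V :: real
      using s by (simp add: power_mult_distrib mult.left_commute[of A])
    moreover have "(\<Sum>i\<in>?I. \<rho> i * (\<lambda>i\<in>?I. Z i \<omega>) i) = (\<Sum>i\<in>?I. \<rho> i * Z i \<omega>)"
      "(\<Sum>i\<in>?I. (\<rho> i)\<^sup>2 * ((\<lambda>i\<in>?I. Z i \<omega>) i)\<^sup>2) = (\<Sum>i\<in>?I. (\<rho> i)\<^sup>2 * (Z i \<omega>)\<^sup>2)"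
      by (auto intro!: sum.cong)
    ultimately show ?thesis unfolding 1 2 Q_def by simp
  qed
  have Qm: "Measurable.pred (coord_lebesgue ?I) Q" unfolding Q_def by measurable
  have k0: "cone_kernel ?I x (y\<^sup>2) \<ge> 0" for y
    using x by (intro cone_kernel_nonneg) (auto intro: less_imp_le)
  have "cone_prob \<sigma> A = enn2real (emeasure M {\<omega> \<in> space M. Q (\<lambda>i\<in>?I. Z i \<omega>)})"
    unfolding cone_prob_def ev measure_def ..
  also have "emeasure M {\<omega> \<in> space M. Q (\<lambda>i\<in>?I. Z i \<omega>)} =
      ennreal (1 / pi) * (\<integral>\<^sup>+y. ennreal (cone_kernel ?I x (y\<^sup>2) / (1 + y\<^sup>2)) \<partial>lborel)"
  proof -
    have "emeasure M {\<omega> \<in> space M. Q (\<lambda>i\<in>{1..n}. Z i \<omega>)} =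
        (\<integral>\<^sup>+z. ennreal (\<Prod>i\<in>{1..n}. std_normal_density (z i)) * indicator {z. Q z} z \<partial>coord_lebesgue {1..n})"
      by (rule emeasure_normal_event[OF Qm])
    also have "\<dots> = ennreal (1 / pi) * (\<integral>\<^sup>+y. ennreal (cone_kernel ?I x (y\<^sup>2) / (1 + y\<^sup>2)) \<partial>lborel)"
      unfolding Q_def A(1)[symmetric] \<rho>_def
      by (rule nn_integral_gaussian_cone) (use x i0 in auto)
    finally show ?thesis .
  qed
  also have "enn2real \<dots> = 1 / pi * enn2real (\<integral>\<^sup>+y. ennreal (cone_kernel ?I x (y\<^sup>2) / (1 + y\<^sup>2)) \<partial>lborel)"
    by (simp add: enn2real_mult)
  also have "enn2real (\<integral>\<^sup>+y. ennreal (cone_kernel ?I x (y\<^sup>2) / (1 + y\<^sup>2)) \<partial>lborel) =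
      (\<integral>y. cone_kernel ?I x (y\<^sup>2) / (1 + y\<^sup>2) \<partial>lborel)"
    using k0 by (intro integral_eq_nn_integral[symmetric]) (auto simp: add_nonneg_nonneg)
  finally show ?thesis by (simp add: cone_mass_def)
qed

text \<open>
  The Cauchy-Schwarz inequality over the indices with \<open>\<sigma> i > 0\<close>.
\<close>

lemma cone_prob_eq_0:
  assumes \<sigma>: "\<And>i. i \<in> {1..n} \<Longrightarrow> \<sigma> i \<ge> 0" and A: "real (card {i\<in>{1..n}. \<sigma> i > 0}) \<le> A"
  shows "cone_prob \<sigma> A = 0"
proof -
  let ?S = "{i\<in>{1..n}. \<sigma> i > 0}"
  have "(\<Sum>i=1..n. \<sigma> i * Z i \<omega>)\<^sup>2 \<le> A * (\<Sum>i=1..n. (\<sigma> i)\<^sup>2 * (Z i \<omega>)\<^sup>2)" for \<omega>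
  proof -
    have z: "\<sigma> i = 0" if "i \<in> {1..n} - ?S" for i using \<sigma>[of i] that by auto
    have 1: "(\<Sum>i=1..n. \<sigma> i * Z i \<omega>) = (\<Sum>i\<in>?S. \<sigma> i * Z i \<omega>)"
      using z by (intro sum.mono_neutral_right) auto
    have 2: "(\<Sum>i=1..n. (\<sigma> i)\<^sup>2 * (Z i \<omega>)\<^sup>2) = (\<Sum>i\<in>?S. (\<sigma> i * Z i \<omega>)\<^sup>2)"
      unfolding power_mult_distrib using z by (intro sum.mono_neutral_right) auto
    have "(\<Sum>i\<in>?S. \<sigma> i * Z i \<omega>)\<^sup>2 \<le> (\<Sum>i\<in>?S. (\<sigma> i * Z i \<omega>)\<^sup>2) * card ?S"
      by (rule sum_squared_le_sum_of_squares)
    also have "\<dots> \<le> (\<Sum>i\<in>?S. (\<sigma> i * Z i \<omega>)\<^sup>2) * A"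
      using A by (intro mult_left_mono sum_nonneg) auto
    finally show ?thesis unfolding 1 2 by (simp add: mult.commute)
  qed
  then have e: "{\<omega> \<in> space M. (\<Sum>i=1..n. \<sigma> i * Z i \<omega>)\<^sup>2 > A * (\<Sum>i=1..n. (\<sigma> i)\<^sup>2 * (Z i \<omega>)\<^sup>2)} = {}"
    by (auto simp: not_less[symmetric])
  show ?thesis unfolding cone_prob_def e by simp
qed

lemma cone_prob_eq_cone_mass:
  fixes A :: real
  assumes \<sigma>: "\<And>i. i \<in> {1..n} \<Longrightarrow> \<sigma> i \<ge> 0" and A: "A > 0" "A < card {i\<in>{1..n}. \<sigma> i > 0}"
  obtains x :: "nat \<Rightarrow> real" where "\<And>i. i \<in> {1..n} \<Longrightarrow> 0 \<le> x i" "\<And>i. i \<in> {1..n} \<Longrightarrow> x i < 1"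
    "(\<Sum>i=1..n. x i) = A" "cone_prob \<sigma> A = cone_mass {1..n} x"
proof -
  have "{i\<in>{1..n}. \<sigma> i > 0} = {i\<in>{1..n}. (\<sigma> i)\<^sup>2 > 0}" using \<sigma> by (auto simp: less_le)
  then obtain v where v: "v > 0" "(\<Sum>i=1..n. v * (\<sigma> i)\<^sup>2 / (1 + v * (\<sigma> i)\<^sup>2)) = A"
    using ex_normalising_scale[of "{1..n}" "\<lambda>i. (\<sigma> i)\<^sup>2" A] A by auto
  define x where "x = (\<lambda>i. v * (\<sigma> i)\<^sup>2 / (1 + v * (\<sigma> i)\<^sup>2))"
  have p: "1 + v * (\<sigma> i)\<^sup>2 > 0" for i using v by (simp add: add_pos_nonneg)
  have x: "0 \<le> x i" "x i < 1" for i
    using v p[of i] by (auto simp: x_def)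
  have "\<sigma> i = 1 / sqrt v * sqrt (x i / (1 - x i))" if "i \<in> {1..n}" for i
  proof -
    have "1 - x i = 1 / (1 + v * (\<sigma> i)\<^sup>2)" unfolding x_def using p[of i] by (simp add: field_simps)
    then have "x i / (1 - x i) = v * (\<sigma> i)\<^sup>2" unfolding x_def using p[of i] by simp
    then show ?thesis using v \<sigma>[OF that] by (simp add: real_sqrt_mult)
  qed
  then have "cone_prob \<sigma> A = cone_mass {1..n} x"
    using v A x by (intro cone_prob_scaled_eq_cone_mass[where s = "1 / sqrt v"]) (auto simp: x_def)
  then show thesis using that[of x] x v by (simp add: x_def)
qed

text \<open>
  \<open>\<sigma> = first k\<close> has the first \<open>k\<close> entries equal to one; it yields the statistic of the theorem with
  \<open>Z 1, \<dots>, Z k\<close>.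
\<close>

abbreviation first :: "nat \<Rightarrow> nat \<Rightarrow> real" where
  "first k \<equiv> (\<lambda>i. if i \<le> k then 1 else 0)"

lemma cone_prob_first:
  assumes k: "k \<in> {1..n}" and A: "0 < A" "A < real k"
  shows "cone_prob (first k) A = equal_mass A k"
proof -
  define x where "x = (\<lambda>i. if i \<le> k then A / k else 0)"
  define w where "w = A / k"
  have w: "0 < w" "w < 1" unfolding w_def using A k by auto
  have sub: "{i \<in> {1..n}. i \<le> k} = {1..k}" using k by auto
  have sum: "(\<Sum>i=1..n. x i) = A"
  proof -
    have "(\<Sum>i=1..n. x i) = (\<Sum>i\<in>{i \<in> {1..n}. i \<le> k}. A / k)"
      unfolding x_def by (rule sum.inter_filter[symmetric]) simp
    then show ?thesis unfolding sub using A by simp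
  qed
  have "cone_prob (first k) A = cone_mass {1..n} x"
  proof (rule cone_prob_scaled_eq_cone_mass[OF _ _ sum A(1)])
    show "sqrt ((1 - w) / w) > 0" using w by simp
    fix i
    have "sqrt ((1 - w) / w) * sqrt (w / (1 - w)) = 1" using w by (simp add: real_sqrt_mult[symmetric])
    then show "first k i = sqrt ((1 - w) / w) * sqrt (x i / (1 - x i))"
      by (simp add: x_def w_def)
    show "0 \<le> x i" "x i < 1" using w by (auto simp: x_def w_def)
  qed
  also have "\<dots> = cone_mass {1..k} x" using k by (intro cone_mass_drop_zeros) (auto simp: x_def)
  also have "\<dots> = equal_mass A k" using k A by (intro cone_mass_const) (auto simp: x_def)
  finally show ?thesis .
qed

lemma sum_first: "(\<Sum>i=1..n. first k i * f i) = (\<Sum>i=1..k. f i)" if "k \<le> n"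
proof -
  have "(\<Sum>i=1..n. first k i * f i) = (\<Sum>i\<in>{1..k}. first k i * f i)"
    using that by (intro sum.mono_neutral_right) auto
  also have "\<dots> = (\<Sum>i\<in>{1..k}. f i)" by (intro sum.cong) auto
  finally show ?thesis .
qed

lemma partial_sums_restrict:
  assumes "k \<le> n"
  shows "(\<Sum>i=1..k. (\<lambda>i\<in>{1..n}. Z i \<omega>) i) = (\<Sum>i=1..k. Z i \<omega>)"
    "(\<Sum>i=1..k. ((\<lambda>i\<in>{1..n}. Z i \<omega>) i)\<^sup>2) = (\<Sum>i=1..k. (Z i \<omega>)\<^sup>2)"
  using assms by (auto intro!: sum.cong)

lemma measurable_partial_sums:
  assumes "k \<le> n"
  shows "(\<lambda>z. \<Sum>i=1..k. z i) \<in> borel_measurable (coord_lebesgue {1..n})"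
    "(\<lambda>z. \<Sum>i=1..k. (z i)\<^sup>2) \<in> borel_measurable (coord_lebesgue {1..n})"
  using assms
  by (auto intro!: borel_measurable_sum borel_measurable_power)

text \<open>
  On each line in the direction of the first coordinate the condition is a quadratic equation with
  leading coefficient \<open>1 - A \<noteq> 0\<close>, so it has at most two solutions. The integer case \<open>A = k\<close>, in which
  the open cone is empty, is included.
\<close>

lemma cone_boundary_null:
  assumes k: "k \<in> {1..n}" and A: "A > 1"
  shows "emeasure M {\<omega> \<in> space M. (\<Sum>i=1..k. Z i \<omega>)\<^sup>2 = A * (\<Sum>i=1..k. (Z i \<omega>)\<^sup>2)} = 0"
proof -
  let ?I = "{1..n}"
  define L where "L = (\<lambda>z::nat \<Rightarrow> real. \<Sum>i=1..k. z i)"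
  define V where "V = (\<lambda>z::nat \<Rightarrow> real. \<Sum>i=1..k. (z i)\<^sup>2)"
  define Q where "Q = (\<lambda>z. (L z)\<^sup>2 = A * V z)"
  have kn: "k \<le> n" "1 \<in> {1..n}" using k by auto
  have [measurable]: "L \<in> borel_measurable (coord_lebesgue ?I)" "V \<in> borel_measurable (coord_lebesgue ?I)"
    unfolding L_def V_def by (rule measurable_partial_sums[OF kn(1)])+
  have Qm[measurable]: "Measurable.pred (coord_lebesgue ?I) Q"
    unfolding pred_def Q_def
    by (intro borel_measurable_eq borel_measurable_power borel_measurable_times borel_measurable_const) fact+
  define e where "e = (\<lambda>i::nat. if i = 1 then 1 else (0::real))"
  have fin: "finite {t. Q (line_point ?I e z t)}" for z
  proof -
    define b where "b = (\<Sum>i=1..k. z i)"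
    define c where "c = (\<Sum>i=1..k. (z i)\<^sup>2)"
    have 1: "(\<Sum>i=1..k. line_point ?I e z t i) = b + t" for t
    proof -
      have "(\<Sum>i=1..k. line_point ?I e z t i) = (\<Sum>i=1..k. z i + t * e i)"
        using kn by (intro sum.cong) auto
      also have "\<dots> = b + t * (\<Sum>i=1..k. e i)" by (simp add: sum.distrib b_def sum_distrib_left)
      also have "(\<Sum>i=1..k. e i) = 1" using k by (simp add: e_def)
      finally show ?thesis by simp
    qed
    have 2: "(\<Sum>i=1..k. (line_point ?I e z t i)\<^sup>2) = c + 2 * t * z 1 + t\<^sup>2" for t
    proof -
      have "(\<Sum>i=1..k. (line_point ?I e z t i)\<^sup>2) = (\<Sum>i=1..k. (z i)\<^sup>2 + (if i = 1 then 2 * t * z 1 + t\<^sup>2 else 0))"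
        using kn by (intro sum.cong) (auto simp: e_def power2_eq_square algebra_simps)
      then show ?thesis using k by (simp add: sum.distrib c_def)
    qed
    have "{t. Q (line_point ?I e z t)} = {t. (1 - A) * t\<^sup>2 + (2 * b - 2 * A * z 1) * t + (b\<^sup>2 - A * c) = 0}"
      unfolding Q_def L_def V_def 1 2 by (auto simp: power2_eq_square algebra_simps)
    also have "finite \<dots>" using A by (intro real_quadratic_finite_roots) simp
    finally show ?thesis .
  qed
  have "emeasure M {\<omega> \<in> space M. (\<Sum>i=1..k. Z i \<omega>)\<^sup>2 = A * (\<Sum>i=1..k. (Z i \<omega>)\<^sup>2)} =
      emeasure M {\<omega> \<in> space M. Q (\<lambda>i\<in>?I. Z i \<omega>)}"
    unfolding Q_def L_def V_def partial_sums_restrict[OF kn(1)] ..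
  also have "\<dots> = (\<integral>\<^sup>+z. ennreal (\<Prod>i\<in>?I. std_normal_density (z i)) * indicator {z. Q z} z \<partial>coord_lebesgue ?I)"
    by (rule emeasure_normal_event[OF Qm])
  also have "\<dots> = (\<integral>\<^sup>+z. 0 \<partial>coord_lebesgue ?I)"
  proof (rule nn_integral_eq_if_line_integrals_eq[where \<xi> = e])
    show "e 1 \<noteq> 0" by (simp add: e_def)
    fix z
    have "AE t in lborel. t \<notin> {t. Q (line_point ?I e z t)}"
      using finite_imp_null_set_lborel[OF fin] by (rule AE_not_in)
    then have "AE t in lborel. ennreal (\<Prod>i\<in>?I. std_normal_density (line_point ?I e z t i)) * indicator {z. Q z} (line_point ?I e z t) = 0"
      by eventually_elim simp
    then show "(\<integral>\<^sup>+t. ennreal (\<Prod>i\<in>?I. std_normal_density (line_point ?I e z t i)) * indicator {z. Q z} (line_point ?I e z t) \<partial>lborel) = (\<integral>\<^sup>+t. 0 \<partial>(lborel :: real measure))"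
      by (rule nn_integral_cong_AE)
    show "(\<lambda>z. ennreal (\<Prod>i\<in>?I. std_normal_density (z i)) * indicator {z. Q z} z) \<in> borel_measurable (coord_lebesgue ?I)"
      by measurable
  qed (use kn in auto)
  finally show ?thesis by simp
qed

lemma upper_tail_symmetric:
  assumes k: "k \<in> {1..n}"
  shows "\<P>(\<omega> in M. - (\<Sum>i=1..k. Z i \<omega>) > a * sqrt (\<Sum>i=1..k. (Z i \<omega>)\<^sup>2)) =
    \<P>(\<omega> in M. (\<Sum>i=1..k. Z i \<omega>) > a * sqrt (\<Sum>i=1..k. (Z i \<omega>)\<^sup>2))"
proof -
  let ?I = "{1..n}"
  have kn: "k \<le> n" using k by auto
  define L where "L = (\<lambda>z::nat \<Rightarrow> real. \<Sum>i=1..k. z i)"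
  define V where "V = (\<lambda>z::nat \<Rightarrow> real. \<Sum>i=1..k. (z i)\<^sup>2)"
  define Q where "Q = (\<lambda>z. L z > a * sqrt (V z))"
  define Q' where "Q' = (\<lambda>z. - L z > a * sqrt (V z))"
  have [measurable]: "L \<in> borel_measurable (coord_lebesgue ?I)" "V \<in> borel_measurable (coord_lebesgue ?I)"
    unfolding L_def V_def by (rule measurable_partial_sums[OF kn])+
  have Qm[measurable]: "Measurable.pred (coord_lebesgue ?I) Q" unfolding Q_def by measurable
  have Qm'[measurable]: "Measurable.pred (coord_lebesgue ?I) Q'" unfolding Q'_def by measurable
  have flip: "Q' (\<lambda>i\<in>?I. 0 + - 1 * z i) \<longleftrightarrow> Q z" for z
  proof -
    have "(\<Sum>i=1..k. (\<lambda>i\<in>?I. 0 + - 1 * z i) i) = - (\<Sum>i=1..k. z i)"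
      unfolding sum_negf[symmetric] using kn by (intro sum.cong) auto
    moreover have "(\<Sum>i=1..k. ((\<lambda>i\<in>?I. 0 + - 1 * z i) i)\<^sup>2) = (\<Sum>i=1..k. (z i)\<^sup>2)"
      using kn by (intro sum.cong) auto
    ultimately show ?thesis unfolding Q_def Q'_def L_def V_def by simp
  qed
  have "emeasure M {\<omega> \<in> space M. Q' (\<lambda>i\<in>?I. Z i \<omega>)} =
     (\<integral>\<^sup>+z. ennreal (\<Prod>i\<in>?I. std_normal_density (z i)) * indicator {z. Q' z} z \<partial>coord_lebesgue ?I)"
    by (rule emeasure_normal_event[OF Qm'])
  also have "\<dots> = (\<integral>\<^sup>+z. ennreal (\<Prod>i\<in>?I. std_normal_density ((\<lambda>i\<in>?I. 0 + - 1 * z i) i)) * indicator {z. Q' z} (\<lambda>i\<in>?I. 0 + - 1 * z i) \<partial>coord_lebesgue ?I)"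
  proof (rule nn_integral_coord_lebesgue_affine[symmetric])
    show "(\<lambda>z. ennreal (\<Prod>i\<in>?I. std_normal_density (z i)) * indicator {z. Q' z} z) \<in> borel_measurable (coord_lebesgue ?I)"
      by measurable
  qed simp_all
  also have "\<dots> = (\<integral>\<^sup>+z. ennreal (\<Prod>i\<in>?I. std_normal_density (z i)) * indicator {z. Q z} z \<partial>coord_lebesgue ?I)"
  proof (rule nn_integral_cong)
    fix z :: "nat \<Rightarrow> real"
    have "(\<Prod>i\<in>?I. std_normal_density ((\<lambda>i\<in>?I. 0 + - 1 * z i) i)) = (\<Prod>i\<in>?I. std_normal_density (z i))"
      by (intro prod.cong refl) (simp add: std_normal_density_def)
    moreover have "indicator {z. Q' z} (\<lambda>i\<in>?I. 0 + - 1 * z i) = (indicator {z. Q z} z :: ennreal)"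
      unfolding indicator_def mem_Collect_eq flip ..
    ultimately show "ennreal (\<Prod>i\<in>?I. std_normal_density ((\<lambda>i\<in>?I. 0 + - 1 * z i) i)) * indicator {z. Q' z} (\<lambda>i\<in>?I. 0 + - 1 * z i) =
       ennreal (\<Prod>i\<in>?I. std_normal_density (z i)) * indicator {z. Q z} z"
      by (simp only:)
  qed
  also have "\<dots> = emeasure M {\<omega> \<in> space M. Q (\<lambda>i\<in>?I. Z i \<omega>)}"
    by (rule emeasure_normal_event[OF Qm, symmetric])
  finally have "measure M {\<omega> \<in> space M. Q' (\<lambda>i\<in>?I. Z i \<omega>)} = measure M {\<omega> \<in> space M. Q (\<lambda>i\<in>?I. Z i \<omega>)}"
    by (simp add: measure_def)
  then show ?thesis unfolding Q_def Q'_def L_def V_def partial_sums_restrict[OF kn] .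
qed

text \<open>
  The cone \<open>L\<^sup>2 > a\<^sup>2 * V\<close> consists of two opposite halves of equal probability, and its boundary is null.
\<close>

lemma equal_weights_tail:
  assumes k: "k \<in> {1..n}" and a: "a > 1"
  shows "\<P>(\<omega> in M. (\<Sum>i=1..k. Z i \<omega>) / sqrt (\<Sum>i=1..k. (Z i \<omega>)\<^sup>2) \<ge> a) = cone_prob (first k) (a\<^sup>2) / 2"
proof -
  have kn: "k \<le> n" using k by auto
  define L where "L = (\<lambda>\<omega>. \<Sum>i=1..k. Z i \<omega>)"
  define V where "V = (\<lambda>\<omega>. \<Sum>i=1..k. (Z i \<omega>)\<^sup>2)"
  have [measurable]: "L \<in> borel_measurable M" "V \<in> borel_measurable M"
    unfolding L_def V_def using kn by (auto intro!: borel_measurable_sum borel_measurable_power measurable_Z)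
  have V0: "V \<omega> \<ge> 0" for \<omega> unfolding V_def by (intro sum_nonneg) simp
  have VL: "L \<omega> = 0" if "V \<omega> = 0" for \<omega>
  proof -
    have "\<And>i. i \<in> {1..k} \<Longrightarrow> Z i \<omega> = 0"
      using that unfolding V_def by (subst (asm) sum_nonneg_eq_0_iff) auto
    then show ?thesis unfolding L_def by (intro sum.neutral) blast
  qed
  have "(first k i)\<^sup>2 = first k i" for i by simp
  then have "cone_prob (first k) (a\<^sup>2) = \<P>(\<omega> in M. (L \<omega>)\<^sup>2 > a\<^sup>2 * V \<omega>)"
    unfolding cone_prob_def L_def V_def by (simp only: sum_first[OF kn])
  also have "{\<omega> \<in> space M. (L \<omega>)\<^sup>2 > a\<^sup>2 * V \<omega>} =
     {\<omega> \<in> space M. L \<omega> > a * sqrt (V \<omega>)} \<union> {\<omega> \<in> space M. - L \<omega> > a * sqrt (V \<omega>)}"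
  proof -
    have "(L \<omega>)\<^sup>2 > a\<^sup>2 * V \<omega> \<longleftrightarrow> \<bar>L \<omega>\<bar> > a * sqrt (V \<omega>)" for \<omega>
    proof -
      have "a\<^sup>2 * V \<omega> = (a * sqrt (V \<omega>))\<^sup>2" using V0 by (simp add: power_mult_distrib)
      moreover have "a * sqrt (V \<omega>) \<ge> 0" using a V0 by simp
      moreover have "(L \<omega>)\<^sup>2 > (a * sqrt (V \<omega>))\<^sup>2 \<longleftrightarrow> sqrt ((L \<omega>)\<^sup>2) > sqrt ((a * sqrt (V \<omega>))\<^sup>2)"
        by (rule real_sqrt_less_iff[symmetric])
      ultimately show ?thesis by (simp only: real_sqrt_abs abs_of_nonneg)
    qed
    then have "(L \<omega>)\<^sup>2 > a\<^sup>2 * V \<omega> \<longleftrightarrow> L \<omega> > a * sqrt (V \<omega>) \<or> - L \<omega> > a * sqrt (V \<omega>)" for \<omega>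
      unfolding abs_real_def by auto
    then show ?thesis by blast
  qed
  also have "measure M \<dots> = \<P>(\<omega> in M. L \<omega> > a * sqrt (V \<omega>)) + \<P>(\<omega> in M. - L \<omega> > a * sqrt (V \<omega>))"
  proof (rule finite_measure_Union)
    have "\<not> (L \<omega> > a * sqrt (V \<omega>) \<and> - L \<omega> > a * sqrt (V \<omega>))" for \<omega>
    proof -
      have "a * sqrt (V \<omega>) \<ge> 0" using a V0 by simp
      then show ?thesis by linarith
    qed
    then show "{\<omega> \<in> space M. L \<omega> > a * sqrt (V \<omega>)} \<inter> {\<omega> \<in> space M. - L \<omega> > a * sqrt (V \<omega>)} = {}" by auto
  qed measurable
  also have "\<P>(\<omega> in M. - L \<omega> > a * sqrt (V \<omega>)) = \<P>(\<omega> in M. L \<omega> > a * sqrt (V \<omega>))"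
    unfolding L_def V_def by (rule upper_tail_symmetric[OF k])
  also have "\<P>(\<omega> in M. L \<omega> > a * sqrt (V \<omega>)) = \<P>(\<omega> in M. L \<omega> / sqrt (V \<omega>) \<ge> a)"
  proof (rule measure_eq_AE)
    have "{\<omega> \<in> space M. (L \<omega>)\<^sup>2 = a\<^sup>2 * V \<omega>} \<in> null_sets M"
    proof (rule null_setsI)
      have "1 < a\<^sup>2" using a by (simp add: one_less_power)
      then show "emeasure M {\<omega> \<in> space M. (L \<omega>)\<^sup>2 = a\<^sup>2 * V \<omega>} = 0"
        unfolding L_def V_def by (rule cone_boundary_null[OF k])
    qed measurable
    then have "AE \<omega> in M. \<not> (L \<omega>)\<^sup>2 = a\<^sup>2 * V \<omega>"
      by (rule AE_I') auto
    then show "AE \<omega> in M. \<omega> \<in> {\<omega> \<in> space M. L \<omega> > a * sqrt (V \<omega>)} \<longleftrightarrow> \<omega> \<in> {\<omega> \<in> space M. L \<omega> / sqrt (V \<omega>) \<ge> a}"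
    proof eventually_elim
      case (elim \<omega>)
      then have "V \<omega> \<noteq> 0" using VL by auto
      then have V: "sqrt (V \<omega>) > 0" using V0[of \<omega>] by simp
      have "L \<omega> \<noteq> a * sqrt (V \<omega>)" using elim V0[of \<omega>] by (auto simp: power_mult_distrib)
      then show ?case using V by (auto simp: le_divide_eq)
    qed
  qed measurable
  finally show ?thesis unfolding L_def V_def by simp
qed

lemma cone_prob_le_equal_mass:
  assumes A: "A > 1" and m: "m \<ge> 0" and eq: "\<And>k. A < real k \<Longrightarrow> k \<le> n \<Longrightarrow> equal_mass A k \<le> m"
    and \<sigma>: "\<And>i. i \<in> {1..n} \<Longrightarrow> \<sigma> i \<ge> 0"
  shows "cone_prob \<sigma> A \<le> m"
proof (cases "A < card {i\<in>{1..n}. \<sigma> i > 0}")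
  case True
  have "A > 0" using A by simp
  from cone_prob_eq_cone_mass[OF \<sigma> this True] obtain x where
    x: "\<And>i. i \<in> {1..n} \<Longrightarrow> 0 \<le> x i" "\<And>i. i \<in> {1..n} \<Longrightarrow> x i < 1" "(\<Sum>i=1..n. x i) = A"
    and eqx: "cone_prob \<sigma> A = cone_mass {1..n} x" by blast
  have "cone_mass {1..n} x \<le> m"
  proof (rule cone_mass_le_equal_mass[OF A m])
    show "equal_mass A k \<le> m" if "A < real k" "k \<le> card {1..n}" for k
      using eq[of k] that by simp
  qed (use x in \<open>auto intro: less_imp_le\<close>)
  then show ?thesis by (simp add: eqx)
next
  case False
  then show ?thesis using cone_prob_eq_0[OF \<sigma>] m by simp
qed

text \<open>
  The formula for the maximum needs \<open>A > 1\<close>. The event for \<open>A = 1\<close> is the increasing union of the events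
  for \<open>A = 1 + 1 / (j + 1)\<close>, and for these the maximum is at most \<open>1 / 2\<close>.
\<close>

lemma cone_prob_1_le:
  assumes \<sigma>: "\<And>i. i \<in> {1..n} \<Longrightarrow> \<sigma> i \<ge> 0"
  shows "cone_prob \<sigma> 1 \<le> 1 / 2"
proof -
  define A where "A = (\<lambda>j. 1 + 1 / real (Suc j))"
  have A1: "A j > 1" for j by (simp add: A_def)
  define L where "L = (\<lambda>\<omega>. (\<Sum>i=1..n. \<sigma> i * Z i \<omega>)\<^sup>2)"
  define V where "V = (\<lambda>\<omega>. \<Sum>i=1..n. (\<sigma> i)\<^sup>2 * (Z i \<omega>)\<^sup>2)"
  have [measurable]: "L \<in> borel_measurable M" "V \<in> borel_measurable M" unfolding L_def V_def by measurable
  have V0: "V \<omega> \<ge> 0" for \<omega> unfolding V_def by (intro sum_nonneg) simp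
  define E where "E = (\<lambda>j. {\<omega> \<in> space M. L \<omega> > A j * V \<omega>})"
  have le: "cone_prob \<sigma> (A j) \<le> 1 / 2" for j
  proof (rule cone_prob_le_equal_mass[OF A1 _ _ \<sigma>])
    fix k assume k: "A j < real k" "k \<le> n"
    have "real k > 1" using k A1[of j] by simp
    then have k2: "k \<ge> 2" by simp
    then have k1: "k \<in> {1..n}" using k by auto
    have "equal_mass (A j) k = cone_prob (first k) (A j)"
      using cone_prob_first[OF k1 _ k(1)] A1[of j] by simp
    also have "\<dots> \<le> cone_prob (first k) 1" using A1[of j] by (intro cone_prob_antimono) simp
    also have "\<dots> = equal_mass 1 k" using k2 by (intro cone_prob_first k1) auto
    also have "\<dots> \<le> 1 / 2" by (rule equal_mass_1_le[OF k2])
    finally show "equal_mass (A j) k \<le> 1 / 2" .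
  qed simp
  have "incseq E"
  proof (rule incseq_SucI)
    fix j
    have "A (Suc j) * V \<omega> \<le> A j * V \<omega>" for \<omega>
      using V0 by (intro mult_right_mono) (auto simp: A_def frac_le)
    then show "E j \<le> E (Suc j)" unfolding E_def by (auto intro: le_less_trans)
  qed
  then have lim: "(\<lambda>j. measure M (E j)) \<longlonglongrightarrow> measure M (\<Union>j. E j)"
    by (intro finite_Lim_measure_incseq) (auto simp: E_def)
  have "(\<Union>j. E j) = {\<omega> \<in> space M. L \<omega> > 1 * V \<omega>}"
  proof (intro equalityI subsetI)
    fix \<omega> assume "\<omega> \<in> (\<Union>j. E j)"
    then obtain j where j: "\<omega> \<in> space M" "L \<omega> > A j * V \<omega>" by (auto simp: E_def)
    have "1 * V \<omega> \<le> A j * V \<omega>" using V0 A1[of j] by (intro mult_right_mono) auto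
    then show "\<omega> \<in> {\<omega> \<in> space M. L \<omega> > 1 * V \<omega>}" using j by auto
  next
    fix \<omega> assume \<omega>: "\<omega> \<in> {\<omega> \<in> space M. L \<omega> > 1 * V \<omega>}"
    have "A \<longlonglongrightarrow> 1 + 0" unfolding A_def
      by (intro tendsto_add tendsto_const LIMSEQ_Suc[OF lim_1_over_n])
    then have "(\<lambda>j. A j * V \<omega>) \<longlonglongrightarrow> (1 + 0) * V \<omega>" by (intro tendsto_mult tendsto_const)
    then have "\<forall>\<^sub>F j in sequentially. A j * V \<omega> < L \<omega>" using \<omega> by (intro order_tendstoD) auto
    then obtain j where "A j * V \<omega> < L \<omega>" by (auto simp: eventually_sequentially)
    then show "\<omega> \<in> (\<Union>j. E j)" using \<omega> by (auto simp: E_def)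
  qed
  then have "measure M (\<Union>j. E j) = cone_prob \<sigma> 1" by (simp add: cone_prob_def L_def V_def)
  moreover have "measure M (E j) \<le> 1 / 2" for j using le[of j] by (simp add: E_def cone_prob_def L_def V_def)
  ultimately show ?thesis using lim by (metis LIMSEQ_le_const2)
qed

abbreviation scales :: "(nat \<Rightarrow> real) set" where
  "scales \<equiv> {\<sigma>. (\<forall>i\<in>{1..n}. \<sigma> i \<ge> 0) \<and> (\<exists>i\<in>{1..n}. \<sigma> i > 0)}"

lemma first_in_scales: "k \<in> {1..n} \<Longrightarrow> first k \<in> scales"
  by (auto intro!: bexI[of _ 1])

text \<open>
  The supremum is attained in every case of the theorem.
\<close>

lemma tG_eqI:
  assumes "\<sigma>0 \<in> scales" "cone_prob \<sigma>0 (a\<^sup>2) = s"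
    and "\<And>\<sigma>. \<sigma> \<in> scales \<Longrightarrow> cone_prob \<sigma> (a\<^sup>2) \<le> s"
  shows "tG M Z n a = 1 - s / 2"
proof -
  have "(SUP \<sigma>\<in>scales. cone_prob \<sigma> (a\<^sup>2)) = s"
    using assms by (intro cSup_eq_maximum) auto
  then show ?thesis unfolding tG_def ratio_event_eq_cone_prob by simp
qed

lemma tG_lt_1:
  assumes "0 \<le> a" "a < 1"
  shows "tG M Z n a = 1 / 2"
proof -
  define A where "A = max (a\<^sup>2) (1 / 2)"
  have A: "0 < A" "A < real 1" "a\<^sup>2 \<le> A" using assms by (auto simp: A_def power_less_one_iff abs_square_less_1)
  have 1: "1 \<in> {1..n}" using n by auto
  have "equal_mass A 1 = 1"
  proof -
    have "(\<integral>y. 1 / (1 + y\<^sup>2) \<partial>lborel) = pi"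
      using nn_integral_inverse_1_plus_square by (intro integral_eq_nn_integral[THEN trans]) (auto simp: add_nonneg_nonneg)
    then show ?thesis by (simp add: equal_mass_def equal_kernel_def)
  qed
  then have "1 \<le> cone_prob (first 1) (a\<^sup>2)"
    using cone_prob_first[OF 1 A(1,2)] cone_prob_antimono[OF A(3), of "first 1"] by simp
  moreover have le1: "cone_prob \<sigma> (a\<^sup>2) \<le> 1" for \<sigma> unfolding cone_prob_def by simp
  ultimately have "cone_prob (first 1) (a\<^sup>2) = 1" by (simp add: order_antisym)
  from tG_eqI[OF first_in_scales[OF 1] this] le1 show ?thesis by simp
qed

lemma tG_eq_1: "tG M Z n 1 = 3 / 4"
proof -
  have 2: "2 \<in> {1..n}" using n by auto
  have "cone_prob (first 2) (1\<^sup>2) = 1 / 2"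
    using cone_prob_first[OF 2, of 1] equal_mass_1_2 by simp
  from tG_eqI[OF first_in_scales[OF 2] this] cone_prob_1_le show ?thesis by simp
qed

lemma tG_ge_sqrt:
  assumes "a \<ge> sqrt (real n)"
  shows "tG M Z n a = 1"
proof -
  have 1: "1 \<in> {1..n}" using n by auto
  have "real n \<le> a\<^sup>2" by (rule sqrt_le_D[OF assms])
  have zero: "cone_prob \<sigma> (a\<^sup>2) = 0" if "\<sigma> \<in> scales" for \<sigma>
  proof (rule cone_prob_eq_0)
    have "card {i\<in>{1..n}. \<sigma> i > 0} \<le> card {1..n}" by (intro card_mono) auto
    then show "real (card {i\<in>{1..n}. \<sigma> i > 0}) \<le> a\<^sup>2" using \<open>real n \<le> a\<^sup>2\<close> by simp
  qed (use that in auto)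
  then show ?thesis using tG_eqI[OF first_in_scales[OF 1] zero[OF first_in_scales[OF 1]]] by simp
qed

lemma tG_middle:
  assumes a: "1 < a" "a < sqrt (real n)"
  defines "K \<equiv> {k::nat. a\<^sup>2 < real k \<and> k \<le> n}"
  shows "finite K" "K \<subseteq> {1..n}" "n \<in> K"
    and "1 - tG M Z n a = Max ((\<lambda>k. equal_mass (a\<^sup>2) k / 2) ` K)"
    and "1 - tG M Z n a = Max ((\<lambda>k. \<P>(\<omega> in M. (\<Sum>i=1..k. Z i \<omega>) / sqrt (\<Sum>i=1..k. (Z i \<omega>)\<^sup>2) \<ge> a)) ` {1..n})"
proof -
  have a2: "1 < a\<^sup>2" using a by (simp add: one_less_power)
  have "a\<^sup>2 < (sqrt (real n))\<^sup>2" using a by (intro power_strict_mono) auto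
  then have "a\<^sup>2 < real n" by simp
  then show nK: "n \<in> K" by (simp add: K_def)
  show fin: "finite K" unfolding K_def by (rule finite_subset[of _ "{..n}"]) auto
  show sub: "K \<subseteq> {1..n}"
  proof
    fix k assume "k \<in> K"
    then have "real k > 1" "k \<le> n" using a2 by (auto simp: K_def)
    then show "k \<in> {1..n}" by auto
  qed
  define s where "s = Max (equal_mass (a\<^sup>2) ` K)"
  have cf: "cone_prob (first k) (a\<^sup>2) = equal_mass (a\<^sup>2) k" if "k \<in> K" for k
    using that sub a2 by (intro cone_prob_first) (auto simp: K_def)
  have le_s: "equal_mass (a\<^sup>2) k \<le> s" if "k \<in> K" for k
    unfolding s_def using fin that by simp
  have "s \<in> equal_mass (a\<^sup>2) ` K" unfolding s_def using fin nK by (intro Max_in) auto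
  then obtain k0 where k0: "k0 \<in> K" "equal_mass (a\<^sup>2) k0 = s" by auto
  have s0: "s \<ge> 0" unfolding k0(2)[symmetric] cf[OF k0(1), symmetric] cone_prob_def by simp
  have le: "cone_prob \<sigma> (a\<^sup>2) \<le> s" if "\<sigma> \<in> scales" for \<sigma>
  proof (rule cone_prob_le_equal_mass[OF a2 s0])
    show "equal_mass (a\<^sup>2) k \<le> s" if "a\<^sup>2 < real k" "k \<le> n" for k
      using le_s[of k] that by (simp add: K_def)
  qed (use that in auto)
  have k0n: "k0 \<in> {1..n}" using k0(1) sub by blast
  have "cone_prob (first k0) (a\<^sup>2) = s" unfolding cf[OF k0(1)] by (rule k0(2))
  from tG_eqI[OF first_in_scales[OF k0n] this le] have "tG M Z n a = 1 - s / 2" .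
  then have tG: "1 - tG M Z n a = s / 2" by simp
  show "1 - tG M Z n a = Max ((\<lambda>k. equal_mass (a\<^sup>2) k / 2) ` K)"
    unfolding tG using fin k0 le_s by (intro Max_eqI[symmetric]) auto
  show "1 - tG M Z n a = Max ((\<lambda>k. \<P>(\<omega> in M. (\<Sum>i=1..k. Z i \<omega>) / sqrt (\<Sum>i=1..k. (Z i \<omega>)\<^sup>2) \<ge> a)) ` {1..n})"
    unfolding tG
  proof (rule Max_eqI[symmetric])
    show "s / 2 \<in> (\<lambda>k. \<P>(\<omega> in M. (\<Sum>i=1..k. Z i \<omega>) / sqrt (\<Sum>i=1..k. (Z i \<omega>)\<^sup>2) \<ge> a)) ` {1..n}"
    proof (rule image_eqI)
      show "k0 \<in> {1..n}" using k0 sub by auto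
      then show "s / 2 = \<P>(\<omega> in M. (\<Sum>i=1..k0. Z i \<omega>) / sqrt (\<Sum>i=1..k0. (Z i \<omega>)\<^sup>2) \<ge> a)"
        by (simp only: equal_weights_tail[OF k0n a(1)] cf[OF k0(1)] k0(2))
    qed
    fix y assume "y \<in> (\<lambda>k. \<P>(\<omega> in M. (\<Sum>i=1..k. Z i \<omega>) / sqrt (\<Sum>i=1..k. (Z i \<omega>)\<^sup>2) \<ge> a)) ` {1..n}"
    then obtain k where k: "k \<in> {1..n}" and y: "y = \<P>(\<omega> in M. (\<Sum>i=1..k. Z i \<omega>) / sqrt (\<Sum>i=1..k. (Z i \<omega>)\<^sup>2) \<ge> a)" by blast
    show "y \<le> s / 2" unfolding y equal_weights_tail[OF k a(1)] using le[OF first_in_scales[OF k]] by simp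
  qed simp
qed

end

theorem theorem3p1:
  fixes M :: "'a measure" and Z :: "nat \<Rightarrow> 'a \<Rightarrow> real"
    and N :: "nat \<Rightarrow> 'b measure" and T :: "nat \<Rightarrow> 'b \<Rightarrow> real"
    and n :: nat
  assumes "n > 1"
    and "prob_space M"
    and "prob_space.indep_vars M (\<lambda>_. borel) Z {1..n}"
    and "\<And>i. i \<in> {1..n} \<Longrightarrow> distributed M lborel (Z i) (\<lambda>x. ennreal (std_normal_density x))"
    and "\<And>\<nu>. \<nu> \<in> {1..n - 1} \<Longrightarrow> prob_space (N \<nu>)"
    and "\<And>\<nu>. \<nu> \<in> {1..n - 1} \<Longrightarrow>
           distributed (N \<nu>) lborel (T \<nu>) (\<lambda>x. ennreal (student_t_density \<nu> x))"
  shows "(\<forall>a::real. 0 \<le> a \<and> a < 1 \<longrightarrow> tG M Z n a = 1 / 2) \<and>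
    tG M Z n 1 = 3 / 4 \<and>
    (\<forall>a::real. a \<ge> sqrt (real n) \<longrightarrow> tG M Z n a = 1) \<and>
    (\<forall>a::real. 1 < a \<and> a < sqrt (real n) \<longrightarrow>
       1 - tG M Z n a =
         Max ((\<lambda>k. \<P>(\<omega> in M. (\<Sum>i=1..k. Z i \<omega>) / sqrt (\<Sum>i=1..k. (Z i \<omega>)\<^sup>2) \<ge> a)) ` {1..n}) \<and>
       1 - tG M Z n a =
         Max ((\<lambda>k. \<P>(x in N (k - 1).
                 T (k - 1) x > sqrt (a\<^sup>2 * (real k - 1) / (real k - a\<^sup>2))))
              ` {k::nat. a\<^sup>2 < real k \<and> k \<le> n}))"
proof -
  interpret independent_normals M Z n
    by (rule independent_normals.intro[OF assms(2) independent_normals_axioms.intro[OF assms(1,3,4)]])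
  have student: "1 - tG M Z n a =
      Max ((\<lambda>k. \<P>(x in N (k - 1). T (k - 1) x > sqrt (a\<^sup>2 * (real k - 1) / (real k - a\<^sup>2))))
              ` {k::nat. a\<^sup>2 < real k \<and> k \<le> n})" if a: "1 < a" "a < sqrt (real n)" for a
  proof -
    have a2: "1 < a\<^sup>2" using a by (simp add: one_less_power)
    have "\<P>(x in N (k - 1). T (k - 1) x > sqrt (a\<^sup>2 * (real k - 1) / (real k - a\<^sup>2))) = equal_mass (a\<^sup>2) k / 2"
      if k: "k \<in> {k::nat. a\<^sup>2 < real k \<and> k \<le> n}" for k
    proof -
      have "real k > 1" "k \<le> n" using k a2 by auto
      then have "k - 1 \<in> {1..n - 1}" by auto
      then show ?thesis using k a2 by (intro student_t_tail_eq_equal_mass assms(5,6)) auto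
    qed
    then show ?thesis unfolding tG_middle(4)[OF a] by (intro arg_cong[where f = Max] image_cong) auto
  qed
  show ?thesis
  proof (intro conjI allI impI)
    fix a :: real
    assume "1 < a \<and> a < sqrt (real n)"
    then have a: "1 < a" "a < sqrt (real n)" by auto
    show "1 - tG M Z n a = Max ((\<lambda>k. \<P>(\<omega> in M. (\<Sum>i=1..k. Z i \<omega>) / sqrt (\<Sum>i=1..k. (Z i \<omega>)\<^sup>2) \<ge> a)) ` {1..n})"
      by (rule tG_middle(5)[OF a])
    show "1 - tG M Z n a =
        Max ((\<lambda>k. \<P>(x in N (k - 1). T (k - 1) x > sqrt (a\<^sup>2 * (real k - 1) / (real k - a\<^sup>2))))
              ` {k::nat. a\<^sup>2 < real k \<and> k \<le> n})"
      by (rule student[OF a])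
  qed (simp_all add: tG_lt_1 tG_eq_1 tG_ge_sqrt)
qed

end
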